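(* Assume $B_0>0$ and $B_m<\infty$ for all $m\in\mathbb N^*=\{1,2,\dots\}$, let $u_0\in H^1$ and let $u=u(t;u_0)$ be the solution of the stochastic Burgers equation with viscosity $\nu$. Let $c_*,c_1,c_2>0$ be the constants described in the context. If the constant $M$ in the definition of $E_k$ is sufficiently large (independently of $\nu$), then there exist $c_3,c_4>0$, independent of $\nu$ and $k$, such that for all $\nu\in(0,c_*]$ and all positive integers $k$ satisfying $$c_2^{-1}\le k\le (c_1\nu)^{-1}$$ one has $$c_3k^{-2}\le E_k\le c_4k^{-2}.$$
   Context: $\mathbb S^1=\mathbb R/\mathbb Z$. $H=\{v\in L_2(\mathbb S^1;\mathbb R):\int_{\mathbb S^1} v\,dx=0\}$ with the $L_2$ norm $\|\cdot\|$ and orthonormal basis $e_s=\sqrt2\cos(2\pi s x)$, $e_{-s}=\sqrt2\sin(2\pi s x)$, $s\in\mathbb N^*$. $H^1=\{u\in H:u_x\in H\}$, $\|u\|_1=\|u_x\|$. Force: $(b_s)_{s\in\mathbb Z^*}$ are real numbers, $(\beta_s)_{s\in\mathbb Z^*}$ independent standard Wiener processes on a probability space $(\Omega,\mathcal F,\mathbb P)$, $\xi^\omega(t,x)=\sum_{s\in\mathbb Z^*}b_s\beta_s^\omega(t)e_s(x)$, and $B_m=\sum_{s\in\mathbb Z^*}|s|^{2m}b_s^2$. Equation: for $\nu\in(0,1]$ and $u_0\in H^1$, $u(t)=u^\omega(t;u_0)$ denotes the solution of $u_t+uu_x-\nu u_{xx}=\partial_t\xi^\omega$, $u(0)=u_0$,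 on $\mathbb S^1$, meaning: for almost every $\omega$, $u\in C([0,\infty);H^1)$ and $u(t)-u_0+\int_0^t(uu_x-\nu u_{xx})\,ds=\xi^\omega(t)$ for all $t\ge0$. (It exists and is unique.) Write $u(t,x)=\sum_{s\in\mathbb Z^*}u_s(t)e_s(x)$. Averaging: fix $T\ge1$ and $\sigma\ge\sigma_0$ (independent of $\nu$), where $\sigma_0=\sigma_0(B_0,B_4)>0$ is a fixed constant such that for all $\sigma\ge\sigma_0$, $T\ge1$, $\nu\in(0,1]$, $u_0\in H^1$ one has $\frac14B_0\le\frac{\nu}{\sigma}\int_T^{T+\sigma}\mathbb E[\|u(s;u_0)\|_1^2]\,ds\le\frac34B_0$ (such a constant exists). For a real random process $\zeta^\omega(t)$, $\langle\langle\zeta\rangle\rangle=\frac1\sigma\int_T^{T+\sigma}\mathbb E[\zeta^\omega(t)]\,dt$. Constants $c_*,c_1,c_2$: for $p>0$ let $S_p(l)=\langle\langle\int_{\mathbb S^1}|u(x+l)-u(x)|^pdx\rangle\rangle$. The constants $c_*\in(0,1]$, $c_1,c_2>0$ (independent of $\nu$) are fixed so that for every $p>0$ there is $c_p'>0$ with $S_p(l)\ge c_p'l^{\min(1,p)}$ for all $l\in[c_1\nu,c_2]$ and $\nu\in(0,c_*]$ (such constants exist). Energy at wave number $k$: for a constant $M>1$ independent of $\nu$, $$E_k=\frac{1}{2k(M-M^{-1})}\sum_{M^{-1}k\le|n|\le Mk}\frac12\langle\langle|u_n|^2\rangle\rangle .$$ *)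

theory Defs
  imports "HOL-Probability.Probability"
begin

section \<open>Function spaces on the circle\<close>

text \<open>
  Functions on the circle \<open>\<real>/\<int>\<close> are 1-periodic functions on \<open>\<real>\<close>, integrated over one period.
  Elements of \<open>L\<^sub>2\<close> are given by representatives; all notions below depend only on the class
  of a function modulo equality almost everywhere.
\<close>

definition circle_integral :: "(real \<Rightarrow> real) \<Rightarrow> real" where
  "circle_integral f = (LINT x:{0..1}|lborel. f x)"

definition H_space :: "(real \<Rightarrow> real) set" where
  "H_space = {v. v \<in> borel_measurable borel \<and> (\<forall>x. v (x + 1) = v x) \<and>
                 set_integrable lborel {0..1} (\<lambda>x. (v x)\<^sup>2) \<and> circle_integral v = 0}"

definition H_norm :: "(real \<Rightarrow> real) \<Rightarrow> real" where
  "H_norm v = sqrt (circle_integral (\<lambda>x. (v x)\<^sup>2))"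

definition weak_derivative :: "(real \<Rightarrow> real) \<Rightarrow> (real \<Rightarrow> real) \<Rightarrow> bool" where
  "weak_derivative u g \<longleftrightarrow>
     (\<forall>\<phi> \<phi>'. (\<forall>x. \<phi> (x + 1) = \<phi> x) \<and> (\<forall>x. (\<phi> has_real_derivative \<phi>' x) (at x)) \<and>
             continuous_on UNIV \<phi>' \<longrightarrow>
        circle_integral (\<lambda>x. u x * \<phi>' x) = - circle_integral (\<lambda>x. g x * \<phi> x))"

definition H1_space :: "(real \<Rightarrow> real) set" where
  "H1_space = {u \<in> H_space. \<exists>g \<in> H_space. weak_derivative u g}"

text \<open>The weak derivative of an element of \<open>H\<^sup>1\<close>; it is unique almost everywhere.\<close>

definition dx :: "(real \<Rightarrow> real) \<Rightarrow> real \<Rightarrow> real" where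
  "dx u = (SOME g. g \<in> H_space \<and> weak_derivative u g)"

definition H1_norm :: "(real \<Rightarrow> real) \<Rightarrow> real" where
  "H1_norm u = H_norm (dx u)"

definition continuous_H1_path :: "(real \<Rightarrow> real \<Rightarrow> real) \<Rightarrow> bool" where
  "continuous_H1_path v \<longleftrightarrow>
     (\<forall>t\<ge>0. v t \<in> H1_space \<and>
            ((\<lambda>s. H1_norm (\<lambda>x. v s x - v t x)) \<longlongrightarrow> 0) (at t within {0..}))"

text \<open>The trigonometric basis, indexed by the nonzero integers (the value at index 0 is unused).\<close>

definition trig_basis :: "int \<Rightarrow> real \<Rightarrow> real" where
  "trig_basis s x = (if s > 0 then sqrt 2 * cos (2 * pi * of_int s * x)
                     else sqrt 2 * sin (2 * pi * of_int (- s) * x))"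

definition fourier_coeff :: "(real \<Rightarrow> real) \<Rightarrow> int \<Rightarrow> real" where
  "fourier_coeff v s = circle_integral (\<lambda>x. v x * trig_basis s x)"


section \<open>The random force\<close>

definition standard_wiener :: "'w measure \<Rightarrow> (real \<Rightarrow> 'w \<Rightarrow> real) \<Rightarrow> bool" where
  "standard_wiener P w \<longleftrightarrow>
     (\<forall>t\<ge>0. w t \<in> borel_measurable P) \<and>
     (AE \<omega> in P. w 0 \<omega> = 0 \<and> continuous_on {0..} (\<lambda>t. w t \<omega>)) \<and>
     (\<forall>s t. 0 \<le> s \<and> s < t \<longrightarrow>
        distributed P lborel (\<lambda>\<omega>. w t \<omega> - w s \<omega>) (normal_density 0 (sqrt (t - s)))) \<and>
     (\<forall>\<tau> :: nat \<Rightarrow> real. 0 \<le> \<tau> 0 \<and> mono \<tau> \<longrightarrow>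
        prob_space.indep_vars P (\<lambda>_. borel) (\<lambda>i \<omega>. w (\<tau> (Suc i)) \<omega> - w (\<tau> i) \<omega>) UNIV)"

text \<open>
  Independence is that of the whole processes, as random elements of \<open>\<real>\<^bsup>[0,\<infinity>)\<^esup>\<close>.
\<close>

definition independent_wieners :: "'w measure \<Rightarrow> (int \<Rightarrow> real \<Rightarrow> 'w \<Rightarrow> real) \<Rightarrow> bool" where
  "independent_wieners P \<beta> \<longleftrightarrow>
     (\<forall>s\<in>-{0}. standard_wiener P (\<beta> s)) \<and>
     prob_space.indep_vars P (\<lambda>_. PiM {0..} (\<lambda>_. borel))
       (\<lambda>s \<omega>. restrict (\<lambda>t. \<beta> s t \<omega>) {0..}) (-{0})"

text \<open>
  When all \<open>B\<^sub>m\<close> are finite, the series for the force converges absolutely for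
  all \<open>t\<close> and \<open>x\<close>, almost surely.
\<close>

definition force :: "(int \<Rightarrow> real) \<Rightarrow> (int \<Rightarrow> real \<Rightarrow> 'w \<Rightarrow> real) \<Rightarrow> real \<Rightarrow> 'w \<Rightarrow> real \<Rightarrow> real" where
  "force b \<beta> t \<omega> x = (\<Sum>\<^sub>\<infinity>s\<in>-{0}. b s * \<beta> s t \<omega> * trig_basis s x)"

definition B_finite :: "(int \<Rightarrow> real) \<Rightarrow> nat \<Rightarrow> bool" where
  "B_finite b m \<longleftrightarrow> (\<lambda>s. \<bar>of_int s\<bar> ^ (2 * m) * (b s)\<^sup>2 :: real) summable_on (-{0})"

definition B :: "(int \<Rightarrow> real) \<Rightarrow> nat \<Rightarrow> real" where
  "B b m = (\<Sum>\<^sub>\<infinity>s\<in>-{0}. \<bar>of_int s\<bar> ^ (2 * m) * (b s)\<^sup>2)"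


section \<open>Solutions of the stochastic Burgers equation\<close>

text \<open>
  For \<open>v\<close> continuous with values in \<open>H\<^sup>1\<close>, the terms of
  \[ v(t) - u_0 + \int_0^t (v v_x - \nu v_{xx})\,ds = \xi(t) \]
  lie in the dual space of \<open>H\<^sup>1\<close>: the equality means that both sides agree on every
  \<open>\<phi> \<in> H\<^sup>1\<close>, where \<open>v\<^sub>x\<^sub>x\<close> acts by \<open>\<langle>v\<^sub>x\<^sub>x, \<phi>\<rangle> = - \<langle>v\<^sub>x, \<phi>\<^sub>x\<rangle>\<close>.
\<close>

definition burgers_path ::
    "real \<Rightarrow> (real \<Rightarrow> real) \<Rightarrow> (real \<Rightarrow> real \<Rightarrow> real) \<Rightarrow> (real \<Rightarrow> real \<Rightarrow> real) \<Rightarrow> bool" where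
  "burgers_path \<nu> u\<^sub>0 \<xi> v \<longleftrightarrow>
     continuous_H1_path v \<and> (AE x in lborel. v 0 x = u\<^sub>0 x) \<and>
     (\<forall>t\<ge>0. \<forall>\<phi>\<in>H1_space.
        circle_integral (\<lambda>x. (v t x - u\<^sub>0 x) * \<phi> x) +
        (LINT s:{0..t}|lborel. circle_integral (\<lambda>x. v s x * dx (v s) x * \<phi> x) +
                               \<nu> * circle_integral (\<lambda>x. dx (v s) x * dx \<phi> x)) =
        circle_integral (\<lambda>x. \<xi> t x * \<phi> x))"

text \<open>
  The first two conditions say that \<open>u(t)\<close> is a random variable with values in \<open>H\<close>, for each \<open>t\<close>.
  They are stated separately because the probability space need not be complete: values on a
  non-measurable null set could otherwise make the expectations below ill-defined.
\<close>

definition burgers_solution ::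
    "'w measure \<Rightarrow> (int \<Rightarrow> real) \<Rightarrow> (int \<Rightarrow> real \<Rightarrow> 'w \<Rightarrow> real) \<Rightarrow> real \<Rightarrow> (real \<Rightarrow> real) \<Rightarrow>
     (real \<Rightarrow> 'w \<Rightarrow> real \<Rightarrow> real) \<Rightarrow> bool" where
  "burgers_solution P b \<beta> \<nu> u\<^sub>0 u \<longleftrightarrow>
     (\<forall>t\<ge>0. \<forall>\<omega>\<in>space P. u t \<omega> \<in> H_space) \<and>
     (\<forall>t\<ge>0. \<forall>s\<in>-{0}. (\<lambda>\<omega>. fourier_coeff (u t \<omega>) s) \<in> borel_measurable P) \<and>
     (AE \<omega> in P. burgers_path \<nu> u\<^sub>0 (\<lambda>t. force b \<beta> t \<omega>) (\<lambda>t. u t \<omega>))"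


section \<open>Averages, structure functions and energy spectrum\<close>

definition bracket :: "'w measure \<Rightarrow> real \<Rightarrow> real \<Rightarrow> (real \<Rightarrow> 'w \<Rightarrow> real) \<Rightarrow> real" where
  "bracket P T \<sigma> \<zeta> = 1 / \<sigma> * (LINT t:{T..T + \<sigma>}|lborel. (LINT \<omega>|P. \<zeta> t \<omega>))"

definition structure_function ::
    "'w measure \<Rightarrow> real \<Rightarrow> real \<Rightarrow> (real \<Rightarrow> 'w \<Rightarrow> real \<Rightarrow> real) \<Rightarrow> real \<Rightarrow> real \<Rightarrow> real" where
  "structure_function P T \<sigma> u p l =
     bracket P T \<sigma> (\<lambda>t \<omega>. circle_integral (\<lambda>x. \<bar>u t \<omega> (x + l) - u t \<omega> x\<bar> powr p))"

definition energy ::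
    "'w measure \<Rightarrow> real \<Rightarrow> real \<Rightarrow> (real \<Rightarrow> 'w \<Rightarrow> real \<Rightarrow> real) \<Rightarrow> real \<Rightarrow> nat \<Rightarrow> real" where
  "energy P T \<sigma> u M k =
     1 / (2 * real k * (M - 1 / M)) *
     (\<Sum>n | real k / M \<le> \<bar>real_of_int n\<bar> \<and> \<bar>real_of_int n\<bar> \<le> M * real k.
        1 / 2 * bracket P T \<sigma> (\<lambda>t \<omega>. \<bar>fourier_coeff (u t \<omega>) n\<bar>\<^sup>2))"

end

(*
  Since the initial value and the averaging window are fixed, it suffices to bound the total variation of u(t)
  on a bounded time interval uniformly in the viscosity. For the difference d of two translates of u - xi, the
  L1 norm of d is controlled by Kruzhkov's argument: the transport term drops out, the viscous term has a sign, and
  the force enters only through its spatial derivatives. Gronwall's inequality then bounds the variation of u(t) by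
  C exp(c G), where G bounds the third derivatives of the force, and exp(c G) is integrable because the force is
  Gaussian. Consequently |u_n| <= K / |n| with K square integrable, which gives the upper bound. For the lower
  bound, by Parseval the second structure function at distance 1/k is the sum of 4 sin(pi n / k)^2 |u_n|^2, to which
  the wave numbers below k/M and above Mk contribute at most C / (M k), whereas the whole sum is at least c / k.
*)

theory Submission
  imports Defs
begin

text \<open>The solution is merely continuous in time with values in H^1; it is not differentiable
  in time and satisfies its equation only against test functions from H^1. Three choices answer
  this. Subtracting the force gives \<open>z\<close>, whose increments are time integrals.
  Differences of two translates replace the spatial derivative, because a smoothed sign of such a
  difference is again an admissible test function, whereas one of the derivative need not be; the
  variation is recovered from small spacings. Finally, no chain rule in time is used: by convexity
  the increment of the regularized L1 norm over a short time step is at most the tested equation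
  with the test function frozen at the end of the step, and continuity of the path makes the error
  of also freezing the equation negligible. The smoothing parameter and the time step may depend on
  the viscosity, since both disappear from the final bound. The exponent in Gronwall's bound is
  linear in the size of the force, and this is what keeps its expectation finite: the supremum over
  time of the Gaussian series has exponential moments of first order.\<close>

section \<open>Periodic functions\<close>

lemmas hk_integral_add = Henstock_Kurzweil_Integration.integral_add
lemmas hk_integral_diff = Henstock_Kurzweil_Integration.integral_diff
lemmas hk_integral_combine = Henstock_Kurzweil_Integration.integral_combine

definition per :: "(real \<Rightarrow> real) \<Rightarrow> bool" where
  "per f \<longleftrightarrow> (\<forall>x. f (x + 1) = f x)"

text \<open>Integrability is demanded on every interval rather than on one period, so that
  translates and shifted windows stay in the class at once; \<open>per_set_integrable\<close>
  recovers it from one period.\<close>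

definition L1p :: "(real \<Rightarrow> real) \<Rightarrow> bool" where
  "L1p f \<longleftrightarrow> f \<in> borel_measurable borel \<and> per f \<and> (\<forall>a b. set_integrable lborel {a..b} f)"

definition L2p :: "(real \<Rightarrow> real) \<Rightarrow> bool" where
  "L2p f \<longleftrightarrow> f \<in> borel_measurable borel \<and> per f \<and> (\<forall>a b. set_integrable lborel {a..b} (\<lambda>x. (f x)\<^sup>2))"

definition cper :: "(real \<Rightarrow> real) \<Rightarrow> bool" where
  "cper f \<longleftrightarrow> continuous_on UNIV f \<and> per f"

text \<open>\<open>ac f g\<close>: the function \<open>f\<close> is absolutely continuous with derivative \<open>g \<in> L\<^sub>2\<close>; this is the continuous
  representative of an element of \<open>H\<^sup>1\<close> (up to a constant).\<close>

definition ac :: "(real \<Rightarrow> real) \<Rightarrow> (real \<Rightarrow> real) \<Rightarrow> bool" where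
  "ac f g \<longleftrightarrow> per f \<and> L2p g \<and> (\<forall>a b. a \<le> b \<longrightarrow> (g has_integral (f b - f a)) {a..b})"

lemma per_int: assumes "per f" shows "f (x + of_int n) = f x"
proof -
  have 1: "f (x + real m) = f x" for m x
    by (induction m) (use assms in \<open>auto simp: per_def add.assoc[symmetric] add.commute[of 1]\<close>)
  show ?thesis
  proof (cases "n \<ge> 0")
    case True
    then show ?thesis using 1[of x "nat n"] by simp
  next
    case False
    then show ?thesis using 1[of "x + of_int n" "nat (-n)"] by simp
  qed
qed

lemma per_frac: "per f \<Longrightarrow> f (frac x) = f x"
  using per_int[of f "frac x" "floor x"] by (simp add: frac_def)

lemma set_integrable_shift:
  fixes f :: "real \<Rightarrow> real"
  assumes "set_integrable lborel {a + h..b + h} f"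
  shows "set_integrable lborel {a..b} (\<lambda>x. f (x + h))"
proof -
  have "integrable lborel (\<lambda>x. indicator {a+h..b+h} (h + 1 * x) *\<^sub>R f (h + 1 * x))"
    using assms unfolding set_integrable_def
    by (intro lborel_integrable_real_affine) auto
  moreover have "(\<lambda>x. indicator {a+h..b+h} (h + 1 * x) *\<^sub>R f (h + 1 * x)) = (\<lambda>x. indicator {a..b} x *\<^sub>R f (x + h))"
    by (auto simp: indicator_def algebra_simps)
  ultimately show ?thesis unfolding set_integrable_def by simp
qed

lemma per_set_integrable:
  assumes p: "per f" and i: "set_integrable lborel {0..1} f"
  shows "set_integrable lborel {a..b} f"
proof -
  have 1: "set_integrable lborel {of_int n..of_int n + 1} f" for n :: int
  proof -
    have "(\<lambda>x. f (x + of_int (- n))) = f" using per_int[OF p] by blast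
    then show ?thesis using set_integrable_shift[of "of_int n" "of_int (-n)" "of_int n + 1" f] i by simp
  qed
  have 2: "set_integrable lborel {of_int m..of_int m + real n} f" for m n
  proof (induction n)
    case 0
    then show ?case using set_integrable_subset[OF 1[of m], of "{of_int m..of_int m + real 0}"] by auto
  next
    case (Suc n)
    have "set_integrable lborel ({of_int m..of_int m + real n} \<union> {of_int (m + int n)..of_int (m + int n)+1}) f"
      by (intro set_integrable_Un Suc 1) auto
    moreover have "{of_int m..of_int m + real n} \<union> {of_int (m + int n)..of_int (m + int n)+1} = {of_int m..of_int m + real (Suc n)}"
      by auto
    ultimately show ?case by simp
  qed
  obtain n where n: "b - of_int \<lfloor>a\<rfloor> \<le> real n" using real_arch_simple by blast
  have "{a..b} \<subseteq> {of_int \<lfloor>a\<rfloor>..of_int \<lfloor>a\<rfloor> + real n}"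
    using n of_int_floor_le[of a] by (auto simp: subset_eq intro: order_trans[OF of_int_floor_le])
  then show ?thesis using set_integrable_subset[OF 2[of "\<lfloor>a\<rfloor>" n]] by auto
qed

lemma L1pD: assumes "L1p f" shows "f \<in> borel_measurable borel" "per f" "set_integrable lborel {a..b} f"
  "f integrable_on {a..b}" "(\<lambda>x. \<bar>f x\<bar>) integrable_on {a..b}" "circle_integral f = integral {0..1} f"
proof -
  show 1: "f \<in> borel_measurable borel" "per f" "set_integrable lborel {a..b} f" for a b
    using assms unfolding L1p_def by auto
  show "f integrable_on {a..b}" "circle_integral f = integral {0..1} f"
    unfolding circle_integral_def using set_borel_integral_eq_integral[OF 1(3)] by auto
  show "(\<lambda>x. \<bar>f x\<bar>) integrable_on {a..b}"
    using set_borel_integral_eq_integral(1)[OF set_integrable_abs[OF 1(3)]] .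
qed

lemma L2pD: assumes "L2p f" shows "f \<in> borel_measurable borel" "per f" "set_integrable lborel {a..b} (\<lambda>x. (f x)\<^sup>2)"
  using assms unfolding L2p_def by auto

lemma set_integrable_dominated:
  fixes f g :: "real \<Rightarrow> real"
  assumes "f \<in> borel_measurable borel" "set_integrable lborel {a..b} g" "\<And>x. \<bar>f x\<bar> \<le> g x"
  shows "set_integrable lborel {a..b} f"
  by (rule set_integrable_bound[OF assms(2)])
     (use assms in \<open>auto simp: set_borel_measurable_def intro!: AE_I2 order_trans[OF assms(3)]\<close>)

lemma L1p_dominated:
  assumes "L1p g" "f \<in> borel_measurable borel" "per f" "\<And>x. \<bar>f x\<bar> \<le> g x"
  shows "L1p f"
  unfolding L1p_def using assms set_integrable_dominated[OF assms(2) L1pD(3)[OF assms(1)] assms(4)] by auto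

lemma cperD: "cper f \<Longrightarrow> continuous_on UNIV f" "cper f \<Longrightarrow> per f" "cper f \<Longrightarrow> f \<in> borel_measurable borel"
  by (auto simp: cper_def intro: borel_measurable_continuous_onI)

lemma cper_bounded: assumes "cper f" obtains B where "B > 0" "\<And>x. \<bar>f x\<bar> \<le> B"
proof -
  have "bounded (f ` {0..1})"
    using assms by (intro compact_imp_bounded compact_continuous_image)
      (auto simp: cper_def intro: continuous_on_subset)
  then obtain B where B: "B > 0" "\<And>x. x \<in> {0..1} \<Longrightarrow> \<bar>f x\<bar> \<le> B" by (auto simp: bounded_pos)
  have "\<bar>f x\<bar> \<le> B" for x
    using B(2)[of "frac x"] per_frac[OF cperD(2)[OF assms], of x] frac_ge_0[of x] frac_lt_1[of x]
    by (auto simp: less_imp_le)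
  then show thesis using that B by blast
qed

lemma L1p_const: "L1p (\<lambda>_. c)"
  unfolding L1p_def per_def set_integrable_def
  using integrable_real_indicator[of "{a..b}" lborel for a b] by (auto simp: emeasure_lborel_Icc_eq)

lemma cper_L1p: assumes "cper f" shows "L1p f"
proof -
  obtain B where "B > 0" "\<And>x. \<bar>f x\<bar> \<le> B" using cper_bounded[OF assms] by blast
  then show ?thesis by (intro L1p_dominated[OF L1p_const[of B]]) (use cperD assms in auto)
qed

lemma per_intros:
  "per (\<lambda>_. c)"
  "per f \<Longrightarrow> per g \<Longrightarrow> per (\<lambda>x. f x + g x)"
  "per f \<Longrightarrow> per g \<Longrightarrow> per (\<lambda>x. f x - g x)"
  "per f \<Longrightarrow> per g \<Longrightarrow> per (\<lambda>x. f x * g x)"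
  "per f \<Longrightarrow> per (\<lambda>x. f x ^ n)"
  "per f \<Longrightarrow> per (\<lambda>x. \<bar>f x\<bar>)"
  by (auto simp: per_def)

lemma per_shift: assumes "per f" shows "per (\<lambda>x. f (x + h))" "per (\<lambda>x. f (x - h))"
proof -
  have "f (x + 1 + h) = f (x + h)" "f (x + 1 - h) = f (x - h)" for x
    using assms[unfolded per_def, rule_format, of "x + h"] assms[unfolded per_def, rule_format, of "x - h"]
    by (simp_all add: algebra_simps)
  then show "per (\<lambda>x. f (x + h))" "per (\<lambda>x. f (x - h))" by (simp_all add: per_def)
qed

lemma cper_shift: assumes "cper f" shows "cper (\<lambda>x. f (x + h))" "cper (\<lambda>x. f (x - h))"
  using assms per_shift unfolding cper_def
  by (auto intro!: continuous_on_compose2[of UNIV f] continuous_intros)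

lemma cper_compose: "continuous_on UNIV k \<Longrightarrow> cper f \<Longrightarrow> cper (\<lambda>x. k (f x))"
  unfolding cper_def per_def by (auto intro: continuous_on_compose2[of UNIV k])

lemma cper_intros:
  "cper (\<lambda>_. c)"
  "cper f \<Longrightarrow> cper g \<Longrightarrow> cper (\<lambda>x. f x + g x)"
  "cper f \<Longrightarrow> cper g \<Longrightarrow> cper (\<lambda>x. f x - g x)"
  "cper f \<Longrightarrow> cper g \<Longrightarrow> cper (\<lambda>x. f x * g x)"
  "cper f \<Longrightarrow> cper (\<lambda>x. - f x)"
  "cper f \<Longrightarrow> cper (\<lambda>x. \<bar>f x\<bar>)"
  "cper f \<Longrightarrow> cper (\<lambda>x. f x ^ n)"
  by (auto simp: cper_def per_def intro!: continuous_intros)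

lemma L1p_intros:
  assumes "L1p f"
  shows "L1p g \<Longrightarrow> L1p (\<lambda>x. f x + g x)"
    "L1p g \<Longrightarrow> L1p (\<lambda>x. f x - g x)"
    "L1p (\<lambda>x. c * f x)"
    "L1p (\<lambda>x. - f x)"
    "L1p (\<lambda>x. \<bar>f x\<bar>)"
proof -
  show g: "L1p (\<lambda>x. c * f x)" for c
    using assms unfolding L1p_def by (auto intro!: per_intros)
  show "L1p (\<lambda>x. - f x)" using g[of "-1"] by simp
  show "L1p (\<lambda>x. \<bar>f x\<bar>)"
    using assms unfolding L1p_def by (auto intro!: per_intros set_integrable_abs)
  show "L1p (\<lambda>x. f x + g x)" "L1p (\<lambda>x. f x - g x)" if "L1p g"
    using assms that unfolding L1p_def by (auto intro!: per_intros)
qed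

lemma L1p_shift: assumes "L1p f" shows "L1p (\<lambda>x. f (x + h))"
  using assms unfolding L1p_def
  by (auto intro!: per_shift set_integrable_shift)

lemma L2p_mult: assumes "L2p f" "L2p g" shows "L1p (\<lambda>x. f x * g x)"
  unfolding L1p_def
proof (intro conjI allI)
  show "(\<lambda>x. f x * g x) \<in> borel_measurable borel" "per (\<lambda>x. f x * g x)"
    using assms by (auto simp: L2p_def intro!: per_intros)
  fix a b
  show "set_integrable lborel {a..b} (\<lambda>x. f x * g x)"
  proof (rule set_integrable_dominated)
    show "set_integrable lborel {a..b} (\<lambda>x. (f x)\<^sup>2 + (g x)\<^sup>2)"
      by (intro set_integral_add L2pD assms)
    show "\<bar>f x * g x\<bar> \<le> (f x)\<^sup>2 + (g x)\<^sup>2" for x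
    proof -
      have "0 \<le> (\<bar>f x\<bar> - \<bar>g x\<bar>)\<^sup>2" by simp
      moreover have "0 \<le> \<bar>f x\<bar> * \<bar>g x\<bar>" by simp
      ultimately show ?thesis unfolding abs_mult power2_diff power2_abs by linarith
    qed
  qed (use assms in \<open>auto simp: L2p_def\<close>)
qed

lemma cper_L2p: "cper f \<Longrightarrow> L2p f"
  using cper_L1p[of "\<lambda>x. f x ^ 2"] cper_intros(7)[of f 2] cperD[of f] unfolding L2p_def L1p_def by auto

lemma L2p_cong: "L2p f \<longleftrightarrow> f \<in> borel_measurable borel \<and> per f \<and> L1p (\<lambda>x. (f x)\<^sup>2)"
  unfolding L2p_def L1p_def by (auto simp: per_def)

lemma L2p_intros:
  "L2p f \<Longrightarrow> L2p g \<Longrightarrow> L2p (\<lambda>x. f x + g x)"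
  "L2p f \<Longrightarrow> L2p g \<Longrightarrow> L2p (\<lambda>x. f x - g x)"
  "L2p f \<Longrightarrow> cper k \<Longrightarrow> L2p (\<lambda>x. k x * f x)"
  "L2p f \<Longrightarrow> L2p (\<lambda>x. - f x)"
  "L2p f \<Longrightarrow> L2p (\<lambda>x. \<bar>f x\<bar>)"
  "L2p f \<Longrightarrow> L2p (\<lambda>x. f (x + h))"
proof -
  assume f: "L2p f"
  show "L2p (\<lambda>x. - f x)" "L2p (\<lambda>x. \<bar>f x\<bar>)" using f unfolding L2p_def per_def by auto
  show "L2p (\<lambda>x. f (x + h))" using f L1p_shift[of "\<lambda>x. (f x)\<^sup>2" h] unfolding L2p_cong
    by (auto intro!: per_shift)
  show "L2p (\<lambda>x. k x * f x)" if k: "cper k"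
  proof -
    obtain B where B: "B > 0" "\<And>x. \<bar>k x\<bar> \<le> B" using cper_bounded[OF k] by blast
    have "L1p (\<lambda>x. (k x * f x)\<^sup>2)"
    proof (rule L1p_dominated[OF L1p_intros(3)[of "\<lambda>x. (f x)\<^sup>2" "B^2"]])
      show "L1p (\<lambda>x. (f x)\<^sup>2)" using f by (simp add: L2p_cong)
      show "\<bar>(k x * f x)\<^sup>2\<bar> \<le> B\<^sup>2 * (f x)\<^sup>2" for x
        unfolding power_mult_distrib using B power_mono[of "\<bar>k x\<bar>" B 2] by (auto intro!: mult_right_mono)
    qed (use f k cperD(3)[OF k] in \<open>auto simp: L2p_cong cper_def intro!: per_intros\<close>)
    then show ?thesis using f k cperD(3)[OF k] by (auto simp: L2p_cong cper_def intro!: per_intros)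
  qed
  {
    fix g :: "real \<Rightarrow> real" assume g: "L2p g"
    have "L1p (\<lambda>x. (f x)\<^sup>2 + ((g x)\<^sup>2 + 2 * (f x * g x)))" "L1p (\<lambda>x. (f x)\<^sup>2 + ((g x)\<^sup>2 - 2 * (f x * g x)))"
      using f g L2p_mult[OF f g] by (auto intro!: L1p_intros simp: L2p_cong)
    then have "L1p (\<lambda>x. (f x + g x)\<^sup>2)" "L1p (\<lambda>x. (f x - g x)\<^sup>2)"
      by (simp_all add: power2_sum power2_diff algebra_simps)
    then show "L2p (\<lambda>x. f x + g x)" "L2p (\<lambda>x. f x - g x)"
      using f g by (auto simp: L2p_cong intro!: per_intros)
  }
qed

lemma L2p_L1p: "L2p f \<Longrightarrow> L1p f"
  using L2p_mult[of f "\<lambda>_. 1"] cper_L2p[OF cper_intros(1)[of 1]] by simp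

lemma L2p_cmult: "L2p f \<Longrightarrow> L2p (\<lambda>x. c * f x)"
  using L2p_intros(3)[OF _ cper_intros(1)[of c]] .

lemma per_integral_window:
  assumes "L1p f" shows "integral {a..a+1} f = integral {0..1} f"
proof -
  note I = L1pD(4)[OF assms] and p = L1pD(2)[OF assms]
  define n where "n = \<lfloor>a\<rfloor>"
  define r where "r = frac a"
  have r: "0 \<le> r" "r < 1" "a = of_int n + r" by (auto simp: r_def n_def frac_def frac_lt_1) (simp add: frac_lt_1 flip: frac_def)
  have sh: "integral {c..d} f = integral {c + of_int m..d + of_int m} f" for c d m
    using integral_shift_Icc_real[of c d f "of_int m"] per_int[OF p]
    by (simp add: o_def add.commute[of "of_int m"])
  have "integral {a..a+1} f = integral {r..r+1} f"
    using sh[of r "r+1" n] r by (simp add: algebra_simps)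
  also have "\<dots> = integral {r..1} f + integral {1..r+1} f"
    using r by (intro hk_integral_combine[symmetric] I) auto
  also have "integral {1..r+1} f = integral {0..r} f"
    using sh[of 0 r 1] by (simp add: algebra_simps)
  also have "integral {r..1} f + integral {0..r} f = integral {0..1} f"
    using r hk_integral_combine[of 0 r 1 f] I by auto
  finally show ?thesis .
qed

lemma per_integral_shift:
  assumes "L1p f" shows "integral {0..1} (\<lambda>x. f (x + h)) = integral {0..1} f"
  using integral_shift_Icc_real[of 0 1 f h] per_integral_window[OF assms, of h]
  by (simp add: o_def add.commute)

section \<open>Absolutely continuous functions on the circle\<close>

lemma ac_cper: assumes "ac f g" shows "cper f"
proof -
  have "isCont f x" for x
  proof -
    have "g integrable_on {x-1..x+1}" using assms unfolding ac_def
      by (metis L1pD(4) L2p_L1p)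
    then have "continuous_on {x-1..x+1} (\<lambda>y. f (x-1) + integral {x-1..y} g)"
      by (intro continuous_intros indefinite_integral_continuous_1)
    moreover have "f (x-1) + integral {x-1..y} g = f y" if "y \<in> {x-1..x+1}" for y
    proof -
      have "(g has_integral (f y - f (x-1))) {x-1..y}" using assms that unfolding ac_def by auto
      from integral_unique[OF this] show ?thesis by simp
    qed
    ultimately have "continuous_on {x-1..x+1} f" by (rule continuous_on_eq)
    then show ?thesis by (rule continuous_on_interior) auto
  qed
  then show ?thesis using assms by (auto simp: cper_def ac_def continuous_at_imp_continuous_on)
qed

lemma acD: assumes "ac f g"
  shows "per f" "L2p g" "L1p g" "a \<le> b \<Longrightarrow> (g has_integral (f b - f a)) {a..b}"
    "a \<le> b \<Longrightarrow> integral {a..b} g = f b - f a" "cper f" "L2p f" "L1p f" "g integrable_on {a..b}"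
    "(\<lambda>x. \<bar>g x\<bar>) integrable_on {a..b}"
proof -
  show 1: "per f" "L2p g" "L1p g" "a \<le> b \<Longrightarrow> (g has_integral (f b - f a)) {a..b}"
    "cper f" "L2p f" "L1p f" "g integrable_on {a..b}"
     "(\<lambda>x. \<bar>g x\<bar>) integrable_on {a..b}" for a b
    using assms ac_cper[OF assms] cper_L2p[of f] cper_L1p L2p_L1p[of g] L1pD(4,5)[of g] by (auto simp: ac_def)
  show "a \<le> b \<Longrightarrow> integral {a..b} g = f b - f a" using 1(4) by (auto intro: integral_unique)
qed

lemma ac_add: "ac f g \<Longrightarrow> ac f' g' \<Longrightarrow> ac (\<lambda>x. f x + f' x) (\<lambda>x. g x + g' x)"
  and ac_diff: "ac f g \<Longrightarrow> ac f' g' \<Longrightarrow> ac (\<lambda>x. f x - f' x) (\<lambda>x. g x - g' x)"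
  using has_integral_add[of g "f b - f a" "{a..b}" g' "f' b - f' a" for a b]
    has_integral_diff[of g "f b - f a" "{a..b}" g' "f' b - f' a" for a b]
  by (auto simp: ac_def intro!: per_intros L2p_intros simp: algebra_simps)

lemma ac_cmult: "ac f g \<Longrightarrow> ac (\<lambda>x. c * f x) (\<lambda>x. c * g x)"
  using has_integral_mult_right[of g "f b - f a" "{a..b}" c for a b]
  by (auto simp: ac_def intro!: per_intros L2p_cmult simp: algebra_simps)

lemma ac_const: "ac (\<lambda>_. c) (\<lambda>_. 0)"
  using cper_L2p[OF cper_intros(1)] by (auto simp: ac_def per_def)

lemma ac_shift: assumes "ac f g" shows "ac (\<lambda>x. f (x + h)) (\<lambda>x. g (x + h))"
  unfolding ac_def
proof (intro conjI allI impI)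
  show "per (\<lambda>x. f (x + h))" "L2p (\<lambda>x. g (x + h))" using acD[OF assms] by (auto intro: per_shift L2p_intros)
  fix a b :: real assume "a \<le> b"
  then have "(g has_integral (f (b + h) - f (a + h))) {a + h..b + h}"
    by (intro acD(4)[OF assms]) auto
  then show "((\<lambda>x. g (x + h)) has_integral (f (b + h) - f (a + h))) {a..b}"
    by (simp flip: has_integral_shift_Icc_real add: o_def add.commute)
qed

text \<open>\<open>f\<close> has a derivative only in the integrated sense, so the rule is proved up
  to an error \<open>e\<close> times the integral of |g|. Such an error is additive over adjacent
  intervals, and Bolzano's subdivision reduces it to intervals on which \<Psi>' is nearly constant
  along \<open>f\<close> and the mean value theorem for \<Psi> applies.\<close>

lemma ac_chain:
  assumes f: "ac f g" and \<Psi>: "\<And>x. (\<Psi> has_real_derivative \<Psi>' x) (at x)" and c: "continuous_on UNIV \<Psi>'"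
  shows "ac (\<lambda>x. \<Psi> (f x)) (\<lambda>x. \<Psi>' (f x) * g x)"
proof -
  have cf: "isCont f x" for x using acD(6)[OF f] by (auto simp: cper_def continuous_on_eq_continuous_at)
  have c\<Psi>: "isCont \<Psi>' x" for x using c by (auto simp: continuous_on_eq_continuous_at)
  have L2: "L2p (\<lambda>x. \<Psi>' (f x) * g x)"
    by (rule L2p_intros(3)[OF acD(2)[OF f] cper_compose[OF c acD(6)[OF f]]])
  note I = L1pD(4)[OF L2p_L1p[OF L2]]
  have "integral {a..b} (\<lambda>x. \<Psi>' (f x) * g x) = \<Psi> (f b) - \<Psi> (f a)" if ab: "a \<le> b" for a b
  proof -
    have le: "\<bar>\<Psi> (f b) - \<Psi> (f a) - integral {a..b} (\<lambda>x. \<Psi>' (f x) * g x)\<bar> \<le> e * integral {a..b} (\<lambda>x. \<bar>g x\<bar>)"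
      if e: "e > 0" for e
      using ab
    proof (induction rule: Bolzano)
      case (trans a b c)
      have "integral {a..c} (\<lambda>x. \<Psi>' (f x) * g x) = integral {a..b} (\<lambda>x. \<Psi>' (f x) * g x) + integral {b..c} (\<lambda>x. \<Psi>' (f x) * g x)"
        "integral {a..c} (\<lambda>x. \<bar>g x\<bar>) = integral {a..b} (\<lambda>x. \<bar>g x\<bar>) + integral {b..c} (\<lambda>x. \<bar>g x\<bar>)"
        using trans I acD[OF f] by (auto intro!: hk_integral_combine[symmetric])
      then show ?case using trans(1,2) by (simp add: distrib_left)
    next
      case (local x)
      obtain d1 where d1: "d1 > 0" "\<And>z. \<bar>z - f x\<bar> < d1 \<Longrightarrow> \<bar>\<Psi>' z - \<Psi>' (f x)\<bar> < e / 2"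
        using c\<Psi>[of "f x"] half_gt_zero[OF e] unfolding continuous_at_eps_delta by (metis dist_real_def)
      obtain d where d: "d > 0" "\<And>s. \<bar>s - x\<bar> < d \<Longrightarrow> \<bar>f s - f x\<bar> < d1"
        using cf[of x] d1(1) unfolding continuous_at_eps_delta by (metis dist_real_def)
      show ?case
      proof (intro exI[of _ d] conjI allI impI d(1))
        fix a b assume ab: "a \<le> x \<and> x \<le> b \<and> b - a < d"
        then have fa: "\<bar>f a - f x\<bar> < d1" "\<bar>f b - f x\<bar> < d1" by (auto intro!: d)
        have "\<exists>\<zeta>. \<bar>\<zeta> - f x\<bar> < d1 \<and> \<Psi> (f b) - \<Psi> (f a) = \<Psi>' \<zeta> * (f b - f a)"
        proof (cases "f a" "f b" rule: linorder_cases)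
          case less
          then obtain z where "f a < z" "z < f b" "\<Psi> (f b) - \<Psi> (f a) = (f b - f a) * \<Psi>' z"
            using MVT2[of "f a" "f b" \<Psi> \<Psi>'] \<Psi> by auto
          then show ?thesis using fa by (intro exI[of _ z]) (auto simp: abs_if split: if_splits)
        next
          case equal
          then show ?thesis using d1(1) by (intro exI[of _ "f x"]) auto
        next
          case greater
          then obtain z where "f b < z" "z < f a" "\<Psi> (f a) - \<Psi> (f b) = (f a - f b) * \<Psi>' z"
            using MVT2[of "f b" "f a" \<Psi> \<Psi>'] \<Psi> by auto
          then show ?thesis using fa by (intro exI[of _ z]) (auto simp: abs_if algebra_simps split: if_splits)
        qed
        then obtain \<zeta> where z: "\<bar>\<zeta> - f x\<bar> < d1" "\<Psi> (f b) - \<Psi> (f a) = \<Psi>' \<zeta> * (f b - f a)" by blast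
        have "\<Psi> (f b) - \<Psi> (f a) - integral {a..b} (\<lambda>x. \<Psi>' (f x) * g x) = integral {a..b} (\<lambda>x. \<Psi>' \<zeta> * g x - \<Psi>' (f x) * g x)"
          using ab acD(5)[OF f, of a b] z(2) I acD(9)[OF f]
          by (subst hk_integral_diff) (auto intro: integrable_on_mult_right)
        also have "\<bar>\<dots>\<bar> \<le> integral {a..b} (\<lambda>x. e * \<bar>g x\<bar>)"
          unfolding real_norm_def[symmetric]
        proof (rule integral_norm_bound_integral)
          fix s assume s: "s \<in> {a..b}"
          then have "\<bar>f s - f x\<bar> < d1" using ab by (intro d) auto
          then have "\<bar>\<Psi>' \<zeta> - \<Psi>' (f s)\<bar> \<le> e" using d1(2)[of "f s"] d1(2)[OF z(1)] by linarith
          then have "\<bar>\<Psi>' \<zeta> - \<Psi>' (f s)\<bar> * \<bar>g s\<bar> \<le> e * \<bar>g s\<bar>" by (intro mult_right_mono) auto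
          then show "norm (\<Psi>' \<zeta> * g s - \<Psi>' (f s) * g s) \<le> e * norm (g s)"
            by (simp add: abs_mult[symmetric] left_diff_distrib)
        qed (use acD[OF f] I in \<open>auto intro!: integrable_diff integrable_on_mult_right\<close>)
        finally show "\<bar>\<Psi> (f b) - \<Psi> (f a) - integral {a..b} (\<lambda>x. \<Psi>' (f x) * g x)\<bar> \<le> e * integral {a..b} (\<lambda>x. \<bar>g x\<bar>)"
          by simp
      qed
    qed
    define D where "D = \<bar>\<Psi> (f b) - \<Psi> (f a) - integral {a..b} (\<lambda>x. \<Psi>' (f x) * g x)\<bar>"
    define m where "m = integral {a..b} (\<lambda>x. \<bar>g x\<bar>)"
    have m: "m \<ge> 0" unfolding m_def by (intro integral_nonneg acD[OF f]) auto
    have "D \<le> 0 + e" if "e > 0" for e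
    proof -
      have "D \<le> e / (m + 1) * m"
        using le[of "e / (m + 1)"] that m unfolding D_def[symmetric] m_def[symmetric] by simp
      also have "\<dots> \<le> e" using that m by (simp add: field_simps)
      finally show ?thesis by simp
    qed
    then have "D \<le> 0" using field_le_epsilon by blast
    then show ?thesis unfolding D_def by simp
  qed
  then show ?thesis using L2 I acD(1)[OF f] unfolding ac_def
    by (auto simp: has_integral_iff per_def)
qed

text \<open>Polarization reduces the product rule to the chain rule for the square.\<close>

lemma ac_mult: assumes "ac f f'" "ac g g'" shows "ac (\<lambda>x. f x * g x) (\<lambda>x. f' x * g x + f x * g' x)"
proof -
  have sq: "ac (\<lambda>x. (f x)\<^sup>2) (\<lambda>x. (2 * f x) * g x)" if "ac f g" for f g
    by (rule ac_chain[OF that]) (auto intro!: derivative_eq_intros continuous_intros)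
  have "ac (\<lambda>x. (1/4) * ((f x + g x)\<^sup>2 - (f x - g x)\<^sup>2))
     (\<lambda>x. (1/4) * (2 * (f x + g x) * (f' x + g' x) - 2 * (f x - g x) * (f' x - g' x)))"
    by (intro ac_cmult ac_diff sq ac_add assms)
  then show ?thesis by (simp add: power2_sum power2_diff algebra_simps)
qed

lemma ac_integral_0: "ac f g \<Longrightarrow> integral {0..1} g = 0"
  using acD(5)[of f g 0 1] acD(1)[of f g] unfolding per_def by (metis add_0 diff_self zero_le_one)

lemma ac_parts: assumes "ac f f'" "ac g g'"
  shows "integral {0..1} (\<lambda>x. f' x * g x) = - integral {0..1} (\<lambda>x. f x * g' x)"
proof -
  have "L1p (\<lambda>x. f' x * g x)" "L1p (\<lambda>x. f x * g' x)"
    using acD[OF assms(1)] acD[OF assms(2)] by (auto intro: L2p_mult)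
  then have "integral {0..1} (\<lambda>x. f' x * g x + f x * g' x) = integral {0..1} (\<lambda>x. f' x * g x) + integral {0..1} (\<lambda>x. f x * g' x)"
    by (intro hk_integral_add L1pD)
  then show ?thesis using ac_integral_0[OF ac_mult[OF assms]] by simp
qed

lemma ac_C1: assumes "per f" "\<And>x. (f has_real_derivative f' x) (at x)" "continuous_on UNIV f'"
  shows "ac f f'"
proof -
  have "f' (x + 1) = f' x" for x
  proof -
    have "((\<lambda>x. f (x + 1)) has_real_derivative f' (x + 1)) (at x)"
      using DERIV_shift[of f "f' (x+1)" x 1] assms(2) by simp
    then have "(f has_real_derivative f' (x + 1)) (at x)" using assms(1) by (simp add: per_def)
    then show ?thesis using assms(2) DERIV_unique by blast
  qed
  then have "cper f'" using assms(3) by (auto simp: cper_def per_def)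
  moreover have "(f' has_integral (f b - f a)) {a..b}" if "a \<le> b" for a b
    using that assms(2) by (intro fundamental_theorem_of_calculus)
      (auto simp flip: has_real_derivative_iff_has_vector_derivative intro: has_field_derivative_at_within)
  ultimately show ?thesis using assms(1) cper_L2p unfolding ac_def by blast
qed

lemma ac_deriv: assumes "ac f g" "continuous_on UNIV g" shows "(f has_real_derivative g x) (at x)"
proof -
  have "((\<lambda>y. integral {x-1..y} g) has_real_derivative g x) (at x within {x-1..x+1})"
    using assms(2) by (intro integral_has_real_derivative) (auto intro: continuous_on_subset)
  then have "((\<lambda>y. f (x-1) + integral {x-1..y} g) has_real_derivative g x) (at x within {x-1..x+1})"
    by (auto intro!: derivative_eq_intros)
  then have "(f has_real_derivative g x) (at x within {x-1..x+1})"
    by (rule has_field_derivative_transform_within[where d = 1]) (use acD(5)[OF assms(1)] in auto)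
  then show ?thesis using at_within_interior[of x "{x-1..x+1}"] by auto
qed

text \<open>Vanishing mean is exactly what makes the primitive periodic.\<close>

lemma ac_primitive: assumes "L2p g" "integral {0..1} g = 0" shows "\<exists>f. ac f g \<and> f 0 = c"
proof -
  note I = L1pD(4)[OF L2p_L1p[OF assms(1)]]
  note comb = hk_integral_combine[OF _ _ I]
  define f where "f x = c + (if x \<ge> 0 then integral {0..x} g else - integral {x..0} g)" for x
  have 1: "f b - f a = integral {a..b} g" if "a \<le> b" for a b
    using that comb[of a 0 b] comb[of 0 a b] comb[of a b 0] unfolding f_def
    by (auto simp: algebra_simps)
  have "f (x + 1) = f x" for x
    using 1[of x "x+1"] per_integral_window[OF L2p_L1p[OF assms(1)], of x] assms(2) by simp
  then have "ac f g" using assms(1) I 1 unfolding ac_def per_def by (auto simp: has_integral_iff)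
  moreover have "f 0 = c" by (simp add: f_def)
  ultimately show ?thesis by blast
qed

lemma cper_primitive: assumes "cper \<theta>"
  shows "\<exists>F. ac F (\<lambda>x. \<theta> x - integral {0..1} \<theta>) \<and> (\<forall>x. (F has_real_derivative (\<theta> x - integral {0..1} \<theta>)) (at x))"
proof -
  have c: "cper (\<lambda>x. \<theta> x - integral {0..1} \<theta>)" by (intro cper_intros assms)
  have "integral {0..1} (\<lambda>x. \<theta> x - integral {0..1} \<theta>) = 0"
    using L1pD(4)[OF cper_L1p[OF assms]] by (subst hk_integral_diff) auto
  then show ?thesis using ac_primitive[OF cper_L2p[OF c]] ac_deriv cperD(1)[OF c] by blast
qed

lemma cper_uniform: assumes "cper \<theta>" "e > 0"
  shows "\<exists>d>0. \<forall>x y. \<bar>x - y\<bar> < d \<longrightarrow> \<bar>\<theta> x - \<theta> y\<bar> < e"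
proof -
  \<comment> \<open>Wide enough to hold both points after the integer translation that moves
    \<open>x\<close> into the unit interval, as long as they are less than 1 apart.\<close>
  have "uniformly_continuous_on {-1..2} \<theta>"
    by (intro compact_uniformly_continuous) (use cperD(1)[OF assms(1)] in \<open>auto intro: continuous_on_subset\<close>)
  then obtain d where d: "d > 0" "\<And>x y. x \<in> {-1..2} \<Longrightarrow> y \<in> {-1..2} \<Longrightarrow> \<bar>x - y\<bar> < d \<Longrightarrow> \<bar>\<theta> x - \<theta> y\<bar> < e"
    using assms(2) unfolding uniformly_continuous_on_def dist_real_def by metis
  have "\<bar>\<theta> x - \<theta> y\<bar> < e" if "\<bar>x - y\<bar> < min d 1" for x y
  proof -
    have p: "\<theta> x = \<theta> (x + of_int (-\<lfloor>x\<rfloor>))" "\<theta> y = \<theta> (y + of_int (-\<lfloor>x\<rfloor>))"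
      using per_int[OF cperD(2)[OF assms(1)]] by metis+
    have "\<bar>y - x\<bar> < 1" using that by auto
    then have "x + of_int (-\<lfloor>x\<rfloor>) \<in> {-1..2}" "y + of_int (-\<lfloor>x\<rfloor>) \<in> {-1..2}"
      using of_int_floor_le[of x] real_of_int_floor_add_one_gt[of x] by (simp_all add: abs_less_iff) linarith+
    then show ?thesis using that by (subst p(1), subst p(2), intro d(2)) auto
  qed
  then show ?thesis using d(1) by (intro exI[of _ "min d 1"]) auto
qed

section \<open>Duality with continuous functions\<close>

text \<open>At an integer the pieces on the two adjacent unit intervals are glued; they agree there
  because the end values coincide.\<close>

lemma cper_frac:
  assumes c: "continuous_on {0..1} \<rho>" and e: "\<rho> 0 = \<rho> 1"
  shows "cper (\<lambda>x. \<rho> (frac x))"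
proof -
  have 1: "continuous_on {of_int n..of_int n + 1} (\<lambda>x. \<rho> (frac x))" for n
  proof -
    have "continuous_on {of_int n..of_int n + 1} (\<lambda>x. \<rho> (x - of_int n))"
      by (rule continuous_on_compose2[OF c]) (auto intro!: continuous_intros)
    moreover have "\<rho> (x - of_int n) = \<rho> (frac x)" if "x \<in> {of_int n..of_int n + 1}" for x
    proof (cases "x = of_int n + 1")
      case True
      then show ?thesis using e by (simp add: frac_def)
    next
      case False
      then have "\<lfloor>x\<rfloor> = n" using that by (intro floor_unique) auto
      then show ?thesis by (simp add: frac_def)
    qed
    ultimately show ?thesis by (rule continuous_on_eq)
  qed
  have "isCont (\<lambda>x. \<rho> (frac x)) x" for x
  proof -
    define n where "n = \<lfloor>x\<rfloor>"
    have "continuous_on ({of_int (n-1)..of_int (n-1) + 1} \<union> {of_int n..of_int n + 1}) (\<lambda>x. \<rho> (frac x))"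
      by (intro continuous_on_closed_Un 1) auto
    moreover have "{of_int (n-1)..of_int (n-1) + 1} \<union> {of_int n..of_int n + 1} = {of_int n - 1..of_int n + (1::real)}"
      by auto
    moreover have "x \<in> interior {of_int n - 1..of_int n + (1::real)}"
      unfolding n_def using floor_correct[of x] by (simp; linarith)
    ultimately show ?thesis using continuous_on_interior by metis
  qed
  then show ?thesis by (auto simp: cper_def per_def continuous_at_imp_continuous_on frac_1_eq)
qed

text \<open>Continuous test functions suffice, since \<open>sgn g\<close> is an almost everywhere limit of such functions.\<close>

lemma L1_norm_le_dual:
  assumes g: "L1p g" and D: "\<And>\<theta>. cper \<theta> \<Longrightarrow> (\<And>x. \<bar>\<theta> x\<bar> \<le> 1) \<Longrightarrow> integral {0..1} (\<lambda>x. g x * \<theta> x) \<le> D"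
  shows "integral {0..1} (\<lambda>x. \<bar>g x\<bar>) \<le> D"
proof -
  note gm[measurable] = L1pD(1)[OF g]
  have "(\<lambda>x. sgn (g x)) \<in> borel_measurable lborel" unfolding sgn_if by measurable
  then have "(\<lambda>x. sgn (g x)) \<in> borel_measurable lebesgue" by (rule measurable_completion)
  then have "(\<lambda>x. sgn (g x)) measurable_on UNIV"
    by (intro lebesgue_measurable_imp_measurable_on_real) auto
  then obtain N c where N: "negligible N" and c: "\<And>n. continuous_on UNIV (c n :: real \<Rightarrow> real)"
    and lim: "\<And>x. x \<notin> N \<Longrightarrow> (\<lambda>n. c n x) \<longlonglongrightarrow> sgn (g x)"
    unfolding measurable_on_def by auto
  \<comment> \<open>The approximants \<open>c n\<close> are neither bounded by 1 nor periodic.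
    Clipping enforces the bound, and the first factor vanishes at 0 and 1, so that the periodic
    extension is continuous, while it tends to 1 in the interior.\<close>
  define \<rho> where "\<rho> n x = min 1 (real n * (x * (1 - x))) * max (-1) (min 1 (c n x))" for n x
  define \<theta> where "\<theta> n x = \<rho> n (frac x)" for n x
  have \<theta>c: "cper (\<theta> n)" for n
    unfolding \<theta>_def by (rule cper_frac) (auto simp: \<rho>_def intro!: continuous_intros continuous_on_subset[OF c])
  have \<theta>1: "\<bar>\<theta> n x\<bar> \<le> 1" for n x
  proof -
    have "0 \<le> frac x * (1 - frac x)" using frac_ge_0[of x] frac_lt_1[of x] by simp
    then have "0 \<le> min 1 (real n * (frac x * (1 - frac x)))" by simp
    then show ?thesis unfolding \<theta>_def \<rho>_def abs_mult by (intro mult_le_one) auto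
  qed
  have gL: "L1p (\<lambda>x. g x * \<theta> n x)" for n
  proof (rule L1p_dominated[OF L1p_intros(5)[OF g]])
    show "per (\<lambda>x. g x * \<theta> n x)" using L1pD(2)[OF g] cperD(2)[OF \<theta>c] by (rule per_intros)
    show "(\<lambda>x. g x * \<theta> n x) \<in> borel_measurable borel" using cperD(3)[OF \<theta>c] by simp
    show "\<bar>g x * \<theta> n x\<bar> \<le> \<bar>g x\<bar>" for x using mult_left_mono[OF \<theta>1[of n x], of "\<bar>g x\<bar>"] by (simp add: abs_mult)
  qed
  have "(\<lambda>n. LINT x:{0..1}|lborel. g x * \<theta> n x) \<longlonglongrightarrow> (LINT x:{0..1}|lborel. \<bar>g x\<bar>)"
    unfolding set_lebesgue_integral_def
  proof (rule integral_dominated_convergence)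
    show "integrable lborel (\<lambda>x. indicator {0..1} x *\<^sub>R \<bar>g x\<bar>)"
      using L1pD(3)[OF L1p_intros(5)[OF g]] unfolding set_integrable_def .
    show "(\<lambda>x. indicat_real {0..1} x *\<^sub>R (g x * \<theta> n x)) \<in> borel_measurable lborel" for n using cperD(3)[OF \<theta>c] by simp
    show "(\<lambda>x. indicat_real {0..1} x *\<^sub>R \<bar>g x\<bar>) \<in> borel_measurable lborel" by simp
    show "AE x in lborel. norm (indicat_real {0..1} x *\<^sub>R (g x * \<theta> n x)) \<le> indicat_real {0..1} x *\<^sub>R \<bar>g x\<bar>" for n
    proof (rule AE_I2)
      fix x
      show "norm (indicat_real {0..1} x *\<^sub>R (g x * \<theta> n x)) \<le> indicat_real {0..1} x *\<^sub>R \<bar>g x\<bar>"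
        using mult_left_mono[OF \<theta>1[of n x], of "\<bar>g x\<bar>"] by (auto simp: abs_mult indicator_def)
    qed
    have "AE x in lebesgue. x \<notin> N" using N by (simp add: negligible_iff_null_sets AE_not_in)
    then have "AE x in lborel. x \<notin> N" by (simp add: AE_completion_iff)
    moreover have "AE x in lborel. x \<noteq> 0" "AE x in lborel. x \<noteq> (1::real)" by (rule AE_lborel_singleton)+
    ultimately show "AE x in lborel. (\<lambda>n. indicat_real {0..1} x *\<^sub>R (g x * \<theta> n x)) \<longlonglongrightarrow> indicat_real {0..1} x *\<^sub>R \<bar>g x\<bar>"
    proof eventually_elim
      case (elim x)
      show ?case
      proof (cases "x \<in> {0..1}")
        case True
        then have x: "0 < x" "x < 1" "frac x = x" using elim by (auto simp: frac_eq)
        have "(\<lambda>n. max (-1) (min 1 (c n x))) \<longlonglongrightarrow> max (-1) (min 1 (sgn (g x)))"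
          by (intro tendsto_intros lim elim)
        moreover have "max (-1) (min 1 (sgn (g x))) = sgn (g x)" by (auto simp: sgn_if)
        moreover have "(\<lambda>n. min 1 (real n * (x * (1 - x)))) \<longlonglongrightarrow> 1"
        proof (rule tendsto_eventually)
          have "filterlim (\<lambda>n. real n * (x * (1 - x))) at_top sequentially"
            using x by (intro filterlim_at_top_mult_tendsto_pos[OF tendsto_const] filterlim_real_sequentially) auto
          then have "\<forall>\<^sub>F n in sequentially. 1 \<le> real n * (x * (1 - x))" by (simp add: filterlim_at_top)
          then show "\<forall>\<^sub>F n in sequentially. min 1 (real n * (x * (1 - x))) = 1" by eventually_elim auto
        qed
        ultimately have "(\<lambda>n. \<theta> n x) \<longlonglongrightarrow> 1 * sgn (g x)"
          unfolding \<theta>_def \<rho>_def x(3) by (intro tendsto_mult) auto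
        then have "(\<lambda>n. g x * \<theta> n x) \<longlonglongrightarrow> g x * (1 * sgn (g x))" by (intro tendsto_intros)
        then show ?thesis using True by (simp add: abs_sgn)
      qed auto
    qed
  qed
  moreover have "(LINT x:{0..1}|lborel. g x * \<theta> n x) \<le> D" for n
    using D[OF \<theta>c \<theta>1] L1pD(6)[OF gL] unfolding circle_integral_def by simp
  ultimately have "(LINT x:{0..1}|lborel. \<bar>g x\<bar>) \<le> D"
    by (intro LIMSEQ_le_const2) auto
  then show ?thesis using L1pD(6)[OF L1p_intros(5)[OF g]] unfolding circle_integral_def by simp
qed

section \<open>L1 size of a derivative and L1 size of translation differences\<close>

lemma per_AE:
  assumes "f \<in> borel_measurable borel" "per f" and ae: "AE x in lborel. x \<in> {0..1} \<longrightarrow> f x = 0"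
  shows "AE x in lborel. f x = (0::real)"
proof -
  have [measurable]: "f \<in> borel_measurable borel" by fact
  have "AE x in lborel. x \<in> {of_int n..of_int n + 1} \<longrightarrow> f x = 0" for n :: int
  proof -
    have "AE x in distr lborel borel (\<lambda>x. of_int (-n) + x). x \<in> {0..1} \<longrightarrow> f x = 0"
      using ae by (subst lborel_distr_plus) auto
    then have "AE x in lborel. of_int (-n) + x \<in> {0..1} \<longrightarrow> f (of_int (-n) + x) = 0"
      by (subst (asm) AE_distr_iff) auto
    then show ?thesis
    proof eventually_elim
      case (elim x)
      then show ?case using per_int[OF assms(2), of x "-n"] by (auto simp: algebra_simps)
    qed
  qed
  then have "AE x in lborel. \<forall>n::int. x \<in> {of_int n..of_int n + 1} \<longrightarrow> f x = 0"
    by (subst AE_all_countable) blast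
  then show ?thesis
  proof eventually_elim
    case (elim x)
    then have "x \<in> {of_int \<lfloor>x\<rfloor>..of_int \<lfloor>x\<rfloor> + 1} \<longrightarrow> f x = 0" by blast
    then show ?case using floor_correct[of x] by auto
  qed
qed

lemma AE_zero_L1:
  assumes g: "L1p g" and z: "integral {0..1} (\<lambda>x. \<bar>g x\<bar>) \<le> 0"
  shows "AE x in lborel. g x = 0"
proof (rule per_AE)
  show "g \<in> borel_measurable borel" "per g" using L1pD[OF g] by auto
  have "integral {0..1} (\<lambda>x. \<bar>g x\<bar>) = (LINT x|lborel. indicator {0..1} x *\<^sub>R \<bar>g x\<bar>)"
    using L1pD(6)[OF L1p_intros(5)[OF g]] unfolding circle_integral_def set_lebesgue_integral_def by simp
  moreover have "(LINT x|lborel. indicator {0..1} x *\<^sub>R \<bar>g x\<bar>) \<ge> 0" by (intro integral_nonneg_AE) auto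
  ultimately have "(LINT x|lborel. indicator {0..1} x *\<^sub>R \<bar>g x\<bar>) = 0" using z by linarith
  then have "AE x in lborel. indicator {0..1} x *\<^sub>R \<bar>g x\<bar> = 0"
    using L1pD(3)[OF L1p_intros(5)[OF g]] unfolding set_integrable_def
    by (subst (asm) integral_nonneg_eq_0_iff_AE) auto
  then show "AE x in lborel. x \<in> {0..1} \<longrightarrow> g x = 0" by eventually_elim (auto simp: indicator_def split: if_splits)
qed

text \<open>The increment of \<open>f\<close> is at most the integral of |g| over [x, x + h].
  Writing this integral as an increment of a periodic primitive \<open>m\<close> of |g| - J plus
  \<open>h * J\<close> takes the place of Fubini's theorem, because increments of \<open>m\<close>
  have integral zero.\<close>

lemma L1_diff_le:
  assumes f: "ac f g" and h: "h \<ge> 0"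
  shows "integral {0..1} (\<lambda>x. \<bar>f (x + h) - f x\<bar>) \<le> h * integral {0..1} (\<lambda>x. \<bar>g x\<bar>)"
proof -
  define J where "J = integral {0..1} (\<lambda>x. \<bar>g x\<bar>)"
  have "L2p (\<lambda>x. \<bar>g x\<bar> - J)"
    by (rule L2p_intros(2)[OF L2p_intros(5)[OF acD(2)[OF f]] cper_L2p[OF cper_intros(1)]])
  moreover have "integral {0..1} (\<lambda>x. \<bar>g x\<bar> - J) = 0"
    using acD(10)[OF f] by (subst hk_integral_diff) (auto simp: J_def)
  ultimately obtain m where m: "ac m (\<lambda>x. \<bar>g x\<bar> - J)" using ac_primitive by blast
  have le: "\<bar>f (x + h) - f x\<bar> \<le> m (x + h) - m x + h * J" for x
  proof -
    have "\<bar>f (x + h) - f x\<bar> = \<bar>integral {x..x+h} g\<bar>" using acD(5)[OF f, of x "x+h"] h by simp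
    also have "\<dots> \<le> integral {x..x+h} (\<lambda>x. \<bar>g x\<bar>)"
      using integral_norm_bound_integral[OF acD(9)[OF f] acD(10)[OF f]] by auto
    also have "\<dots> = integral {x..x+h} (\<lambda>x. (\<bar>g x\<bar> - J) + J)" by simp
    also have "\<dots> = integral {x..x+h} (\<lambda>x. \<bar>g x\<bar> - J) + integral {x..x+h} (\<lambda>x. J)"
      by (rule hk_integral_add[OF acD(9)[OF m]]) (rule integrable_const_ivl)
    also have "\<dots> = m (x + h) - m x + h * J" using acD(5)[OF m, of x "x+h"] h by simp
    finally show ?thesis .
  qed
  have cm: "cper (\<lambda>x. m (x + h) - m x)" "cper (\<lambda>x. \<bar>f (x + h) - f x\<bar>)"
    by (rule cper_intros(3)[OF cper_shift(1)] cper_intros(6)[OF cper_intros(3)[OF cper_shift(1)]], (rule acD(6)[OF m] acD(6)[OF f])+)+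
  have "integral {0..1} (\<lambda>x. \<bar>f (x + h) - f x\<bar>) \<le> integral {0..1} (\<lambda>x. (m (x + h) - m x) + h * J)"
    by (intro integral_le le integrable_add L1pD(4) cper_L1p cm cper_intros(1))
  also have "\<dots> = integral {0..1} (\<lambda>x. m (x + h) - m x) + integral {0..1::real} (\<lambda>x. h * J)"
    by (rule hk_integral_add) (use L1pD(4)[OF cper_L1p[OF cm(1)]] in auto)
  also have "integral {0..1} (\<lambda>x. m (x + h) - m x) = 0"
    using per_integral_shift[OF acD(8)[OF m], of h] L1pD(4)[OF L1p_shift[OF acD(8)[OF m]]] L1pD(4)[OF acD(8)[OF m]]
    by (subst hk_integral_diff) auto
  finally show ?thesis by (simp add: J_def)
qed

text \<open>Test with the Steklov averages of a continuous function, which can be integrated by parts.\<close>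

lemma L1_le_from_diff:
  assumes f: "ac f g" and h0: "h0 > 0"
    and D: "\<And>h. 0 < h \<Longrightarrow> h < h0 \<Longrightarrow> integral {0..1} (\<lambda>x. \<bar>f (x + h) - f x\<bar>) \<le> D * h"
  shows "integral {0..1} (\<lambda>x. \<bar>g x\<bar>) \<le> D"
proof (rule L1_norm_le_dual[OF acD(3)[OF f]])
  fix \<theta> assume \<theta>: "cper \<theta>" "\<And>x. \<bar>\<theta> x\<bar> \<le> (1::real)"
  define J where "J = integral {0..1} (\<lambda>x. \<bar>g x\<bar>)"
  have J0: "J \<ge> 0" unfolding J_def by (intro integral_nonneg acD[OF f]) auto
  obtain F where F: "ac F (\<lambda>x. \<theta> x - integral {0..1} \<theta>)" using cper_primitive[OF \<theta>(1)] by blast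
  define m where "m = integral {0..1} \<theta>"
  note F = F[folded m_def]
  have "integral {0..1} (\<lambda>x. g x * \<theta> x) \<le> D + e * J" if e: "e > 0" for e
  proof -
    obtain d where d: "d > 0" "\<And>x y. \<bar>x - y\<bar> < d \<Longrightarrow> \<bar>\<theta> x - \<theta> y\<bar> < e" using cper_uniform[OF \<theta>(1) e] by blast
    define h where "h = min d h0 / 2"
    have h: "h > 0" "h < h0" "h < d" using d h0 by (auto simp: h_def min_def field_simps)
    \<comment> \<open>Average of \<theta> over [x - h, x], expressed through the primitive
      \<open>F\<close> of \<theta> - m. Its derivative is a difference quotient of \<theta>, which
      integration by parts and a translation turn into one of \<open>f\<close>. The form
      \<open>x + (- h) + h\<close> matches the double use of \<open>ac_shift\<close>.\<close>
    define S where "S x = m + (1/h) * (F (x + (- h) + h) - F (x + (- h)))" for x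
    have S: "ac S (\<lambda>x. 0 + (1/h) * ((\<theta> (x + (-h) + h) - m) - (\<theta> (x + (-h)) - m)))"
      unfolding S_def
      using ac_add[OF ac_const[of m] ac_cmult[OF ac_diff[OF ac_shift[OF ac_shift[OF F, of h], of "-h"] ac_shift[OF F, of "-h"]], of "1/h"]] by simp
    have Sb: "\<bar>S x - \<theta> x\<bar> \<le> e" for x
    proof -
      have "((\<lambda>y. (\<theta> y - m) - (\<theta> x - m)) has_integral (F x - F (x - h)) - (\<theta> x - m) * h) (cbox (x - h) x)"
        using has_integral_diff[OF acD(4)[OF F, of "x-h" x] has_integral_const_real[of "\<theta> x - m" "x - h" x]] h
        by (simp add: mult.commute)
      then have "norm ((F x - F (x - h)) - (\<theta> x - m) * h) \<le> e * measure lborel (cbox (x - h) x)"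
        by (rule has_integral_bound[rotated]) (use e h in \<open>auto intro!: less_imp_le d(2)\<close>)
      then have "\<bar>((F x - F (x - h)) - (\<theta> x - m) * h) / h\<bar> \<le> e" using h by (simp add: field_simps)
      moreover have "((F x - F (x - h)) - (\<theta> x - m) * h) / h = S x - \<theta> x" using h by (simp add: S_def field_simps)
      ultimately show ?thesis by simp
    qed
    have L: "L1p (\<lambda>x. g x * S x)" "L1p (\<lambda>x. g x * \<theta> x)"
      using acD[OF f] acD[OF S] cper_L2p[OF \<theta>(1)] by (auto intro: L2p_mult)
    have "integral {0..1} (\<lambda>x. g x * \<theta> x) - integral {0..1} (\<lambda>x. g x * S x) = integral {0..1} (\<lambda>x. g x * \<theta> x - g x * S x)"
      by (rule hk_integral_diff[symmetric]) (intro L1pD(4) L)+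
    also have "\<dots> \<le> integral {0..1} (\<lambda>x. e * \<bar>g x\<bar>)"
    proof (rule integral_le)
      show "(\<lambda>x. g x * \<theta> x - g x * S x) integrable_on {0..1}" by (intro integrable_diff L1pD(4) L)
      show "(\<lambda>x. e * \<bar>g x\<bar>) integrable_on {0..1}" by (intro integrable_on_mult_right acD[OF f])
      fix x
      have "g x * \<theta> x - g x * S x \<le> \<bar>g x * (\<theta> x - S x)\<bar>" by (simp add: right_diff_distrib)
      also have "\<dots> \<le> \<bar>g x\<bar> * e" using Sb[of x] unfolding abs_mult by (intro mult_left_mono) (auto simp: abs_minus_commute)
      finally show "g x * \<theta> x - g x * S x \<le> e * \<bar>g x\<bar>" by (simp add: mult.commute)
    qed
    also have "\<dots> = e * J" by (simp add: J_def)
    finally have 1: "integral {0..1} (\<lambda>x. g x * \<theta> x) \<le> integral {0..1} (\<lambda>x. g x * S x) + e * J" by simp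
    note cf = acD(6)[OF f]
    have c3: "cper (\<lambda>x. f x * \<theta> (x - h))" "cper (\<lambda>x. f x * \<theta> x)" "cper (\<lambda>x. f (x + h) * \<theta> x)" "cper (\<lambda>x. f (x + h))" "cper f"
      by (rule cper_intros(4)[OF cf cper_shift(2)[OF \<theta>(1)]] cper_intros(4)[OF cf \<theta>(1)]
         cper_intros(4)[OF cper_shift(1)[OF cf] \<theta>(1)] cper_shift(1)[OF cf] cf)+
    have "integral {0..1} (\<lambda>x. g x * S x) = - integral {0..1} (\<lambda>x. f x * (0 + (1/h) * ((\<theta> (x + (-h) + h) - m) - (\<theta> (x + (-h)) - m))))"
      by (rule ac_parts[OF f S])
    also have "\<dots> = (1/h) * integral {0..1} (\<lambda>x. f x * \<theta> (x - h) - f x * \<theta> x)"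
      unfolding integral_mult_right[symmetric] integral_neg[symmetric]
      by (intro integral_cong) (auto simp: algebra_simps)
    also have "integral {0..1} (\<lambda>x. f x * \<theta> (x - h) - f x * \<theta> x) = integral {0..1} (\<lambda>x. f x * \<theta> (x - h)) - integral {0..1} (\<lambda>x. f x * \<theta> x)"
      by (intro hk_integral_diff L1pD(4) cper_L1p c3)
    also have "integral {0..1} (\<lambda>x. f x * \<theta> (x - h)) = integral {0..1} (\<lambda>x. f (x + h) * \<theta> x)"
      using per_integral_shift[OF cper_L1p[OF cper_intros(4)[OF acD(6)[OF f] cper_shift(2)[OF \<theta>(1), of h]]], of h] by simp
    also have "\<dots> - integral {0..1} (\<lambda>x. f x * \<theta> x) = integral {0..1} (\<lambda>x. f (x + h) * \<theta> x - f x * \<theta> x)"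
      by (intro hk_integral_diff[symmetric] L1pD(4) cper_L1p c3)
    also have "\<dots> \<le> integral {0..1} (\<lambda>x. \<bar>f (x + h) - f x\<bar>)"
    proof (rule integral_le)
      fix x
      have "f (x + h) * \<theta> x - f x * \<theta> x \<le> \<bar>(f (x + h) - f x) * \<theta> x\<bar>" by (simp add: left_diff_distrib)
      also have "\<dots> \<le> \<bar>f (x + h) - f x\<bar> * 1" unfolding abs_mult by (intro mult_left_mono \<theta>) auto
      finally show "f (x + h) * \<theta> x - f x * \<theta> x \<le> \<bar>f (x + h) - f x\<bar>" by simp
    qed (intro L1pD(4) cper_L1p c3 cper_intros(3) cper_intros(6))+
    also have "\<dots> \<le> D * h" using D h by auto
    finally have "integral {0..1} (\<lambda>x. g x * S x) \<le> D" using h by (simp add: field_simps)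
    then show ?thesis using 1 by simp
  qed
  note * = this
  show "integral {0..1} (\<lambda>x. g x * \<theta> x) \<le> D"
  proof (rule field_le_epsilon)
    fix e :: real assume e: "e > 0"
    have "integral {0..1} (\<lambda>x. g x * \<theta> x) \<le> D + e / (J + 1) * J" using J0 e by (intro *) auto
    also have "e / (J + 1) * J \<le> e" using J0 e by (simp add: field_simps)
    finally show "integral {0..1} (\<lambda>x. g x * \<theta> x) \<le> D + e" by simp
  qed
qed

section \<open>The space \<open>H\<^sup>1\<close>\<close>

lemma H_spaceD: assumes "v \<in> H_space"
  shows "L2p v" "integral {0..1} v = 0"
proof -
  have 1: "v \<in> borel_measurable borel" "per v" "set_integrable lborel {0..1} (\<lambda>x. (v x)\<^sup>2)" "circle_integral v = 0"
    using assms by (auto simp: H_space_def per_def)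
  show "L2p v" using 1 per_set_integrable[OF per_intros(5)[OF 1(2)] 1(3)] by (auto simp: L2p_def)
  then show "integral {0..1} v = 0" using L1pD(6)[OF L2p_L1p] 1(4) by simp
qed

lemma H_spaceI: "L2p v \<Longrightarrow> integral {0..1} v = 0 \<Longrightarrow> v \<in> H_space"
  unfolding H_space_def using L1pD(6)[OF L2p_L1p[of v]] by (auto simp: L2p_def per_def)

lemma H_norm_eq: "L2p v \<Longrightarrow> H_norm v = sqrt (integral {0..1} (\<lambda>x. (v x)\<^sup>2))"
  unfolding H_norm_def using L1pD(6)[of "\<lambda>x. (v x)\<^sup>2"] by (simp add: L2p_cong)

lemma H_norm_nonneg: "H_norm v \<ge> 0"
  unfolding H_norm_def circle_integral_def set_lebesgue_integral_def
  by (intro real_sqrt_ge_zero integral_nonneg_AE) auto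

lemma integral_cong_AE:
  assumes "L1p f" "L1p g" "AE x in lborel. f x = g x"
  shows "integral {0..1} f = integral {0..1} g"
proof -
  have "(LINT x:{0..1}|lborel. f x) = (LINT x:{0..1}|lborel. g x)"
    by (rule set_lebesgue_integral_cong_AE) (use assms L1pD(1) in auto)
  then show ?thesis using L1pD(6)[OF assms(1)] L1pD(6)[OF assms(2)] by (simp add: circle_integral_def)
qed

lemma ac_weak_derivative: assumes "ac f g" shows "weak_derivative f g"
  unfolding weak_derivative_def
proof (intro allI impI, elim conjE)
  fix \<phi> \<phi>' :: "real \<Rightarrow> real"
  assume "\<forall>x. \<phi> (x + 1) = \<phi> x" "\<forall>x. (\<phi> has_real_derivative \<phi>' x) (at x)" "continuous_on UNIV \<phi>'"
  then have p: "ac \<phi> \<phi>'" by (intro ac_C1) (auto simp: per_def)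
  have "L1p (\<lambda>x. f x * \<phi>' x)" "L1p (\<lambda>x. g x * \<phi> x)"
    using acD[OF assms] acD[OF p] by (auto intro: L2p_mult)
  then show "circle_integral (\<lambda>x. f x * \<phi>' x) = - circle_integral (\<lambda>x. g x * \<phi> x)"
    using ac_parts[OF assms p] by (simp add: L1pD(6))
qed

text \<open>Testing with primitives of arbitrary continuous functions shows that the difference
  \<open>D\<close> of primitives of \<open>g1\<close> and \<open>g2\<close> is orthogonal to all
  continuous functions of mean zero. Taking \<open>D\<close> minus its mean as test function makes
  \<open>D\<close> constant; its translation differences vanish, and so does the L1 norm of its
  derivative.\<close>

lemma weak_derivative_unique:
  assumes "L2p g1" "L2p g2" "integral {0..1} g1 = 0" "integral {0..1} g2 = 0"
    "weak_derivative u1 g1" "weak_derivative u2 g2" "L1p u1" "L1p u2" "AE x in lborel. u1 x = u2 x"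
  shows "AE x in lborel. g1 x = g2 x"
proof -
  obtain U1 where 1: "ac U1 g1" using ac_primitive[OF assms(1,3)] by blast
  obtain U2 where 2: "ac U2 g2" using ac_primitive[OF assms(2,4)] by blast
  have L: "L1p g1" "L1p g2" using assms L2p_L1p by auto
  have C1: "integral {0..1} (\<lambda>x. g1 x * \<phi> x) = integral {0..1} (\<lambda>x. g2 x * \<phi> x)"
    if "per \<phi>" "\<And>x. (\<phi> has_real_derivative \<phi>' x) (at x)" "continuous_on UNIV \<phi>'" for \<phi> \<phi>'
  proof -
    have ac: "ac \<phi> \<phi>'" using ac_C1 that by auto
    have "(\<forall>x. \<phi> (x + 1) = \<phi> x) \<and> (\<forall>x. (\<phi> has_real_derivative \<phi>' x) (at x)) \<and> continuous_on UNIV \<phi>'"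
      using that by (auto simp: per_def)
    then have "circle_integral (\<lambda>x. u1 x * \<phi>' x) = - circle_integral (\<lambda>x. g1 x * \<phi> x)"
      "circle_integral (\<lambda>x. u2 x * \<phi>' x) = - circle_integral (\<lambda>x. g2 x * \<phi> x)"
      using assms(5,6) unfolding weak_derivative_def by blast+
    moreover have "circle_integral (\<lambda>x. u1 x * \<phi>' x) = circle_integral (\<lambda>x. u2 x * \<phi>' x)"
      unfolding circle_integral_def
    proof (rule set_lebesgue_integral_cong_AE)
      have [measurable]: "\<phi>' \<in> borel_measurable borel" "u1 \<in> borel_measurable borel" "u2 \<in> borel_measurable borel"
        using that(3) L1pD(1)[OF assms(7)] L1pD(1)[OF assms(8)] by (auto intro: borel_measurable_continuous_onI)
      show "(\<lambda>x. u1 x * \<phi>' x) \<in> borel_measurable lborel" "(\<lambda>x. u2 x * \<phi>' x) \<in> borel_measurable lborel" by simp_all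
      show "AE x\<in>{0..1} in lborel. u1 x * \<phi>' x = u2 x * \<phi>' x" using assms(9) by eventually_elim auto
    qed simp
    moreover have "L1p (\<lambda>x. g1 x * \<phi> x)" "L1p (\<lambda>x. g2 x * \<phi> x)" using assms acD[OF ac] by (auto intro: L2p_mult)
    ultimately show ?thesis by (simp add: L1pD(6))
  qed
  have UU: "integral {0..1} (\<lambda>x. (U1 x - U2 x) * (\<theta> x - integral {0..1} \<theta>)) = 0" if \<theta>: "cper \<theta>" for \<theta>
  proof -
    obtain F where F: "ac F (\<lambda>x. \<theta> x - integral {0..1} \<theta>)" "\<And>x. (F has_real_derivative (\<theta> x - integral {0..1} \<theta>)) (at x)"
      using cper_primitive[OF \<theta>] by blast
    have "continuous_on UNIV (\<lambda>x. \<theta> x - integral {0..1} \<theta>)"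
      using cperD(1)[OF \<theta>] by (intro continuous_intros)
    from C1[OF acD(1)[OF F(1)] F(2) this]
    have "integral {0..1} (\<lambda>x. g1 x * F x) = integral {0..1} (\<lambda>x. g2 x * F x)" .
    moreover have "integral {0..1} (\<lambda>x. (g1 x - g2 x) * F x) = integral {0..1} (\<lambda>x. g1 x * F x) - integral {0..1} (\<lambda>x. g2 x * F x)"
      unfolding left_diff_distrib
      by (intro hk_integral_diff L1pD(4) L2p_mult acD[OF F(1)] assms)
    ultimately show ?thesis using ac_parts[OF ac_diff[OF 1 2] F(1)] by simp
  qed
  define D where "D x = U1 x - U2 x" for x
  have D: "ac D (\<lambda>x. g1 x - g2 x)" unfolding D_def by (intro ac_diff 1 2)
  define m where "m = integral {0..1} D"
  have iD: "D integrable_on {0..1}" using acD(8)[OF D] L1pD(4) by blast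
  have cDm: "cper (\<lambda>x. D x - m)" by (intro cper_intros acD(6)[OF D])
  have "integral {0..1} (\<lambda>x. (D x - m) * (D x - m)) = integral {0..1} (\<lambda>x. D x * (D x - m)) - integral {0..1} (\<lambda>x. m * (D x - m))"
    unfolding left_diff_distrib[of "D _" m]
    by (intro hk_integral_diff L1pD(4) L2p_mult cper_L2p cDm acD(6)[OF D] cper_intros(1))
  also have "integral {0..1} (\<lambda>x. D x * (D x - m)) = 0"
    using UU[OF acD(6)[OF D]] unfolding D_def[symmetric] m_def[symmetric] .
  also have "integral {0..1} (\<lambda>x. m * (D x - m)) = 0"
    using hk_integral_diff[OF iD integrable_const_ivl[of m]] by (simp add: m_def)
  finally have z: "integral {0..1} (\<lambda>x. (D x - m)\<^sup>2) = 0" by (simp add: power2_eq_square)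
  have "D x - m = 0" if "x \<in> {0..1}" for x
  proof -
    have "continuous_on {0..1} (\<lambda>x. (D x - m)\<^sup>2)"
      using cperD(1)[OF cDm] by (intro continuous_intros) (auto intro: continuous_on_subset cperD(1)[OF acD(6)[OF D]])
    then have "(D x - m)\<^sup>2 = 0"
      using z that by (subst (asm) integral_eq_0_iff) auto
    then show ?thesis by simp
  qed
  then have "D x = m" for x using per_frac[OF acD(1)[OF D], of x] frac_ge_0[of x] frac_lt_1[of x] by (auto simp: less_imp_le)
  then have "integral {0..1} (\<lambda>x. \<bar>g1 x - g2 x\<bar>) \<le> 0"
    by (intro L1_le_from_diff[OF D zero_less_one]) simp
  from AE_zero_L1[OF L1p_intros(2)[OF L] this] have "AE x in lborel. g1 x - g2 x = 0" .
  then show ?thesis by eventually_elim simp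
qed

text \<open>The difference between \<open>v\<close> and a primitive of its weak derivative is orthogonal to every \<open>C\<^sup>1\<close> derivative,
  hence to every continuous function of mean zero.\<close>

lemma H1_space_ac: assumes "v \<in> H1_space"
  shows "\<exists>f. ac f (dx v) \<and> (AE x in lborel. v x = f x) \<and> integral {0..1} f = 0"
    "dx v \<in> H_space" "weak_derivative v (dx v)"
proof -
  have "\<exists>g. g \<in> H_space \<and> weak_derivative v g" using assms by (auto simp: H1_space_def)
  then have d: "dx v \<in> H_space \<and> weak_derivative v (dx v)" unfolding dx_def by (rule someI_ex)
  then show "dx v \<in> H_space" "weak_derivative v (dx v)" by auto
  have v: "v \<in> H_space" using assms by (auto simp: H1_space_def)
  note vL = H_spaceD[OF v] L2p_L1p[OF H_spaceD(1)[OF v]]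
  obtain U0 where U0: "ac U0 (dx v)" using ac_primitive d H_spaceD by metis
  define m where "m = integral {0..1} U0"
  define U where "U x = U0 x - m" for x
  have U: "ac U (dx v)" using ac_diff[OF U0 ac_const[of m]] by (simp add: U_def[abs_def])
  have iU: "integral {0..1} U = 0" unfolding U_def[abs_def]
    using L1pD(4)[OF acD(8)[OF U0]] by (subst hk_integral_diff) (auto simp: m_def)
  define r where "r x = v x - U x" for x
  have r2: "L2p r" unfolding r_def using vL(1) acD(7)[OF U] by (rule L2p_intros(2))
  have ir: "integral {0..1} r = 0" unfolding r_def[abs_def] using iU vL L1pD(4)[OF acD(8)[OF U]] L1pD(4)[OF vL(3)]
    by (subst hk_integral_diff) auto
  have rz: "integral {0..1} (\<lambda>x. r x * (\<theta> x - integral {0..1} \<theta>)) = 0" if \<theta>: "cper \<theta>" for \<theta>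
  proof -
    obtain F where F: "ac F (\<lambda>x. \<theta> x - integral {0..1} \<theta>)" "\<And>x. (F has_real_derivative (\<theta> x - integral {0..1} \<theta>)) (at x)"
      using cper_primitive[OF \<theta>] by blast
    let ?t = "\<lambda>x. \<theta> x - integral {0..1} \<theta>"
    have "continuous_on UNIV ?t" using cperD(1)[OF \<theta>] by (intro continuous_intros)
    then have *: "(\<forall>x. F (x + 1) = F x) \<and> (\<forall>x. (F has_real_derivative ?t x) (at x)) \<and> continuous_on UNIV ?t"
      using F(2) acD(1)[OF F(1)] unfolding per_def by blast
    have "circle_integral (\<lambda>x. v x * ?t x) = - circle_integral (\<lambda>x. dx v x * F x)"
      using d[THEN conjunct2, unfolded weak_derivative_def, rule_format, OF *] .
    moreover have "circle_integral (\<lambda>x. U x * ?t x) = - circle_integral (\<lambda>x. dx v x * F x)"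
      using ac_weak_derivative[OF U, unfolded weak_derivative_def, rule_format, OF *] .
    moreover have L: "L1p (\<lambda>x. v x * ?t x)" "L1p (\<lambda>x. U x * ?t x)"
      using L2p_mult vL(1) acD(7)[OF U] acD(2)[OF F(1)] by blast+
    ultimately have "integral {0..1} (\<lambda>x. v x * ?t x) = integral {0..1} (\<lambda>x. U x * ?t x)" by (simp add: L1pD(6))
    then show ?thesis unfolding r_def left_diff_distrib[of "v _"]
      using hk_integral_diff[OF L1pD(4)[OF L(1)] L1pD(4)[OF L(2)]] by simp
  qed
  have "integral {0..1} (\<lambda>x. \<bar>r x\<bar>) \<le> 0"
  proof (rule L1_norm_le_dual)
    fix \<theta> assume \<theta>: "cper \<theta>"
    have L: "L1p (\<lambda>x. r x * \<theta> x)" "L1p (\<lambda>x. integral {0..1} \<theta> * r x)"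
      using L2p_mult[OF r2 cper_L2p[OF \<theta>]] L1p_intros(3)[OF L2p_L1p[OF r2]] by auto
    have "integral {0..1} (\<lambda>x. r x * \<theta> x) - integral {0..1} (\<lambda>x. integral {0..1} \<theta> * r x) = integral {0..1} (\<lambda>x. r x * (\<theta> x - integral {0..1} \<theta>))"
      by (subst hk_integral_diff[symmetric]) (use L1pD(4) L in \<open>auto simp: algebra_simps\<close>)
    then show "integral {0..1} (\<lambda>x. r x * \<theta> x) \<le> 0" using rz[OF \<theta>] ir by simp
  qed (rule L2p_L1p[OF r2])
  from AE_zero_L1[OF L2p_L1p[OF r2] this] have "AE x in lborel. r x = 0" .
  then have "AE x in lborel. v x = U x" by eventually_elim (simp add: r_def)
  then show "\<exists>f. ac f (dx v) \<and> (AE x in lborel. v x = f x) \<and> integral {0..1} f = 0" using U iU by blast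
qed

text \<open>\<open>dx\<close> is a choice among representatives; this lemma is how it is computed,
  from any absolutely continuous representative of \<open>v\<close>.\<close>

lemma dx_unique:
  assumes v: "v \<in> H_space" and f: "ac f g" "AE x in lborel. v x = f x"
  shows "v \<in> H1_space" "AE x in lborel. dx v x = g x" "integral {0..1} f = 0"
proof -
  note vL = H_spaceD[OF v] L2p_L1p[OF H_spaceD(1)[OF v]]
  have gH: "g \<in> H_space" using acD(2)[OF f(1)] ac_integral_0[OF f(1)] by (rule H_spaceI)
  show "integral {0..1} f = 0" using integral_cong_AE[OF vL(3) acD(8)[OF f(1)] f(2)] vL(2) by simp
  have "weak_derivative v g"
    unfolding weak_derivative_def
  proof (intro allI impI)
    fix \<phi> \<phi>' :: "real \<Rightarrow> real"
    assume *: "(\<forall>x. \<phi> (x + 1) = \<phi> x) \<and> (\<forall>x. (\<phi> has_real_derivative \<phi>' x) (at x)) \<and> continuous_on UNIV \<phi>'"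
    then have p: "ac \<phi> \<phi>'" by (intro ac_C1) (auto simp: per_def)
    have "integral {0..1} (\<lambda>x. v x * \<phi>' x) = integral {0..1} (\<lambda>x. f x * \<phi>' x)"
      by (rule integral_cong_AE[OF L2p_mult[OF vL(1) acD(2)[OF p]] L2p_mult[OF acD(7)[OF f(1)] acD(2)[OF p]]])
         (use f(2) in \<open>eventually_elim, simp\<close>)
    then have "circle_integral (\<lambda>x. v x * \<phi>' x) = circle_integral (\<lambda>x. f x * \<phi>' x)"
      using L1pD(6)[OF L2p_mult[OF vL(1) acD(2)[OF p]]] L1pD(6)[OF L2p_mult[OF acD(7)[OF f(1)] acD(2)[OF p]]] by simp
    then show "circle_integral (\<lambda>x. v x * \<phi>' x) = - circle_integral (\<lambda>x. g x * \<phi> x)"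
      using ac_weak_derivative[OF f(1)] * unfolding weak_derivative_def by metis
  qed
  then show "v \<in> H1_space" using v gH by (auto simp: H1_space_def)
  note * = H1_space_ac(2,3)[OF this]
  show "AE x in lborel. dx v x = g x"
    by (rule weak_derivative_unique[OF H_spaceD(1)[OF *(1)] acD(2)[OF f(1)] H_spaceD(2)[OF *(1)] ac_integral_0[OF f(1)] *(2)
          ac_weak_derivative[OF f(1)] vL(3) acD(8)[OF f(1)] f(2)])
qed

lemma ac_H1: assumes "ac f g" "integral {0..1} f = 0" shows "f \<in> H1_space" "AE x in lborel. dx f x = g x"
  using dx_unique[OF H_spaceI[OF acD(7)[OF assms(1)] assms(2)] assms(1)] by auto

section \<open>Norm inequalities in L2 and H^1\<close>

text \<open>Cauchy-Schwarz, by optimizing \<open>s\<close> in 2 |f g| \<le> s f^2 + g^2 / s. If one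
  norm vanishes there is no optimal \<open>s\<close>, and \<open>s\<close> is taken arbitrarily
  large or arbitrarily small instead.\<close>

lemma integral_mult_sqrt_le:
  assumes "L2p f" "L2p g"
  shows "integral {0..1} (\<lambda>x. \<bar>f x * g x\<bar>) \<le> H_norm f * H_norm g"
proof -
  define a where "a = integral {0..1} (\<lambda>x. (f x)\<^sup>2)"
  define b where "b = integral {0..1} (\<lambda>x. (g x)\<^sup>2)"
  define c where "c = integral {0..1} (\<lambda>x. \<bar>f x * g x\<bar>)"
  have L: "L1p (\<lambda>x. (f x)\<^sup>2)" "L1p (\<lambda>x. (g x)\<^sup>2)" "L1p (\<lambda>x. \<bar>f x * g x\<bar>)"
    using assms L1p_intros(5)[OF L2p_mult[OF assms]] by (auto simp: L2p_cong)
  have ab: "a \<ge> 0" "b \<ge> 0" unfolding a_def b_def by (auto intro!: integral_nonneg L1pD(4) L)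
  have *: "2 * c \<le> s * a + b / s" if s: "s > 0" for s
  proof -
    have "integral {0..1} (\<lambda>x. 2 * \<bar>f x * g x\<bar>) \<le> integral {0..1} (\<lambda>x. s * (f x)\<^sup>2 + (1/s) * (g x)\<^sup>2)"
    proof (rule integral_le)
      fix x
      have "0 \<le> (s * \<bar>f x\<bar> - \<bar>g x\<bar>)\<^sup>2 / s" using s by simp
      also have "\<dots> = s * (f x)\<^sup>2 + (1/s) * (g x)\<^sup>2 - 2 * \<bar>f x * g x\<bar>"
        using s by (simp add: power2_diff power_mult_distrib abs_mult field_simps power2_eq_square)
      finally show "2 * \<bar>f x * g x\<bar> \<le> s * (f x)\<^sup>2 + (1/s) * (g x)\<^sup>2" by simp
    qed (intro integrable_add integrable_on_mult_right L1pD(4) L)+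
    also have "\<dots> = s * a + b / s"
      by (subst hk_integral_add[OF integrable_on_mult_right[OF L1pD(4)[OF L(1)]] integrable_on_mult_right[OF L1pD(4)[OF L(2)]]])
         (simp add: a_def b_def)
    finally show ?thesis by (simp add: c_def)
  qed
  have "c \<le> sqrt a * sqrt b"
  proof (cases "a = 0 \<or> b = 0")
    case False
    then have "2 * c \<le> sqrt b / sqrt a * a + b / (sqrt b / sqrt a)" using ab by (intro *) auto
    also have "\<dots> = 2 * (sqrt a * sqrt b)" using False ab
        by (simp add: real_div_sqrt field_simps)
    finally show ?thesis by simp
  next
    case True
    have "2 * c \<le> 0 + e" if e: "e > 0" for e
    proof -
      consider "a = 0" | "b = 0" using True by blast
      then show ?thesis
      proof cases
        case 1
        then have "2 * c \<le> b / ((b + 1) / e)" using *[of "(b + 1) / e"] e ab by simp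
        also have "\<dots> \<le> e" using e ab by (simp add: field_simps)
        finally show ?thesis by simp
      next
        case 2
        then have "2 * c \<le> e / (a + 1) * a" using *[of "e / (a + 1)"] e ab by simp
        also have "\<dots> \<le> e" using e ab by (simp add: field_simps)
        finally show ?thesis by simp
      qed
    qed
    then have "2 * c \<le> 0" using field_le_epsilon by blast
    then show ?thesis using True by auto
  qed
  then show ?thesis unfolding H_norm_eq[OF assms(1)] H_norm_eq[OF assms(2)] a_def b_def c_def .
qed

lemma L1_le_H_norm: assumes "L2p f" shows "integral {0..1} (\<lambda>x. \<bar>f x\<bar>) \<le> H_norm f"
  using integral_mult_sqrt_le[OF assms cper_L2p[OF cper_intros(1)[of 1]]] H_norm_eq[OF cper_L2p[OF cper_intros(1)[of 1]]] by simp

lemma H_norm_triangle: assumes "L2p f" "L2p g" shows "H_norm (\<lambda>x. f x + g x) \<le> H_norm f + H_norm g"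
proof -
  have L: "L1p (\<lambda>x. (f x)\<^sup>2)" "L1p (\<lambda>x. (g x)\<^sup>2)" "L1p (\<lambda>x. \<bar>f x * g x\<bar>)" "L1p (\<lambda>x. (f x + g x)\<^sup>2)"
    using assms L1p_intros(5)[OF L2p_mult[OF assms]] L2p_intros(1)[OF assms] by (auto simp: L2p_cong)
  note I = L1pD(4)[OF L(1)] L1pD(4)[OF L(2)] L1pD(4)[OF L(3)]
  have n: "(H_norm f)\<^sup>2 = integral {0..1} (\<lambda>x. (f x)\<^sup>2)" "(H_norm g)\<^sup>2 = integral {0..1} (\<lambda>x. (g x)\<^sup>2)"
      "(H_norm (\<lambda>x. f x + g x))\<^sup>2 = integral {0..1} (\<lambda>x. (f x + g x)\<^sup>2)"
    using assms L2p_intros(1)[OF assms] L by (auto simp: H_norm_eq intro!: integral_nonneg L1pD(4) real_sqrt_pow2)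
  have "(H_norm (\<lambda>x. f x + g x))\<^sup>2 \<le> integral {0..1} (\<lambda>x. (f x)\<^sup>2 + ((g x)\<^sup>2 + 2 * \<bar>f x * g x\<bar>))"
    unfolding n
  proof (rule integral_le)
    fix x
    have "f x * g x \<le> \<bar>f x * g x\<bar>" by simp
    then show "(f x + g x)\<^sup>2 \<le> (f x)\<^sup>2 + ((g x)\<^sup>2 + 2 * \<bar>f x * g x\<bar>)"
      unfolding power2_sum by (simp only: mult.assoc)
  qed (intro integrable_add integrable_on_mult_right L1pD(4) L)+
  also have "\<dots> = (H_norm f)\<^sup>2 + ((H_norm g)\<^sup>2 + 2 * integral {0..1} (\<lambda>x. \<bar>f x * g x\<bar>))"
    unfolding n using I by (simp add: hk_integral_add integrable_add integrable_on_mult_right)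
  also have "\<dots> \<le> (H_norm f + H_norm g)\<^sup>2"
    using integral_mult_sqrt_le[OF assms] by (simp add: power2_sum)
  finally show ?thesis
    by (rule power2_le_imp_le) (intro add_nonneg_nonneg H_norm_nonneg)
qed

text \<open>With vanishing mean, \<open>f x\<close> is the average of \<open>f x - f y\<close> over
  one period.\<close>

lemma ac_sup_bound: assumes f: "ac f g" and z: "integral {0..1} f = 0"
  shows "\<bar>f x\<bar> \<le> integral {0..1} (\<lambda>x. \<bar>g x\<bar>)"
proof -
  have i: "integral {x-1..x} f = 0" using per_integral_window[OF acD(8)[OF f], of "x-1"] z by simp
  have J: "integral {x-1..x} (\<lambda>x. \<bar>g x\<bar>) = integral {0..1} (\<lambda>x. \<bar>g x\<bar>)"
    using per_integral_window[OF L1p_intros(5)[OF acD(3)[OF f]], of "x-1"] by simp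
  have "f x = integral {x-1..x} (\<lambda>y. f x - f y)"
    using i L1pD(4)[OF acD(8)[OF f]] by (subst hk_integral_diff) auto
  also have "norm \<dots> \<le> integral {x-1..x} (\<lambda>y. integral {0..1} (\<lambda>x. \<bar>g x\<bar>))"
  proof (rule integral_norm_bound_integral)
    fix y assume y: "y \<in> {x-1..x}"
    have "\<bar>f x - f y\<bar> = \<bar>integral {y..x} g\<bar>" using acD(5)[OF f, of y x] y by simp
    also have "\<dots> \<le> integral {y..x} (\<lambda>x. \<bar>g x\<bar>)"
      using integral_norm_bound_integral[OF acD(9)[OF f] acD(10)[OF f]] by auto
    also have "\<dots> \<le> integral {x-1..x} (\<lambda>x. \<bar>g x\<bar>)"
      by (intro integral_subset_le acD[OF f]) (use y in auto)
    finally show "norm (f x - f y) \<le> integral {0..1} (\<lambda>x. \<bar>g x\<bar>)" using J by simp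
  qed (intro integrable_diff integrable_const_ivl L1pD(4)[OF acD(8)[OF f]])+
  finally show ?thesis by simp
qed

section \<open>A smooth approximation of the absolute value\<close>

text \<open>A convex regularization with bounded second derivative for fixed \<open>e\<close>:
  \<open>sabs1 e\<close>, the smoothed sign, then maps absolutely continuous functions to absolutely
  continuous functions and yields admissible test functions. \<open>sabs1\<close> and
  \<open>sabs2\<close> are its first two derivatives.\<close>

definition sabs :: "real \<Rightarrow> real \<Rightarrow> real" where "sabs e s = sqrt (s\<^sup>2 + e\<^sup>2)"
definition sabs1 :: "real \<Rightarrow> real \<Rightarrow> real" where "sabs1 e s = s / sqrt (s\<^sup>2 + e\<^sup>2)"
definition sabs2 :: "real \<Rightarrow> real \<Rightarrow> real" where "sabs2 e s = e\<^sup>2 / (sqrt (s\<^sup>2 + e\<^sup>2)) ^ 3"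

context
  fixes e :: real
  assumes e: "e > 0"
begin

lemma sabs_pos: "sabs e s > 0" "e \<le> sabs e s" "\<bar>s\<bar> \<le> sabs e s" "sabs e s \<le> \<bar>s\<bar> + e" "(sabs e s)\<^sup>2 = s\<^sup>2 + e\<^sup>2"
proof -
  have p: "s\<^sup>2 + e\<^sup>2 > 0" using e by (simp add: add_nonneg_pos)
  then show "sabs e s > 0" "(sabs e s)\<^sup>2 = s\<^sup>2 + e\<^sup>2" by (auto simp: sabs_def)
  show "e \<le> sabs e s" "\<bar>s\<bar> \<le> sabs e s" unfolding sabs_def using e by (auto intro!: real_le_rsqrt)
  show "sabs e s \<le> \<bar>s\<bar> + e" unfolding sabs_def
    using e by (intro real_le_lsqrt) (auto simp: power2_sum)
qed

lemma sabs_deriv: "(sabs e has_real_derivative sabs1 e s) (at s)"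
  "(sabs1 e has_real_derivative sabs2 e s) (at s)"
proof -
  have p: "s\<^sup>2 + e\<^sup>2 > 0" using e by (simp add: add_nonneg_pos)
  show "(sabs e has_real_derivative sabs1 e s) (at s)" unfolding sabs_def[abs_def] sabs1_def
    using p e by (auto intro!: derivative_eq_intros simp: field_simps)
  define q where "q = sqrt (s\<^sup>2 + e\<^sup>2)"
  have q: "q > 0" "q\<^sup>2 = s\<^sup>2 + e\<^sup>2" using p by (auto simp: q_def)
  have "(sabs1 e has_real_derivative (1 * q - s * (inverse q / 2 * (2 * s))) / (q * q)) (at s)"
    unfolding sabs1_def[abs_def] q_def using p by (auto intro!: derivative_eq_intros)
  moreover have "(1 * q - s * (inverse q / 2 * (2 * s))) / (q * q) = sabs2 e s"
    unfolding sabs2_def q_def[symmetric] using q by (simp add: field_simps power2_eq_square power3_eq_cube)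
  ultimately show "(sabs1 e has_real_derivative sabs2 e s) (at s)" by simp
qed

lemma sabs_cont: "continuous_on UNIV (sabs1 e)" "continuous_on UNIV (sabs2 e)" "continuous_on UNIV (sabs e)"
proof -
  have p: "sqrt (s\<^sup>2 + e\<^sup>2) \<noteq> 0" for s using sabs_pos(1)[of s] unfolding sabs_def by linarith
  then show "continuous_on UNIV (sabs1 e)" "continuous_on UNIV (sabs2 e)" "continuous_on UNIV (sabs e)"
    unfolding sabs1_def[abs_def] sabs2_def[abs_def] sabs_def[abs_def]
    by (intro continuous_intros ballI p power_not_zero)+
qed

lemma sabs1_le: "\<bar>sabs1 e s\<bar> \<le> 1"
  using sabs_pos(1,3)[of s] unfolding sabs1_def sabs_def[symmetric] by (simp add: field_simps)

lemma sabs2_bounds: "0 \<le> sabs2 e s" "sabs2 e s \<le> 1 / e"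
proof -
  show "0 \<le> sabs2 e s" unfolding sabs2_def sabs_def[symmetric] using sabs_pos(1)[of s] by simp
  have "e * e * e \<le> (sabs e s)^3" using power_mono[OF sabs_pos(2)[of s], of 3] e by (simp add: power3_eq_cube)
  then show "sabs2 e s \<le> 1 / e" unfolding sabs2_def sabs_def[symmetric] using sabs_pos(1)[of s] e
    by (simp add: field_simps power2_eq_square)
qed

text \<open>For the absolute value itself this difference is zero; \<open>e\<close> is the price of
  regularization in the transport term.\<close>

lemma sabs_legendre: "\<bar>s * sabs1 e s - sabs e s\<bar> \<le> e"
proof -
  have "s * sabs1 e s - sabs e s = - (e\<^sup>2 / sabs e s)"
    using sabs_pos(1,5)[of s] unfolding sabs1_def sabs_def[symmetric] by (simp add: field_simps power2_eq_square)
  moreover have "e\<^sup>2 / sabs e s \<le> e"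
    using sabs_pos(1,2)[of s] e by (simp add: field_simps power2_eq_square)
  moreover have "e\<^sup>2 / sabs e s \<ge> 0" using sabs_pos(1)[of s] by simp
  ultimately show ?thesis by simp
qed

text \<open>The tangent inequality amounts to Cauchy-Schwarz for the vectors (a, e) and (b,
  e).\<close>

lemma sabs_convex: "sabs e a - sabs e b \<le> sabs1 e a * (a - b)"
proof -
  have "(a * b + e\<^sup>2)\<^sup>2 \<le> (a\<^sup>2 + e\<^sup>2) * (b\<^sup>2 + e\<^sup>2)"
  proof -
    have "(a\<^sup>2 + e\<^sup>2) * (b\<^sup>2 + e\<^sup>2) - (a * b + e\<^sup>2)\<^sup>2 = (e * (a - b))\<^sup>2"
      by (simp add: power2_eq_square algebra_simps)
    then show ?thesis using zero_le_power2[of "e * (a - b)"] by linarith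
  qed
  also have "\<dots> = (sabs e a * sabs e b)\<^sup>2" using sabs_pos(5) by (simp add: power_mult_distrib)
  finally have "a * b + e\<^sup>2 \<le> sabs e a * sabs e b"
    by (rule power2_le_imp_le) (simp add: sabs_pos less_imp_le)
  then have "(sabs e a - sabs e b) * sabs e a \<le> a * (a - b)"
    using sabs_pos(5)[of a] by (simp add: algebra_simps power2_eq_square)
  then show ?thesis using sabs_pos(1)[of a] unfolding sabs1_def sabs_def[symmetric] by (simp add: field_simps)
qed

end

section \<open>The tested equation for the difference of two translates\<close>

lemma ac_lipschitz: assumes "ac f g" "\<And>x. \<bar>g x\<bar> \<le> G" "h \<ge> 0" shows "\<bar>f (x + h) - f x\<bar> \<le> G * h"
proof -
  have "G \<ge> 0" using assms(2)[of 0] by linarith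
  from has_integral_bound[OF this, of g "f (x+h) - f x" x "x + h"] assms(2,3) acD(4)[OF assms(1), of x "x+h"]
  show ?thesis by simp
qed

text \<open>The adjoint of taking translation differences: testing the equation with
  \<open>\<theta> (x - h) - \<theta> x\<close> is testing the difference of two translated equations
  with \<theta>.\<close>

lemma delta_parts:
  assumes "L2p w" "L2p \<theta>"
  shows "integral {0..1} (\<lambda>x. w x * (\<theta> (x - h) - \<theta> x)) = integral {0..1} (\<lambda>x. (w (x + h) - w x) * \<theta> x)"
proof -
  have s: "L2p (\<lambda>x. \<theta> (x - h))" "L2p (\<lambda>x. w (x + h))" using L2p_intros(6)[OF assms(2), of "-h"] L2p_intros(6)[OF assms(1)] by auto
  note L = L2p_mult[OF assms(1) s(1)] L2p_mult[OF assms(1,2)] L2p_mult[OF s(2) assms(2)]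
  note I = L1pD(4)[OF L(1)] L1pD(4)[OF L(2)] L1pD(4)[OF L(3)]
  show ?thesis unfolding left_diff_distrib right_diff_distrib
    hk_integral_diff[OF I(1,2)] hk_integral_diff[OF I(3,2)]
    using per_integral_shift[OF L(1), of h] by simp
qed

lemma delta_sabs_ac:
  assumes "e > 0" "ac z z'"
  shows "ac (\<lambda>x. z (x + h) - z x) (\<lambda>x. z' (x + h) - z' x)"
    "ac (\<lambda>x. sabs1 e (z (x + h) - z x)) (\<lambda>x. sabs2 e (z (x + h) - z x) * (z' (x + h) - z' x))"
    "ac (\<lambda>x. sabs e (z (x + h) - z x)) (\<lambda>x. sabs1 e (z (x + h) - z x) * (z' (x + h) - z' x))"
proof -
  show 1: "ac (\<lambda>x. z (x + h) - z x) (\<lambda>x. z' (x + h) - z' x)" by (rule ac_diff[OF ac_shift[OF assms(2)] assms(2)])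
  show "ac (\<lambda>x. sabs1 e (z (x + h) - z x)) (\<lambda>x. sabs2 e (z (x + h) - z x) * (z' (x + h) - z' x))"
    by (rule ac_chain[OF 1 sabs_deriv(2)[OF assms(1)] sabs_cont(2)[OF assms(1)]])
  show "ac (\<lambda>x. sabs e (z (x + h) - z x)) (\<lambda>x. sabs1 e (z (x + h) - z x) * (z' (x + h) - z' x))"
    by (rule ac_chain[OF 1 sabs_deriv(1)[OF assms(1)] sabs_cont(1)[OF assms(1)]])
qed

text \<open>Kruzhkov's argument for two translates of the solution: with \<open>w\<close> the mean of the two translates,
  the transport term \<open>(w d)' sgn d = (w |d|)'\<close> integrates to zero up to the regularization of the sign,
  and the viscous term has the good sign.\<close>

lemma burgers_delta_bound:
  assumes u: "ac u u'" "integral {0..1} u = 0" and Y: "integral {0..1} (\<lambda>x. \<bar>u' x\<bar>) \<le> Y"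
    and \<eta>: "ac \<eta> \<eta>1" "ac \<eta>1 \<eta>2" "ac \<eta>2 \<eta>3"
    and G: "\<And>x. \<bar>\<eta>1 x\<bar> \<le> G" "\<And>x. \<bar>\<eta>2 x\<bar> \<le> G" "\<And>x. \<bar>\<eta>3 x\<bar> \<le> G"
    and h: "h > 0" and \<nu>: "0 \<le> \<nu>" "\<nu> \<le> 1" and e: "e > 0"
    and z: "\<And>x. z x = u x - \<eta> x" "\<And>x. z' x = u' x - \<eta>1 x"
  defines "\<theta> \<equiv> (\<lambda>x. sabs1 e (z (x + h) - z x))"
  defines "\<theta>' \<equiv> (\<lambda>x. sabs2 e (z (x + h) - z x) * (z' (x + h) - z' x))"
  shows "- (e * Y + h * G * (2 * Y + 1)) \<le>
    integral {0..1} (\<lambda>x. (u (x + h) * u' (x + h) - u x * u' x) * \<theta> x) + \<nu> * integral {0..1} (\<lambda>x. (u' (x + h) - u' x) * \<theta>' x)"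
proof -
  define d where "d x = z (x + h) - z x" for x
  define d' where "d' x = z' (x + h) - z' x" for x
  define w where "w x = (1/2) * (u (x + h) + u x)" for x
  define w' where "w' x = (1/2) * (u' (x + h) + u' x)" for x
  define k where "k x = \<eta> (x + h) - \<eta> x" for x
  define k1 where "k1 x = \<eta>1 (x + h) - \<eta>1 x" for x
  define k2 where "k2 x = \<eta>2 (x + h) - \<eta>2 x" for x
  have acz: "ac z z'" using ac_diff[OF u(1) \<eta>(1)] z by (simp add: z[abs_def])
  note acd = delta_sabs_ac(1)[OF e acz, of h, folded d_def d'_def]
  note act = delta_sabs_ac(2)[OF e acz, of h, folded d_def d'_def]
  note acs = delta_sabs_ac(3)[OF e acz, of h, folded d_def d'_def]
  have act': "ac \<theta> \<theta>'" using act unfolding \<theta>_def \<theta>'_def d_def d'_def .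
  have acw: "ac w w'" unfolding w_def w'_def by (intro ac_cmult ac_add ac_shift u)
  have ack: "ac k k1" "ac k1 k2" unfolding k_def k1_def k2_def by (rule ac_diff[OF ac_shift], fact, fact)+
  have G0: "G \<ge> 0" using G(1)[of 0] by linarith
  have kb: "\<bar>k x\<bar> \<le> h * G" "\<bar>k1 x\<bar> \<le> h * G" "\<bar>k2 x\<bar> \<le> h * G" for x
    using ac_lipschitz[OF \<eta>(1) G(1), of h x] ac_lipschitz[OF \<eta>(2) G(2), of h x] ac_lipschitz[OF \<eta>(3) G(3), of h x] h
    by (auto simp: k_def k1_def k2_def mult.commute)
  have ub: "\<bar>u x\<bar> \<le> Y" for x using ac_sup_bound[OF u, of x] Y by linarith
  have wb: "\<bar>w x\<bar> \<le> Y" for x using ub[of x] ub[of "x+h"] by (simp add: w_def)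
  have \<theta>b: "\<bar>\<theta> x\<bar> \<le> 1" for x unfolding \<theta>_def by (rule sabs1_le[OF e])
  have Y0: "Y \<ge> 0" using ub[of 0] by linarith
  have w'i: "integral {0..1} (\<lambda>x. \<bar>w' x\<bar>) \<le> Y"
  proof -
    have L: "L1p (\<lambda>x. \<bar>u' (x + h)\<bar>)" "L1p (\<lambda>x. \<bar>u' x\<bar>)"
      using L1p_shift[OF L1p_intros(5)[OF acD(3)[OF u(1)]]] L1p_intros(5)[OF acD(3)[OF u(1)]] by auto
    have "integral {0..1} (\<lambda>x. \<bar>w' x\<bar>) \<le> integral {0..1} (\<lambda>x. (1/2) * (\<bar>u' (x + h)\<bar> + \<bar>u' x\<bar>))"
      by (intro integral_le acD(10)[OF acw] integrable_on_mult_right integrable_add L1pD(4) L) (simp add: w'_def)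
    also have "\<dots> = (1/2) * (integral {0..1} (\<lambda>x. \<bar>u' (x + h)\<bar>) + integral {0..1} (\<lambda>x. \<bar>u' x\<bar>))"
      using hk_integral_add[OF L1pD(4)[OF L(1)] L1pD(4)[OF L(2)]] by simp
    also have "integral {0..1} (\<lambda>x. \<bar>u' (x + h)\<bar>) = integral {0..1} (\<lambda>x. \<bar>u' x\<bar>)"
      by (rule per_integral_shift[OF L(2)])
    finally show ?thesis using Y by simp
  qed
  have acws: "ac (\<lambda>x. w x * sabs e (d x)) (\<lambda>x. w' x * sabs e (d x) + w x * (\<theta> x * d' x))"
    using ac_mult[OF acw acs] by (simp add: \<theta>_def d_def)
  define A where "A x = (u (x + h) * u' (x + h) - u x * u' x) * \<theta> x" for x
  define C where "C x = w' x * sabs e (d x) + w x * (\<theta> x * d' x)" for x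
  \<comment> \<open>\<open>A\<close> is the tested transport term and \<open>C\<close> the
    derivative of \<open>w * sabs e d\<close>, with integral zero. The increment of u u' is the
    derivative of \<open>w\<close> times the increment of \<open>u\<close>, and that increment is
    \<open>d + k\<close>. Hence the remainder has one regularization error and two terms due to the
    force.\<close>
  have AC: "A x - C x = w' x * (d x * \<theta> x - sabs e (d x)) + w' x * k x * \<theta> x + w x * k1 x * \<theta> x" for x
    unfolding A_def C_def w_def w'_def d_def d'_def k_def k1_def z by (simp add: algebra_simps add_divide_distrib diff_divide_distrib)
  have LA: "L1p A"
  proof -
    have "L2p (\<lambda>x. u (x + h) * u' (x + h) - u x * u' x)"
      by (rule L2p_intros(2)[OF L2p_intros(3)[OF L2p_intros(6)[OF acD(2)[OF u(1)]] cper_shift(1)[OF acD(6)[OF u(1)]]]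
        L2p_intros(3)[OF acD(2)[OF u(1)] acD(6)[OF u(1)]]])
    from L2p_mult[OF this acD(7)[OF act']] show ?thesis unfolding A_def .
  qed
  have LC: "L1p C" "integral {0..1} C = 0" using acD(3)[OF acws] ac_integral_0[OF acws] unfolding C_def by auto
  have "integral {0..1} A = integral {0..1} (\<lambda>x. A x - C x)"
    using LC(2) by (subst hk_integral_diff[OF L1pD(4)[OF LA] L1pD(4)[OF LC(1)]]) simp
  also have "\<dots> \<ge> integral {0..1} (\<lambda>x. - ((e + h * G) * \<bar>w' x\<bar>) + - (Y * (h * G)))"
  proof (rule integral_le)
    show "(\<lambda>x. A x - C x) integrable_on {0..1}" by (intro integrable_diff L1pD(4) LA LC)
    show "(\<lambda>x. - ((e + h * G) * \<bar>w' x\<bar>) + - (Y * (h * G))) integrable_on {0..1}"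
      by (intro integrable_add integrable_neg integrable_on_mult_right acD(10)[OF acw] integrable_const_ivl)
    fix x
    have "\<bar>w' x * (d x * \<theta> x - sabs e (d x))\<bar> \<le> \<bar>w' x\<bar> * e"
      unfolding abs_mult using sabs_legendre[OF e, of "d x"] by (intro mult_left_mono) (auto simp: \<theta>_def d_def)
    moreover have "\<bar>w' x * k x * \<theta> x\<bar> \<le> \<bar>w' x\<bar> * (h * G) * 1"
      unfolding abs_mult by (intro mult_mono kb \<theta>b) (use h G0 in auto)
    moreover have "\<bar>w x * k1 x * \<theta> x\<bar> \<le> Y * (h * G) * 1"
      unfolding abs_mult by (intro mult_mono kb \<theta>b wb) (use h G0 Y0 in auto)
    ultimately show "- ((e + h * G) * \<bar>w' x\<bar>) + - (Y * (h * G)) \<le> A x - C x"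
      unfolding AC by (simp add: algebra_simps abs_le_iff)
  qed
  also have "integral {0..1} (\<lambda>x. - ((e + h * G) * \<bar>w' x\<bar>) + - (Y * (h * G))) = - ((e + h * G) * integral {0..1} (\<lambda>x. \<bar>w' x\<bar>)) - Y * (h * G)"
    using hk_integral_add[OF integrable_neg[OF integrable_on_mult_right[OF acD(10)[OF acw]]] integrable_const_ivl, of 0 1 "e + h * G" "- (Y * (h * G))"]
    by simp
  also have "\<dots> \<ge> - ((e + h * G) * Y) - Y * (h * G)"
    using mult_left_mono[OF w'i, of "e + h * G"] e h G0 by simp
  finally have 1: "integral {0..1} A \<ge> - ((e + h * G) * Y) - Y * (h * G)" .
  have L: "L1p (\<lambda>x. k1 x * \<theta>' x)" "L1p (\<lambda>x. (u' (x + h) - u' x) * \<theta>' x)" "L1p (\<lambda>x. k2 x * \<theta> x)"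
    using L2p_mult[OF acD(7)[OF ack(2)] acD(2)[OF act']] L2p_mult[OF acD(2)[OF ack(2)] acD(7)[OF act']]
      L2p_mult[OF L2p_intros(2)[OF L2p_intros(6)[OF acD(2)[OF u(1)]] acD(2)[OF u(1)]] acD(2)[OF act'], of h] by auto
  \<comment> \<open>The increment of \<open>u'\<close> is \<open>d' + k1\<close>. The
    \<open>d'\<close> part contributes the nonnegative \<open>sabs2 e (d x) * (d' x)^2\<close> and
    is dropped; the \<open>k1\<close> part is moved by parts onto the force, which costs its third
    derivative.\<close>
  have "integral {0..1} (\<lambda>x. (u' (x + h) - u' x) * \<theta>' x) \<ge> integral {0..1} (\<lambda>x. k1 x * \<theta>' x)"
  proof (rule integral_le)
    fix x
    have "(u' (x + h) - u' x) * \<theta>' x = k1 x * \<theta>' x + sabs2 e (d x) * (d' x)\<^sup>2"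
      unfolding \<theta>'_def d_def d'_def k1_def z by (simp add: power2_eq_square algebra_simps)
    moreover have "sabs2 e (d x) * (d' x)\<^sup>2 \<ge> 0" using sabs2_bounds[OF e] by simp
    ultimately show "k1 x * \<theta>' x \<le> (u' (x + h) - u' x) * \<theta>' x" by linarith
  qed (intro L1pD(4) L)+
  moreover have "integral {0..1} (\<lambda>x. k1 x * \<theta>' x) = - integral {0..1} (\<lambda>x. k2 x * \<theta> x)"
    using ac_parts[OF ack(2) act'] by simp
  moreover have "integral {0..1} (\<lambda>x. k2 x * \<theta> x) \<le> integral {0..1} (\<lambda>x::real. h * G)"
  proof (rule integral_le)
    fix x
    have "\<bar>k2 x * \<theta> x\<bar> \<le> h * G * 1" unfolding abs_mult by (intro mult_mono kb \<theta>b) (use h G0 in auto)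
    then show "k2 x * \<theta> x \<le> h * G" by (simp add: abs_le_iff)
  qed (intro L1pD(4) L integrable_const_ivl)+
  ultimately have 2: "integral {0..1} (\<lambda>x. (u' (x + h) - u' x) * \<theta>' x) \<ge> - (h * G)" by simp
  \<comment> \<open>Here \<nu> \<le> 1 removes the viscosity from the bound.\<close>
  have "\<nu> * integral {0..1} (\<lambda>x. (u' (x + h) - u' x) * \<theta>' x) \<ge> \<nu> * - (h * G)"
    using 2 \<nu> by (intro mult_left_mono) auto
  also have "\<nu> * - (h * G) \<ge> - (h * G)" using \<nu> h G0 mult_right_mono[of \<nu> 1 "h * G"] by simp
  finally show ?thesis using 1 unfolding A_def by (simp add: algebra_simps)
qed

section \<open>The total variation of a solution\<close>

text \<open>One fixed \<omega>: the argument up to \<open>variation_bound\<close> is deterministic,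
  and the force is measured by the single bound \<open>G\<close> on its first three spatial
  derivatives over the time interval from 0 to \<open>L\<close>.\<close>

locale burgers_flow =
  fixes \<nu> :: real and u0 :: "real \<Rightarrow> real" and \<xi> v \<eta>1 \<eta>2 \<eta>3 :: "real \<Rightarrow> real \<Rightarrow> real" and G L :: real
  assumes path: "burgers_path \<nu> u0 \<xi> v" and \<nu>: "0 < \<nu>" "\<nu> \<le> 1" and u0: "u0 \<in> H1_space"
    and L: "L \<ge> 0"
    and \<xi>: "\<And>t. t \<in> {0..L} \<Longrightarrow> ac (\<xi> t) (\<eta>1 t)" "\<And>t. t \<in> {0..L} \<Longrightarrow> ac (\<eta>1 t) (\<eta>2 t)"
      "\<And>t. t \<in> {0..L} \<Longrightarrow> ac (\<eta>2 t) (\<eta>3 t)"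
    and G: "\<And>t x. t \<in> {0..L} \<Longrightarrow> \<bar>\<eta>1 t x\<bar> \<le> G" "\<And>t x. t \<in> {0..L} \<Longrightarrow> \<bar>\<eta>2 t x\<bar> \<le> G"
      "\<And>t x. t \<in> {0..L} \<Longrightarrow> \<bar>\<eta>3 t x\<bar> \<le> G"
    and \<xi>0: "\<And>x. \<eta>1 0 x = 0"
begin

definition g :: "real \<Rightarrow> real \<Rightarrow> real" where "g t = dx (v t)"

text \<open>The continuous representative of \<open>v t\<close>.\<close>

definition f :: "real \<Rightarrow> real \<Rightarrow> real" where
  "f t = (SOME f. ac f (g t) \<and> (AE x in lborel. v t x = f x) \<and> integral {0..1} f = 0)"

lemma v_H1: "t \<ge> 0 \<Longrightarrow> v t \<in> H1_space" "t \<ge> 0 \<Longrightarrow> v t \<in> H_space"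
  using path by (auto simp: burgers_path_def continuous_H1_path_def H1_space_def)

lemma fg: assumes "t \<ge> 0" shows "ac (f t) (g t)" "AE x in lborel. v t x = f t x" "integral {0..1} (f t) = 0"
proof -
  have "\<exists>f. ac f (g t) \<and> (AE x in lborel. v t x = f x) \<and> integral {0..1} f = 0"
    using H1_space_ac(1)[OF v_H1(1)[OF assms]] unfolding g_def .
  from someI_ex[OF this] have "ac (f t) (g t) \<and> (AE x in lborel. v t x = f t x) \<and> integral {0..1} (f t) = 0"
    unfolding f_def .
  then show "ac (f t) (g t)" "AE x in lborel. v t x = f t x" "integral {0..1} (f t) = 0" by auto
qed

text \<open>The H^1 distance of \<open>v s\<close> and \<open>v t\<close>, written through the
  chosen derivatives so that no \<open>dx\<close> of a difference has to be handled.\<close>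

definition dist1 :: "real \<Rightarrow> real \<Rightarrow> real" where "dist1 s t = H_norm (\<lambda>x. g s x - g t x)"

lemma H_norm_cong_AE:
  assumes "L2p p" "L2p q" "AE x in lborel. p x = q x" shows "H_norm p = H_norm q"
  unfolding H_norm_eq[OF assms(1)] H_norm_eq[OF assms(2)]
  by (subst integral_cong_AE[of "\<lambda>x. (p x)\<^sup>2" "\<lambda>x. (q x)\<^sup>2"])
     (use assms in \<open>auto simp: L2p_cong\<close>)

lemma g_L2: "t \<ge> 0 \<Longrightarrow> L2p (g t)" using acD(2)[OF fg(1)] .

lemma dist1_tendsto: assumes "t \<ge> 0" shows "((\<lambda>s. dist1 s t) \<longlongrightarrow> 0) (at t within {0..})"
proof -
  have "((\<lambda>s. H1_norm (\<lambda>x. v s x - v t x)) \<longlongrightarrow> 0) (at t within {0..})"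
    using path assms by (auto simp: burgers_path_def continuous_H1_path_def)
  moreover have "H1_norm (\<lambda>x. v s x - v t x) = dist1 s t" if s: "s \<ge> 0" for s
  proof -
    have H: "(\<lambda>x. v s x - v t x) \<in> H_space"
    proof (rule H_spaceI)
      note a = H_spaceD[OF v_H1(2)[OF s]] and b = H_spaceD[OF v_H1(2)[OF assms]]
      show "L2p (\<lambda>x. v s x - v t x)" by (rule L2p_intros(2)[OF a(1) b(1)])
      show "integral {0..1} (\<lambda>x. v s x - v t x) = 0"
        using a b L1pD(4)[OF L2p_L1p] by (subst hk_integral_diff) auto
    qed
    have ae: "AE x in lborel. v s x - v t x = f s x - f t x"
      using fg(2)[OF s] fg(2)[OF assms] by eventually_elim simp
    note D = dx_unique[OF H ac_diff[OF fg(1)[OF s] fg(1)[OF assms]] ae]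
    show ?thesis unfolding H1_norm_def dist1_def
      using H_norm_cong_AE[OF _ _ D(2)] H_spaceD(1)[OF H1_space_ac(2)[OF D(1)]] acD(2)[OF ac_diff[OF fg(1)[OF s] fg(1)[OF assms]]] by blast
  qed
  then have "\<forall>\<^sub>F s in at t within {0..}. H1_norm (\<lambda>x. v s x - v t x) = dist1 s t"
    by (auto simp: eventually_at_filter)
  ultimately show ?thesis by (rule Lim_transform_eventually)
qed

lemma dist1_small: assumes "t \<ge> 0" "\<rho> > 0"
  shows "\<exists>\<delta>>0. \<forall>s\<ge>0. \<bar>s - t\<bar> < \<delta> \<longrightarrow> dist1 s t < \<rho>"
proof -
  have "\<forall>\<^sub>F s in at t within {0..}. dist1 s t < \<rho>"
    using order_tendstoD(2)[OF dist1_tendsto[OF assms(1)] assms(2)] .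
  then obtain d where d: "d > 0" "\<And>s. s \<in> {0..} \<Longrightarrow> s \<noteq> t \<Longrightarrow> dist s t < d \<Longrightarrow> dist1 s t < \<rho>"
    unfolding eventually_at by auto
  have "dist1 t t < \<rho>" using assms(2) by (simp add: dist1_def H_norm_def circle_integral_def)
  then show ?thesis using d by (intro exI[of _ d]) (auto simp: dist_real_def)
qed

lemma dist1_sym: "dist1 s t = dist1 t s"
  unfolding dist1_def H_norm_def by (simp add: power2_commute)

lemma dist1_triangle: assumes "r \<ge> 0" "s \<ge> 0" "t \<ge> 0" shows "dist1 r t \<le> dist1 r s + dist1 s t"
  using H_norm_triangle[OF L2p_intros(2)[OF g_L2[OF assms(1)] g_L2[OF assms(2)]] L2p_intros(2)[OF g_L2[OF assms(2)] g_L2[OF assms(3)]]]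
  by (simp add: dist1_def)

lemma norm_le_dist1: assumes "s \<ge> 0" "t \<ge> 0" shows "H_norm (g s) \<le> H_norm (g t) + dist1 s t"
  using H_norm_triangle[OF L2p_intros(2)[OF g_L2[OF assms(1)] g_L2[OF assms(2)]] g_L2[OF assms(2)]]
  by (simp add: dist1_def)

text \<open>Purely qualitative, by compactness of the time interval. The bound may depend on the
  viscosity and serves only to make a supremum over time finite.\<close>

lemma norm_bounded: "\<exists>K. \<forall>t\<in>{0..L}. H_norm (g t) \<le> K"
proof -
  have "\<exists>K. \<forall>t\<in>{0..L}. t \<ge> 0 \<longrightarrow> H_norm (g t) \<le> K"
    using L
  proof (induction rule: Bolzano[where P = "\<lambda>a b. \<exists>K. \<forall>t\<in>{a..b}. t \<ge> 0 \<longrightarrow> H_norm (g t) \<le> K"])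
    case (trans a b c)
    then obtain K1 K2 where "\<And>t. t \<in> {a..b} \<Longrightarrow> t \<ge> 0 \<Longrightarrow> H_norm (g t) \<le> K1" "\<And>t. t \<in> {b..c} \<Longrightarrow> t \<ge> 0 \<Longrightarrow> H_norm (g t) \<le> K2" by metis
    then show ?case by (intro exI[of _ "max K1 K2"]) (metis atLeastAtMost_iff linear max.coboundedI1 max.coboundedI2)
  next
    case (local x)
    then obtain d where d: "d > 0" "\<And>s. s \<ge> 0 \<Longrightarrow> \<bar>s - x\<bar> < d \<Longrightarrow> dist1 s x < 1"
      using dist1_small[of x 1] by auto
    show ?case
    proof (rule exI[of _ d], intro conjI allI impI d(1))
      fix a b assume ab: "a \<le> x \<and> x \<le> b \<and> b - a < d"
      have "H_norm (g t) \<le> H_norm (g x) + 1" if "t \<in> {a..b}" "0 \<le> t" for t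
      proof -
        have "dist1 t x < 1" using ab that by (intro d(2)) auto
        then show ?thesis using norm_le_dist1[of t x] that local by auto
      qed
      then show "\<exists>K. \<forall>t\<in>{a..b}. 0 \<le> t \<longrightarrow> H_norm (g t) \<le> K" by blast
    qed
  qed
  then show ?thesis by auto
qed

text \<open>The drift u u_x - \<nu> u_xx paired with \<phi>. The derivative of \<phi> is a separate
  argument, which avoids the choice hidden in \<open>dx\<close>.\<close>

definition Q :: "real \<Rightarrow> (real \<Rightarrow> real) \<Rightarrow> (real \<Rightarrow> real) \<Rightarrow> real" where
  "Q s \<phi> \<phi>' = integral {0..1} (\<lambda>x. f s x * g s x * \<phi> x) + \<nu> * integral {0..1} (\<lambda>x. g s x * \<phi>' x)"

lemma fg_L2: assumes "s \<ge> 0" shows "L2p (\<lambda>x. f s x * g s x)"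
  using L2p_intros(3)[OF g_L2[OF assms] acD(6)[OF fg(1)[OF assms]]] .

text \<open>Depends on the test function only through a sup bound and a norm of its derivative,
  hence is uniform over all test functions arising in a short time step; it allows the state to be
  frozen there.\<close>

lemma Q_diff:
  assumes s: "s \<ge> 0" "t \<ge> 0" and \<phi>: "ac \<phi> \<phi>'" "\<And>x. \<bar>\<phi> x\<bar> \<le> p" "H_norm \<phi>' \<le> p'"
  shows "\<bar>Q s \<phi> \<phi>' - Q t \<phi> \<phi>'\<bar> \<le> dist1 s t * ((H_norm (g s) + H_norm (g t)) * p + p')"
proof -
  note F = fg(1)[OF s(1)] fg(1)[OF s(2)]
  note L = L2p_mult[OF fg_L2[OF s(1)] acD(7)[OF \<phi>(1)]] L2p_mult[OF fg_L2[OF s(2)] acD(7)[OF \<phi>(1)]]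
    L2p_mult[OF g_L2[OF s(1)] acD(2)[OF \<phi>(1)]] L2p_mult[OF g_L2[OF s(2)] acD(2)[OF \<phi>(1)]]
  have D: "L2p (\<lambda>x. g s x - g t x)" by (intro L2p_intros(2) g_L2 s)
  have d0: "dist1 s t \<ge> 0" unfolding dist1_def by (rule H_norm_nonneg)
  have J: "integral {0..1} (\<lambda>x. \<bar>g s x\<bar>) \<le> H_norm (g s)" "integral {0..1} (\<lambda>x. \<bar>g t x\<bar>) \<le> H_norm (g t)"
    "integral {0..1} (\<lambda>x. \<bar>g s x - g t x\<bar>) \<le> dist1 s t"
    unfolding dist1_def by (rule L1_le_H_norm[OF g_L2[OF s(1)]] L1_le_H_norm[OF g_L2[OF s(2)]] L1_le_H_norm[OF D])+
  have fd: "\<bar>f s x - f t x\<bar> \<le> dist1 s t" for x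
  proof -
    have "integral {0..1} (\<lambda>x. f s x - f t x) = 0"
      using fg(3)[OF s(1)] fg(3)[OF s(2)] L1pD(4)[OF acD(8)[OF F(1)]] L1pD(4)[OF acD(8)[OF F(2)]]
      by (subst hk_integral_diff) auto
    from ac_sup_bound[OF ac_diff[OF F] this, of x] J(3) show ?thesis by linarith
  qed
  have ft: "\<bar>f t x\<bar> \<le> H_norm (g t)" for x using ac_sup_bound[OF F(2) fg(3)[OF s(2)], of x] J(2) by linarith
  have p0: "p \<ge> 0" using \<phi>(2)[of 0] by linarith
  have "\<bar>integral {0..1} (\<lambda>x. f s x * g s x * \<phi> x - f t x * g t x * \<phi> x)\<bar> \<le> integral {0..1} (\<lambda>x. dist1 s t * p * \<bar>g s x\<bar> + H_norm (g t) * p * \<bar>g s x - g t x\<bar>)"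
    unfolding real_norm_def[symmetric]
  proof (rule integral_norm_bound_integral)
    fix x
    have eq: "f s x * g s x * \<phi> x - f t x * g t x * \<phi> x = (f s x - f t x) * \<phi> x * g s x + f t x * \<phi> x * (g s x - g t x)"
      by (simp add: algebra_simps)
    have b1: "\<bar>(f s x - f t x) * \<phi> x * g s x\<bar> \<le> dist1 s t * p * \<bar>g s x\<bar>"
      unfolding abs_mult by (intro mult_mono fd \<phi>(2) order_refl mult_nonneg_nonneg d0 p0 abs_ge_zero)
    have b2: "\<bar>f t x * \<phi> x * (g s x - g t x)\<bar> \<le> H_norm (g t) * p * \<bar>g s x - g t x\<bar>"
      unfolding abs_mult by (intro mult_mono ft \<phi>(2) order_refl mult_nonneg_nonneg p0 abs_ge_zero H_norm_nonneg)
    show "norm (f s x * g s x * \<phi> x - f t x * g t x * \<phi> x) \<le> dist1 s t * p * norm (g s x) + H_norm (g t) * p * norm (g s x - g t x)"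
      unfolding eq real_norm_def by (rule order_trans[OF abs_triangle_ineq add_mono[OF b1 b2]])
  next
    show "(\<lambda>x. f s x * g s x * \<phi> x - f t x * g t x * \<phi> x) integrable_on {0..1}" by (intro integrable_diff L1pD(4) L)
    show "(\<lambda>x. dist1 s t * p * norm (g s x) + H_norm (g t) * p * norm (g s x - g t x)) integrable_on {0..1}"
      unfolding real_norm_def
      by (rule integrable_add[OF integrable_on_mult_right[OF L1pD(5)[OF L2p_L1p[OF g_L2[OF s(1)]]]] integrable_on_mult_right[OF L1pD(5)[OF L2p_L1p[OF D]]]])
  qed
  also have "\<dots> = dist1 s t * p * integral {0..1} (\<lambda>x. \<bar>g s x\<bar>) + H_norm (g t) * p * integral {0..1} (\<lambda>x. \<bar>g s x - g t x\<bar>)"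
    by (subst hk_integral_add[OF integrable_on_mult_right[OF L1pD(5)[OF L2p_L1p[OF g_L2[OF s(1)]]]] integrable_on_mult_right[OF L1pD(5)[OF L2p_L1p[OF D]]]])
       (simp only: integral_mult_right)
  also have "\<dots> \<le> dist1 s t * p * H_norm (g s) + H_norm (g t) * p * dist1 s t"
    by (intro add_mono mult_left_mono J mult_nonneg_nonneg d0 p0 H_norm_nonneg)
  finally have 1: "\<bar>integral {0..1} (\<lambda>x. f s x * g s x * \<phi> x) - integral {0..1} (\<lambda>x. f t x * g t x * \<phi> x)\<bar> \<le> dist1 s t * ((H_norm (g s) + H_norm (g t)) * p)"
    by (subst hk_integral_diff[OF L1pD(4)[OF L(1)] L1pD(4)[OF L(2)], symmetric]) (simp add: algebra_simps)
  have "\<bar>integral {0..1} (\<lambda>x. g s x * \<phi>' x - g t x * \<phi>' x)\<bar> \<le> integral {0..1} (\<lambda>x. \<bar>(g s x - g t x) * \<phi>' x\<bar>)"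
    unfolding left_diff_distrib[symmetric]
    using integral_norm_bound_integral[OF L1pD(4)[OF L2p_mult[OF D acD(2)[OF \<phi>(1)]]] L1pD(5)[OF L2p_mult[OF D acD(2)[OF \<phi>(1)]]]] by auto
  also have "\<dots> \<le> dist1 s t * H_norm \<phi>'" unfolding dist1_def by (rule integral_mult_sqrt_le[OF D acD(2)[OF \<phi>(1)]])
  also have "\<dots> \<le> dist1 s t * p'" by (intro mult_left_mono \<phi> d0)
  finally have 2: "\<bar>integral {0..1} (\<lambda>x. g s x * \<phi>' x) - integral {0..1} (\<lambda>x. g t x * \<phi>' x)\<bar> \<le> dist1 s t * p'"
    by (subst hk_integral_diff[OF L1pD(4)[OF L(3)] L1pD(4)[OF L(4)], symmetric]) simp
  have eq: "Q s \<phi> \<phi>' - Q t \<phi> \<phi>' = (integral {0..1} (\<lambda>x. f s x * g s x * \<phi> x) - integral {0..1} (\<lambda>x. f t x * g t x * \<phi> x))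
     + \<nu> * (integral {0..1} (\<lambda>x. g s x * \<phi>' x) - integral {0..1} (\<lambda>x. g t x * \<phi>' x))"
    unfolding Q_def by (simp add: algebra_simps)
  have 3: "\<bar>\<nu> * (integral {0..1} (\<lambda>x. g s x * \<phi>' x) - integral {0..1} (\<lambda>x. g t x * \<phi>' x))\<bar> \<le> 1 * (dist1 s t * p')"
    unfolding abs_mult by (intro mult_mono 2) (use \<nu> in auto)
  have "\<bar>Q s \<phi> \<phi>' - Q t \<phi> \<phi>'\<bar> \<le> dist1 s t * ((H_norm (g s) + H_norm (g t)) * p) + 1 * (dist1 s t * p')"
    unfolding eq by (rule order_trans[OF abs_triangle_ineq add_mono[OF 1 3]])
  then show ?thesis by (simp only: distrib_left mult_1)
qed

lemma Q_continuous: assumes \<phi>: "ac \<phi> \<phi>'" shows "continuous_on {0..} (\<lambda>s. Q s \<phi> \<phi>')"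
  unfolding continuous_on_def
proof
  fix t :: real assume t: "t \<in> {0..}"
  obtain p where p: "\<And>x. \<bar>\<phi> x\<bar> \<le> p" using cper_bounded[OF acD(6)[OF \<phi>]] by metis
  have p0: "p \<ge> 0" using p[of 0] by linarith
  have "((\<lambda>s. Q s \<phi> \<phi>' - Q t \<phi> \<phi>') \<longlongrightarrow> 0) (at t within {0..})"
  proof (rule Lim_null_comparison)
    show "\<forall>\<^sub>F s in at t within {0..}. norm (Q s \<phi> \<phi>' - Q t \<phi> \<phi>') \<le> dist1 s t * ((H_norm (g t) + dist1 s t + H_norm (g t)) * p + H_norm \<phi>')"
    proof -
      have "norm (Q s \<phi> \<phi>' - Q t \<phi> \<phi>') \<le> dist1 s t * ((H_norm (g t) + dist1 s t + H_norm (g t)) * p + H_norm \<phi>')" if s: "s \<in> {0..}" for s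
      proof -
        have "norm (Q s \<phi> \<phi>' - Q t \<phi> \<phi>') \<le> dist1 s t * ((H_norm (g s) + H_norm (g t)) * p + H_norm \<phi>')"
          using Q_diff[OF _ _ \<phi> p order_refl, of s t] s t by simp
        also have "\<dots> \<le> dist1 s t * ((H_norm (g t) + dist1 s t + H_norm (g t)) * p + H_norm \<phi>')"
          using norm_le_dist1[of s t] s t p0 by (intro mult_left_mono add_mono mult_right_mono) (auto simp: dist1_def H_norm_nonneg)
        finally show ?thesis .
      qed
      then show ?thesis by (auto simp: eventually_at_filter)
    qed
    have "((\<lambda>s. dist1 s t * ((H_norm (g t) + dist1 s t + H_norm (g t)) * p + H_norm \<phi>')) \<longlongrightarrow> 0 * ((H_norm (g t) + 0 + H_norm (g t)) * p + H_norm \<phi>')) (at t within {0..})"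
      using t by (intro tendsto_intros dist1_tendsto) auto
    then show "((\<lambda>s. dist1 s t * ((H_norm (g t) + dist1 s t + H_norm (g t)) * p + H_norm \<phi>')) \<longlongrightarrow> 0) (at t within {0..})" by simp
  qed
  then show "((\<lambda>s. Q s \<phi> \<phi>') \<longlongrightarrow> Q t \<phi> \<phi>') (at t within {0..})" by (rule LIM_zero_cancel)
qed

text \<open>Subtracting the equation at two times removes the initial value, and with the force
  moved to the left the rest is a time integral. \<phi> has mean zero because the equation is posed
  against \<open>H1_space\<close>, whose elements do.\<close>

lemma weak_equation:
  assumes t: "0 \<le> s" "s \<le> t" "t \<le> L" and \<phi>: "ac \<phi> \<phi>'" "integral {0..1} \<phi> = 0"
  shows "integral {0..1} (\<lambda>x. ((f t x - \<xi> t x) - (f s x - \<xi> s x)) * \<phi> x) = - integral {s..t} (\<lambda>r. Q r \<phi> \<phi>')"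
proof -
  have \<phi>H: "\<phi> \<in> H1_space" and d\<phi>: "AE x in lborel. dx \<phi> x = \<phi>' x" using ac_H1[OF \<phi>] by auto
  have \<phi>2: "L2p \<phi>" "L2p \<phi>'" "L2p (dx \<phi>)" using acD[OF \<phi>(1)] H_spaceD(1)[OF H1_space_ac(2)[OF \<phi>H]] by auto
  have Qc: "circle_integral (\<lambda>x. v r x * dx (v r) x * \<phi> x) + \<nu> * circle_integral (\<lambda>x. dx (v r) x * dx \<phi> x) = Q r \<phi> \<phi>'"
    if r: "r \<ge> 0" for r
  proof -
    have [measurable]: "v r \<in> borel_measurable borel" "g r \<in> borel_measurable borel" "\<phi> \<in> borel_measurable borel" "f r \<in> borel_measurable borel"
      using v_H1(2)[OF r] g_L2[OF r] \<phi>2 acD(7)[OF fg(1)[OF r]] by (auto simp: H_space_def L2p_def)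
    have "circle_integral (\<lambda>x. v r x * g r x * \<phi> x) = circle_integral (\<lambda>x. f r x * g r x * \<phi> x)"
      unfolding circle_integral_def using fg(2)[OF r]
      by (intro set_lebesgue_integral_cong_AE) (auto elim!: eventually_mono)
    moreover have "circle_integral (\<lambda>x. g r x * dx \<phi> x) = integral {0..1} (\<lambda>x. g r x * \<phi>' x)"
      unfolding L1pD(6)[OF L2p_mult[OF g_L2[OF r] \<phi>2(3)]]
      by (rule integral_cong_AE[OF L2p_mult[OF g_L2[OF r] \<phi>2(3)] L2p_mult[OF g_L2[OF r] \<phi>2(2)]])
         (use d\<phi> in \<open>eventually_elim, simp\<close>)
    ultimately show ?thesis unfolding Q_def g_def[symmetric] using L1pD(6)[OF L2p_mult[OF fg_L2[OF r] \<phi>2(1)]] by simp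
  qed
  have u02: "L2p u0" using u0 H_spaceD(1) by (auto simp: H1_space_def)
  have cont: "continuous_on {0..r} (\<lambda>s. Q s \<phi> \<phi>')" for r
    by (rule continuous_on_subset[OF Q_continuous[OF \<phi>(1)]]) auto
  have eq: "integral {0..1} (\<lambda>x. f r x * \<phi> x) - integral {0..1} (\<lambda>x. u0 x * \<phi> x) + integral {0..r} (\<lambda>s. Q s \<phi> \<phi>') = integral {0..1} (\<lambda>x. \<xi> r x * \<phi> x)"
    if r: "0 \<le> r" "r \<le> L" for r
  proof -
    have "circle_integral (\<lambda>x. (v r x - u0 x) * \<phi> x) + (LINT s:{0..r}|lborel. circle_integral (\<lambda>x. v s x * dx (v s) x * \<phi> x) +
                               \<nu> * circle_integral (\<lambda>x. dx (v s) x * dx \<phi> x)) = circle_integral (\<lambda>x. \<xi> r x * \<phi> x)"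
      using path r \<phi>H by (auto simp: burgers_path_def)
    moreover have "circle_integral (\<lambda>x. (v r x - u0 x) * \<phi> x) = integral {0..1} (\<lambda>x. f r x * \<phi> x) - integral {0..1} (\<lambda>x. u0 x * \<phi> x)"
    proof -
      note v2 = H_spaceD(1)[OF v_H1(2)[OF r(1)]]
      note f2 = acD(7)[OF fg(1)[OF r(1)]]
      have "circle_integral (\<lambda>x. (v r x - u0 x) * \<phi> x) = integral {0..1} (\<lambda>x. (f r x - u0 x) * \<phi> x)"
        unfolding L1pD(6)[OF L2p_mult[OF L2p_intros(2)[OF v2 u02] \<phi>2(1)]]
        by (rule integral_cong_AE[OF L2p_mult[OF L2p_intros(2)[OF v2 u02] \<phi>2(1)] L2p_mult[OF L2p_intros(2)[OF f2 u02] \<phi>2(1)]])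
           (use fg(2)[OF r(1)] in \<open>eventually_elim, simp\<close>)
      also have "\<dots> = integral {0..1} (\<lambda>x. f r x * \<phi> x) - integral {0..1} (\<lambda>x. u0 x * \<phi> x)"
        unfolding left_diff_distrib
        by (rule hk_integral_diff[OF L1pD(4)[OF L2p_mult[OF f2 \<phi>2(1)]] L1pD(4)[OF L2p_mult[OF u02 \<phi>2(1)]]])
      finally show ?thesis .
    qed
    moreover have "circle_integral (\<lambda>x. \<xi> r x * \<phi> x) = integral {0..1} (\<lambda>x. \<xi> r x * \<phi> x)"
      by (rule L1pD(6)[OF L2p_mult[OF acD(7)[OF \<xi>(1)] \<phi>2(1)]]) (use r in auto)
    moreover have "(LINT s:{0..r}|lborel. circle_integral (\<lambda>x. v s x * dx (v s) x * \<phi> x) +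
                               \<nu> * circle_integral (\<lambda>x. dx (v s) x * dx \<phi> x)) = (LINT s:{0..r}|lborel. Q s \<phi> \<phi>')"
      by (rule set_lebesgue_integral_cong) (use Qc in auto)
    moreover have "(LINT s:{0..r}|lborel. Q s \<phi> \<phi>') = integral {0..r} (\<lambda>s. Q s \<phi> \<phi>')"
      by (intro set_borel_integral_eq_integral(2) borel_integrable_atLeastAtMost' cont)
    ultimately show ?thesis by simp
  qed
  have comb: "integral {0..s} (\<lambda>r. Q r \<phi> \<phi>') + integral {s..t} (\<lambda>r. Q r \<phi> \<phi>') = integral {0..t} (\<lambda>r. Q r \<phi> \<phi>')"
    using t by (intro hk_integral_combine integrable_continuous_real cont) auto
  have sL: "s \<le> L" "0 \<le> t" using t by auto
  have L2: "L2p (f r)" "L2p (\<xi> r)" if "0 \<le> r" "r \<le> L" for r using acD(7)[OF fg(1)] acD(7)[OF \<xi>(1)] that by auto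
  have split: "integral {0..1} (\<lambda>x. (f r x - \<xi> r x) * \<phi> x) = integral {0..1} (\<lambda>x. f r x * \<phi> x) - integral {0..1} (\<lambda>x. \<xi> r x * \<phi> x)"
    if "0 \<le> r" "r \<le> L" for r
    unfolding left_diff_distrib
    by (rule hk_integral_diff[OF L1pD(4)[OF L2p_mult[OF L2(1) \<phi>2(1)]] L1pD(4)[OF L2p_mult[OF L2(2) \<phi>2(1)]]])
       (use that in auto)
  have "integral {0..1} (\<lambda>x. ((f t x - \<xi> t x) - (f s x - \<xi> s x)) * \<phi> x) =
     integral {0..1} (\<lambda>x. (f t x - \<xi> t x) * \<phi> x) - integral {0..1} (\<lambda>x. (f s x - \<xi> s x) * \<phi> x)"
    unfolding left_diff_distrib[of "f t _ - \<xi> t _" "f s _ - \<xi> s _"]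
    by (rule hk_integral_diff[OF L1pD(4)[OF L2p_mult[OF L2p_intros(2)[OF L2] \<phi>2(1)]] L1pD(4)[OF L2p_mult[OF L2p_intros(2)[OF L2] \<phi>2(1)]]])
       (use t sL in auto)
  then show ?thesis using split[of t] split[of s] eq[of t] eq[of s] comb t sL by simp
qed

end

section \<open>From the tested equation to the total variation\<close>

lemma H_norm_mono: assumes "L2p p" "L2p q" "\<And>x. \<bar>p x\<bar> \<le> \<bar>q x\<bar>" shows "H_norm p \<le> H_norm q"
  unfolding H_norm_eq[OF assms(1)] H_norm_eq[OF assms(2)]
proof (rule real_sqrt_le_mono, rule integral_le)
  show "(p x)\<^sup>2 \<le> (q x)\<^sup>2" for x using assms(3)[of x] by (simp add: abs_le_square_iff)
qed (use assms L1pD(4) in \<open>auto simp: L2p_cong\<close>)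

lemma H_norm_cmult: assumes "L2p p" shows "H_norm (\<lambda>x. c * p x) = \<bar>c\<bar> * H_norm p"
  unfolding H_norm_eq[OF assms(1)] H_norm_eq[OF L2p_cmult[OF assms(1)]]
  by (simp add: power_mult_distrib real_sqrt_mult)

lemma H_norm_const_bound: assumes "L2p p" "\<And>x. \<bar>p x\<bar> \<le> c" shows "H_norm p \<le> c"
proof -
  have "c \<ge> 0" using assms(2)[of 0] by linarith
  have "H_norm p \<le> H_norm (\<lambda>_. c)"
    by (rule H_norm_mono[OF assms(1) cper_L2p[OF cper_intros(1)]]) (use assms(2) \<open>c \<ge> 0\<close> in auto)
  also have "\<dots> = c" using H_norm_eq[OF cper_L2p[OF cper_intros(1)[of c]]] \<open>c \<ge> 0\<close> by simp
  finally show ?thesis .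
qed

lemma H_norm_delta: assumes "L2p w" shows "H_norm (\<lambda>x. w (x + h) - w x) \<le> 2 * H_norm w"
proof -
  have s: "L2p (\<lambda>x. w (x + h))" by (rule L2p_intros(6)[OF assms])
  have n: "L2p (\<lambda>x. - w x)" by (rule L2p_intros(4)[OF assms])
  have "H_norm (\<lambda>x. w (x + h)) = H_norm w"
    unfolding H_norm_eq[OF assms] H_norm_eq[OF s]
    using per_integral_shift[of "\<lambda>x. (w x)\<^sup>2" h] assms by (simp add: L2p_cong)
  moreover have "H_norm (\<lambda>x. - w x) = H_norm w" by (simp add: H_norm_def)
  ultimately show ?thesis using H_norm_triangle[OF s n] by simp
qed

context burgers_flow
begin

text \<open>Unlike \<open>f\<close>, the function \<open>z\<close> is as regular in time as an
  integral (\<open>weak_equation\<close>); the force reappears only through its spatial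
  increments.\<close>

definition z :: "real \<Rightarrow> real \<Rightarrow> real" where "z t x = f t x - \<xi> t x"
definition z' :: "real \<Rightarrow> real \<Rightarrow> real" where "z' t x = g t x - \<eta>1 t x"

lemma zac: "t \<in> {0..L} \<Longrightarrow> ac (z t) (z' t)"
  unfolding z_def z'_def using ac_diff[OF fg(1) \<xi>(1), of t t] by simp

lemma G0: "G \<ge> 0" using G(1)[of 0 0] L by simp

text \<open>Convexity bounds the increment of the regularized L1 norm by the increment of
  \<open>z\<close> tested with \<theta>, the smoothed sign at the end time \<open>t\<close>. As this
  test function does not move with time, \<open>weak_equation\<close> applies to it, and
  \<open>burgers_delta_bound\<close> is needed only at time \<open>t\<close>; the hypothesis on
  \<open>Q\<close> covers the other times of the step.\<close>

lemma entropy_increment: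
  assumes ab: "0 \<le> s" "s \<le> t" "t \<le> L" and e: "e > 0" and h: "h > 0"
    and Y: "integral {0..1} (\<lambda>x. \<bar>g t x\<bar>) \<le> Y"
    and Q: "\<And>r \<phi> \<phi>'. r \<in> {s..t} \<Longrightarrow> ac \<phi> \<phi>' \<Longrightarrow> (\<And>x. \<bar>\<phi> x\<bar> \<le> 2) \<Longrightarrow> H_norm \<phi>' \<le> 4 / e * (H_norm (g t) + G) \<Longrightarrow>
      \<bar>Q r \<phi> \<phi>' - Q t \<phi> \<phi>'\<bar> \<le> \<epsilon>"
  shows "integral {0..1} (\<lambda>x. sabs e (z t (x + h) - z t x)) - integral {0..1} (\<lambda>x. sabs e (z s (x + h) - z s x))
    \<le> (t - s) * (e * Y + h * G * (2 * Y + 1) + \<epsilon>)"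
proof -
  have sL: "s \<in> {0..L}" and tL: "t \<in> {0..L}" "t \<ge> 0" using ab by auto
  define \<theta> where "\<theta> = (\<lambda>x. sabs1 e (z t (x + h) - z t x))"
  define \<theta>' where "\<theta>' = (\<lambda>x. sabs2 e (z t (x + h) - z t x) * (z' t (x + h) - z' t x))"
  define \<phi> where "\<phi> x = \<theta> (x - h) - \<theta> x" for x
  define \<phi>' where "\<phi>' x = \<theta>' (x - h) - \<theta>' x" for x
  note dt = delta_sabs_ac[OF e zac[OF tL(1)], of h]
  note ds = delta_sabs_ac[OF e zac[OF sL], of h]
  have \<theta>ac: "ac \<theta> \<theta>'" unfolding \<theta>_def \<theta>'_def by (rule dt(2))
  have \<phi>ac: "ac \<phi> \<phi>'" unfolding \<phi>_def \<phi>'_def using ac_diff[OF ac_shift[OF \<theta>ac, of "-h"] \<theta>ac] by simp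
  have \<theta>1: "\<bar>\<theta> x\<bar> \<le> 1" for x unfolding \<theta>_def by (rule sabs1_le[OF e])
  have \<phi>2: "\<bar>\<phi> x\<bar> \<le> 2" for x unfolding \<phi>_def using \<theta>1[of x] \<theta>1[of "x - h"] by linarith
  have \<phi>0: "integral {0..1} \<phi> = 0"
    unfolding \<phi>_def[abs_def]
    using per_integral_shift[OF acD(8)[OF \<theta>ac], of "-h"] L1pD(4)[OF L1p_shift[OF acD(8)[OF \<theta>ac], of "-h"]] L1pD(4)[OF acD(8)[OF \<theta>ac]]
    by (subst hk_integral_diff) auto
  \<comment> \<open>Each of the two translation differences costs a factor 2, and
    \<open>sabs2\<close> costs 1 / e.\<close>
  have \<phi>'n: "H_norm \<phi>' \<le> 4 / e * (H_norm (g t) + G)"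
  proof -
    have "H_norm \<phi>' \<le> 2 * H_norm \<theta>'" unfolding \<phi>'_def using H_norm_delta[OF acD(2)[OF \<theta>ac], of "-h"] by simp
    also have "H_norm \<theta>' \<le> H_norm (\<lambda>x. (1 / e) * (z' t (x + h) - z' t x))"
    proof (rule H_norm_mono[OF acD(2)[OF \<theta>ac] L2p_cmult[OF acD(2)[OF dt(1)]]])
      fix x
      show "\<bar>\<theta>' x\<bar> \<le> \<bar>(1 / e) * (z' t (x + h) - z' t x)\<bar>"
        unfolding \<theta>'_def abs_mult using sabs2_bounds[OF e] e by (intro mult_right_mono) auto
    qed
    also have "\<dots> = (1 / e) * H_norm (\<lambda>x. z' t (x + h) - z' t x)"
      using H_norm_cmult[OF acD(2)[OF dt(1)], of "1 / e"] e by simp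
    also have "\<dots> \<le> (1 / e) * (2 * H_norm (z' t))"
      using H_norm_delta[OF acD(2)[OF zac[OF tL(1)]], of h] e by (intro mult_left_mono) auto
    also have "H_norm (z' t) \<le> H_norm (g t) + G"
    proof -
      have L2: "L2p (\<lambda>x. - \<eta>1 t x)" by (rule L2p_intros(4)[OF acD(2)[OF \<xi>(1)[OF tL(1)]]])
      have "H_norm (z' t) \<le> H_norm (g t) + H_norm (\<lambda>x. - \<eta>1 t x)"
        unfolding z'_def[abs_def] using H_norm_triangle[OF g_L2[OF tL(2)] L2] by simp
      moreover have "H_norm (\<lambda>x. - \<eta>1 t x) \<le> G" by (rule H_norm_const_bound[OF L2]) (use G(1)[OF tL(1)] in auto)
      ultimately show ?thesis by linarith
    qed
    finally show ?thesis using e by (simp add: mult_left_mono divide_right_mono)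
  qed
  have Qc: "continuous_on {s..t} (\<lambda>r. Q r \<phi> \<phi>')"
    by (rule continuous_on_subset[OF Q_continuous[OF \<phi>ac]]) (use ab in auto)
  have Qt: "Q t \<phi> \<phi>' \<ge> - (e * Y + h * G * (2 * Y + 1))"
  proof -
    have "integral {0..1} (\<lambda>x. f t x * g t x * \<phi> x) = integral {0..1} (\<lambda>x. (f t (x + h) * g t (x + h) - f t x * g t x) * \<theta> x)"
      unfolding \<phi>_def by (rule delta_parts[OF fg_L2[OF tL(2)] acD(7)[OF \<theta>ac]])
    moreover have "integral {0..1} (\<lambda>x. g t x * \<phi>' x) = integral {0..1} (\<lambda>x. (g t (x + h) - g t x) * \<theta>' x)"
      unfolding \<phi>'_def by (rule delta_parts[OF g_L2[OF tL(2)] acD(2)[OF \<theta>ac]])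
    moreover have "- (e * Y + h * G * (2 * Y + 1)) \<le>
        integral {0..1} (\<lambda>x. (f t (x + h) * g t (x + h) - f t x * g t x) * \<theta> x) + \<nu> * integral {0..1} (\<lambda>x. (g t (x + h) - g t x) * \<theta>' x)"
      unfolding \<theta>_def \<theta>'_def
      by (rule burgers_delta_bound[OF fg(1)[OF tL(2)] fg(3)[OF tL(2)] Y \<xi>(1)[OF tL(1)] \<xi>(2)[OF tL(1)] \<xi>(3)[OF tL(1)]
            G(1)[OF tL(1)] G(2)[OF tL(1)] G(3)[OF tL(1)] h _ _ e])
         (use \<nu> in \<open>auto simp: z_def z'_def\<close>)
    ultimately show ?thesis unfolding Q_def by simp
  qed
  have sc: "cper (\<lambda>x. sabs e (z t (x + h) - z t x))" "cper (\<lambda>x. sabs e (z s (x + h) - z s x))"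
    using acD(6)[OF dt(3)] acD(6)[OF ds(3)] .
  define w where "w x = z t x - z s x" for x
  have wac: "ac w (\<lambda>x. z' t x - z' s x)" unfolding w_def by (rule ac_diff[OF zac[OF tL(1)] zac[OF sL]])
  have "integral {0..1} (\<lambda>x. sabs e (z t (x + h) - z t x)) - integral {0..1} (\<lambda>x. sabs e (z s (x + h) - z s x))
     = integral {0..1} (\<lambda>x. sabs e (z t (x + h) - z t x) - sabs e (z s (x + h) - z s x))"
    by (rule hk_integral_diff[symmetric, OF L1pD(4)[OF cper_L1p[OF sc(1)]] L1pD(4)[OF cper_L1p[OF sc(2)]]])
  also have "\<dots> \<le> integral {0..1} (\<lambda>x. (w (x + h) - w x) * \<theta> x)"
  proof (rule integral_le)
    show "(\<lambda>x. sabs e (z t (x + h) - z t x) - sabs e (z s (x + h) - z s x)) integrable_on {0..1}"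
      by (rule L1pD(4)[OF cper_L1p[OF cper_intros(3)[OF sc]]])
    show "(\<lambda>x. (w (x + h) - w x) * \<theta> x) integrable_on {0..1}"
      by (rule L1pD(4)[OF cper_L1p[OF cper_intros(4)[OF cper_intros(3)[OF cper_shift(1)] acD(6)[OF \<theta>ac]]]]) (rule acD(6)[OF wac])+
    fix x
    have "sabs e (z t (x + h) - z t x) - sabs e (z s (x + h) - z s x) \<le> \<theta> x * ((z t (x + h) - z t x) - (z s (x + h) - z s x))"
      unfolding \<theta>_def by (rule sabs_convex[OF e])
    also have "\<dots> = (w (x + h) - w x) * \<theta> x" unfolding w_def by (simp add: algebra_simps)
    finally show "sabs e (z t (x + h) - z t x) - sabs e (z s (x + h) - z s x) \<le> (w (x + h) - w x) * \<theta> x" .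
  qed
  also have "\<dots> = integral {0..1} (\<lambda>x. w x * \<phi> x)"
    unfolding \<phi>_def by (rule delta_parts[symmetric, OF acD(7)[OF wac] acD(7)[OF \<theta>ac]])
  also have "\<dots> = - integral {s..t} (\<lambda>r. Q r \<phi> \<phi>')"
    unfolding w_def z_def by (rule weak_equation[OF ab \<phi>ac \<phi>0])
  also have "\<dots> \<le> - integral {s..t} (\<lambda>r. - (e * Y + h * G * (2 * Y + 1) + \<epsilon>))"
  proof -
    have "integral {s..t} (\<lambda>r. - (e * Y + h * G * (2 * Y + 1) + \<epsilon>)) \<le> integral {s..t} (\<lambda>r. Q r \<phi> \<phi>')"
    proof (rule integral_le)
      show "(\<lambda>r. Q r \<phi> \<phi>') integrable_on {s..t}" by (rule integrable_continuous_real[OF Qc])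
      fix r assume "r \<in> {s..t}"
      from Q[OF this \<phi>ac \<phi>2 \<phi>'n] Qt show "- (e * Y + h * G * (2 * Y + 1) + \<epsilon>) \<le> Q r \<phi> \<phi>'" by linarith
    qed (rule integrable_const_ivl)
    then show ?thesis by simp
  qed
  also have "\<dots> = (t - s) * (e * Y + h * G * (2 * Y + 1) + \<epsilon>)"
    using ab by (simp add: algebra_simps)
  finally show ?thesis .
qed

text \<open>With a slack \<epsilon> per unit of time the estimate is additive over adjacent time
  intervals and holds on short ones by continuity of the path in H^1. Bolzano's subdivision gives it
  on the whole interval, and then the slack goes to 0.\<close>

lemma entropy_bound:
  assumes ab: "0 \<le> a" "a \<le> b" "b \<le> L" and e: "e > 0" and h: "h > 0"
    and Y: "\<And>s. s \<in> {a..b} \<Longrightarrow> integral {0..1} (\<lambda>x. \<bar>g s x\<bar>) \<le> Y"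
  shows "integral {0..1} (\<lambda>x. sabs e (z b (x + h) - z b x)) - integral {0..1} (\<lambda>x. sabs e (z a (x + h) - z a x))
    \<le> (b - a) * (e * Y + h * G * (2 * Y + 1))"
proof -
  define E where "E t = integral {0..1} (\<lambda>x. sabs e (z t (x + h) - z t x))" for t
  define K where "K = e * Y + h * G * (2 * Y + 1)"
  have main: "E b - E a \<le> (b - a) * (K + \<epsilon>)" if \<epsilon>: "\<epsilon> > 0" for \<epsilon>
  proof -
    have "a \<le> a \<and> b \<le> b \<longrightarrow> E b - E a \<le> (b - a) * (K + \<epsilon>)"
      using ab(2)
    proof (induction rule: Bolzano[where P = "\<lambda>s t. a \<le> s \<and> t \<le> b \<longrightarrow> E t - E s \<le> (t - s) * (K + \<epsilon>)"])
      case (trans r s t)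
      then show ?case by (auto simp: algebra_simps)
    next
      case (local x)
      define N where "N = H_norm (g x) + 1"
      define p' where "p' = 4 / e * (N + G)"
      have N: "N \<ge> 1" unfolding N_def using H_norm_nonneg by simp
      have p': "p' \<ge> 0" unfolding p'_def using N G0 e by simp
      \<comment> \<open>Through \<open>x\<close>, times in the neighbourhood are within 2 \<rho> of
        each other in H^1. The bound \<rho> \<le> 1 keeps the norms below \<open>N\<close>, and the
        quotient makes the estimate of \<open>Q_diff\<close>, with test functions bounded by 2, at
        most \<epsilon>.\<close>
      define \<rho> where "\<rho> = min 1 (\<epsilon> / (2 * (4 * N + p')))"
      have \<rho>: "\<rho> > 0" "\<rho> \<le> 1" "2 * \<rho> * (4 * N + p') \<le> \<epsilon>"
      proof -
        have p: "4 * N + p' > 0" using N p' by linarith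
        then show "\<rho> > 0" "\<rho> \<le> 1" using \<epsilon> by (auto simp: \<rho>_def)
        have "2 * \<rho> * (4 * N + p') \<le> 2 * (\<epsilon> / (2 * (4 * N + p'))) * (4 * N + p')"
          using p by (intro mult_right_mono) (auto simp: \<rho>_def)
        also have "2 * (\<epsilon> / (2 * q)) * q = \<epsilon>" if "q > 0" for q using that by simp
        from this[OF p] have "2 * (\<epsilon> / (2 * (4 * N + p'))) * (4 * N + p') = \<epsilon>" .
        finally show "2 * \<rho> * (4 * N + p') \<le> \<epsilon>" .
      qed
      have x0: "x \<ge> 0" using local ab by simp
      obtain \<delta> where \<delta>: "\<delta> > 0" "\<And>s. s \<ge> 0 \<Longrightarrow> \<bar>s - x\<bar> < \<delta> \<Longrightarrow> dist1 s x < \<rho>"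
        using dist1_small[OF x0 \<rho>(1)] by blast
      show ?case
      proof (rule exI[of _ \<delta>], intro conjI allI impI \<delta>(1))
        fix s t assume st: "s \<le> x \<and> x \<le> t \<and> t - s < \<delta>" "a \<le> s \<and> t \<le> b"
        have near: "dist1 r x < \<rho>" "H_norm (g r) \<le> N" if "r \<in> {s..t}" for r
        proof -
          have r0: "r \<ge> 0" using that st ab by auto
          show d: "dist1 r x < \<rho>" by (rule \<delta>(2)[OF r0]) (use that st in auto)
          show "H_norm (g r) \<le> N" using norm_le_dist1[OF r0 x0] d \<rho>(2) unfolding N_def by linarith
        qed
        have t: "t \<in> {s..t}" using st by auto
        show "E t - E s \<le> (t - s) * (K + \<epsilon>)"
          unfolding E_def K_def
        proof (rule entropy_increment[OF _ _ _ e h])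
          show "0 \<le> s" "s \<le> t" "t \<le> L" using st ab by auto
          show "integral {0..1} (\<lambda>x. \<bar>g t x\<bar>) \<le> Y" by (rule Y) (use st in auto)
          fix r \<phi> \<phi>' assume r: "r \<in> {s..t}" and \<phi>: "ac \<phi> \<phi>'" "\<And>x. \<bar>\<phi> x\<bar> \<le> 2" "H_norm \<phi>' \<le> 4 / e * (H_norm (g t) + G)"
          have r0: "r \<ge> 0" "t \<ge> 0" using r st ab by auto
          have "H_norm \<phi>' \<le> p'" unfolding p'_def
            by (rule order_trans[OF \<phi>(3)]) (use near(2)[OF t] e in \<open>auto intro!: divide_right_mono\<close>)
          from Q_diff[OF r0 \<phi>(1,2) this]
          have "\<bar>Q r \<phi> \<phi>' - Q t \<phi> \<phi>'\<bar> \<le> dist1 r t * ((H_norm (g r) + H_norm (g t)) * 2 + p')" .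
          also have "\<dots> \<le> (2 * \<rho>) * (4 * N + p')"
          proof (rule mult_mono)
            show "dist1 r t \<le> 2 * \<rho>" using dist1_triangle[OF r0(1) x0 r0(2)] near(1)[OF r] near(1)[OF t] dist1_sym[of x t] by linarith
            show "(H_norm (g r) + H_norm (g t)) * 2 + p' \<le> 4 * N + p'" using near(2)[OF r] near(2)[OF t] by simp
            show "0 \<le> 2 * \<rho>" using \<rho> by simp
            show "0 \<le> (H_norm (g r) + H_norm (g t)) * 2 + p'" using p' H_norm_nonneg[of "g r"] H_norm_nonneg[of "g t"] by simp
          qed
          also have "\<dots> \<le> \<epsilon>" by (rule \<rho>(3))
          finally show "\<bar>Q r \<phi> \<phi>' - Q t \<phi> \<phi>'\<bar> \<le> \<epsilon>" .
        qed
      qed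
    qed
    then show ?thesis by simp
  qed
  have "E b - E a \<le> (b - a) * K + e'" if "e' > 0" for e'
  proof -
    have "E b - E a \<le> (b - a) * (K + e' / (b - a + 1))" by (rule main) (use that ab in auto)
    also have "\<dots> = (b - a) * K + e' * ((b - a) / (b - a + 1))" by (simp add: algebra_simps)
    also have "e' * ((b - a) / (b - a + 1)) \<le> e' * 1" using that ab by (intro mult_left_mono) auto
    finally show ?thesis by simp
  qed
  then have "E b - E a \<le> (b - a) * K" by (rule field_le_epsilon)
  then show ?thesis unfolding E_def K_def .
qed

text \<open>The order of limits matters: the regularization error \<open>e * Y\<close> is not small
  compared with \<open>h\<close>, so \<open>e\<close> goes to 0 for fixed \<open>h\<close>, and only
  then are the differences divided by \<open>h\<close>.\<close>

lemma variation_increment: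
  assumes ab: "0 \<le> a" "a \<le> b" "b \<le> L"
    and Y: "\<And>s. s \<in> {a..b} \<Longrightarrow> integral {0..1} (\<lambda>x. \<bar>g s x\<bar>) \<le> Y"
  shows "integral {0..1} (\<lambda>x. \<bar>z' b x\<bar>) \<le> integral {0..1} (\<lambda>x. \<bar>z' a x\<bar>) + (b - a) * G * (2 * Y + 1)"
proof (rule L1_le_from_diff[OF _ zero_less_one])
  show "ac (z b) (z' b)" using ab by (intro zac) auto
  have aL: "a \<in> {0..L}" and bL: "b \<in> {0..L}" using ab by auto
  fix h :: real assume h: "0 < h" "h < 1"
  define D where "D t = integral {0..1} (\<lambda>x. \<bar>z t (x + h) - z t x\<bar>)" for t
  define E where "E e t = integral {0..1} (\<lambda>x. sabs e (z t (x + h) - z t x))" for e t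
  have cz: "cper (\<lambda>x. \<bar>z t (x + h) - z t x\<bar>)" if "t \<in> {0..L}" for t
    by (rule cper_intros(6)[OF cper_intros(3)[OF cper_shift(1)]]) (rule acD(6)[OF zac[OF that]])+
  have DE: "D t \<le> E e t" "E e t \<le> D t + e" if e: "e > 0" and t: "t \<in> {0..L}" for e t
  proof -
    have cE: "cper (\<lambda>x. sabs e (z t (x + h) - z t x))" using acD(6)[OF delta_sabs_ac(3)[OF e zac[OF t]]] .
    show "D t \<le> E e t" unfolding D_def E_def
      by (intro integral_le L1pD(4)[OF cper_L1p[OF cz[OF t]]] L1pD(4)[OF cper_L1p[OF cE]] sabs_pos(3)[OF e])
    have "E e t \<le> integral {0..1} (\<lambda>x. \<bar>z t (x + h) - z t x\<bar> + e)" unfolding E_def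
      by (intro integral_le integrable_add integrable_const_ivl L1pD(4)[OF cper_L1p[OF cz[OF t]]] L1pD(4)[OF cper_L1p[OF cE]] sabs_pos(4)[OF e])
    also have "\<dots> = D t + e" unfolding D_def
      using hk_integral_add[OF L1pD(4)[OF cper_L1p[OF cz[OF t]]] integrable_const_ivl[of e]] by simp
    finally show "E e t \<le> D t + e" .
  qed
  have Y0: "Y \<ge> 0"
  proof -
    have "0 \<le> integral {0..1} (\<lambda>x. \<bar>g a x\<bar>)" by (intro integral_nonneg acD(10)[OF fg(1)] ab) auto
    then show ?thesis using Y[of a] ab by auto
  qed
  have "D b \<le> (D a + (b - a) * (h * G * (2 * Y + 1))) + e" if e: "e > 0" for e
  proof -
    \<comment> \<open>Makes the total regularization error, e' at the initial time plus (b - a) e' Y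
      from the evolution, equal to \<open>e\<close>.\<close>
    define e' where "e' = e / (1 + (b - a) * Y)"
    have p: "1 + (b - a) * Y > 0" using ab Y0 by (simp add: add_pos_nonneg)
    have e': "e' > 0" unfolding e'_def using e p by simp
    have "D b \<le> E e' b" by (rule DE[OF e' bL])
    also have "\<dots> \<le> E e' a + (b - a) * (e' * Y + h * G * (2 * Y + 1))"
      using entropy_bound[OF ab e' h(1) Y] unfolding E_def by simp
    also have "\<dots> \<le> (D a + e') + (b - a) * (e' * Y + h * G * (2 * Y + 1))" using DE(2)[OF e' aL] by simp
    also have "\<dots> = (D a + (b - a) * (h * G * (2 * Y + 1))) + e' * (1 + (b - a) * Y)" by (simp add: algebra_simps)
    also have "e' * (1 + (b - a) * Y) = e" unfolding e'_def using p by simp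
    finally show ?thesis .
  qed
  then have "D b \<le> D a + (b - a) * (h * G * (2 * Y + 1))" by (rule field_le_epsilon)
  also have "D a \<le> h * integral {0..1} (\<lambda>x. \<bar>z' a x\<bar>)" unfolding D_def by (rule L1_diff_le[OF zac[OF aL]]) (use h in simp)
  finally show "integral {0..1} (\<lambda>x. \<bar>z b (x + h) - z b x\<bar>) \<le> (integral {0..1} (\<lambda>x. \<bar>z' a x\<bar>) + (b - a) * G * (2 * Y + 1)) * h"
    unfolding D_def by (simp add: algebra_simps)
qed

text \<open>Gronwall's argument in time steps of length \<open>1 / (4 (G + 1))\<close>, in each of which the variation at most doubles
  (up to a constant).\<close>

theorem variation_bound:
  assumes t: "t \<in> {0..L}"
  shows "integral {0..1} (\<lambda>x. \<bar>g t x\<bar>) \<le> 2 powr (4 * (G + 1) * L + 1) * (integral {0..1} (\<lambda>x. \<bar>dx u0 x\<bar>) + 2 * G + 1) + G"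
proof -
  define y where "y t = integral {0..1} (\<lambda>x. \<bar>z' t x\<bar>)" for t
  \<comment> \<open>The constant part of 2 (m + G) + 1; adding it to \<open>y\<close> makes the
    doubling inequality homogeneous and thus iterable.\<close>
  define c where "c = 2 * G + 1"
  define \<tau> where "\<tau> = 1 / (4 * (G + 1))"
  have \<tau>: "\<tau> > 0" "2 * \<tau> * G \<le> 1/2" unfolding \<tau>_def using G0 by (auto simp: field_simps)
  have I: "(\<lambda>x. \<bar>g t x\<bar>) integrable_on {0..1}" "(\<lambda>x. \<bar>z' t x\<bar>) integrable_on {0..1}" if "t \<in> {0..L}" for t
    using acD(10)[OF fg(1)] acD(10)[OF zac] that by auto
  have y_g: "integral {0..1} (\<lambda>x. \<bar>g t x\<bar>) \<le> y t + G" "y t \<le> integral {0..1} (\<lambda>x. \<bar>g t x\<bar>) + G" if t: "t \<in> {0..L}" for t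
  proof -
    have "integral {0..1} (\<lambda>x. \<bar>g t x\<bar>) \<le> integral {0..1} (\<lambda>x. \<bar>z' t x\<bar> + G)"
    proof (rule integral_le)
      fix x show "\<bar>g t x\<bar> \<le> \<bar>z' t x\<bar> + G" unfolding z'_def using G(1)[OF t, of x] by linarith
    qed (intro I t integrable_add integrable_const_ivl)+
    then show "integral {0..1} (\<lambda>x. \<bar>g t x\<bar>) \<le> y t + G" unfolding y_def
      using hk_integral_add[OF I(2)[OF t] integrable_const_ivl[of G]] by simp
    have "y t \<le> integral {0..1} (\<lambda>x. \<bar>g t x\<bar> + G)" unfolding y_def
    proof (rule integral_le)
      fix x show "\<bar>z' t x\<bar> \<le> \<bar>g t x\<bar> + G" unfolding z'_def using G(1)[OF t, of x] by linarith
    qed (intro I t integrable_add integrable_const_ivl)+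
    then show "y t \<le> integral {0..1} (\<lambda>x. \<bar>g t x\<bar>) + G"
      using hk_integral_add[OF I(1)[OF t] integrable_const_ivl[of G]] by simp
  qed
  have y0: "y t \<ge> 0" if "t \<in> {0..L}" for t unfolding y_def by (intro integral_nonneg I that) auto
  obtain K where K: "\<And>t. t \<in> {0..L} \<Longrightarrow> y t \<le> K"
  proof -
    obtain K where K: "\<And>t. t \<in> {0..L} \<Longrightarrow> H_norm (g t) \<le> K" using norm_bounded by blast
    have "y t \<le> K + G" if "t \<in> {0..L}" for t
      using y_g(2)[OF that] L1_le_H_norm[OF g_L2, of t] K[OF that] that by auto
    then show thesis using that by blast
  qed
  have step: "y t + c \<le> 2 * (y a + c)" if a: "0 \<le> a" "a \<le> t" "t \<le> L" "t - a \<le> \<tau>" for a t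
  proof -
    \<comment> \<open>The increment bound contains the supremum over the step itself. It is finite
      by \<open>K\<close>, and its coefficient 2 \<tau> G \<le> 1/2 lets it be absorbed on the
      left.\<close>
    define m where "m = (SUP s\<in>{a..t}. y s)"
    have bdd: "bdd_above (y ` {a..t})" by (rule bdd_aboveI[of _ K]) (use K a in auto)
    have ym: "y s \<le> m" if "s \<in> {a..t}" for s unfolding m_def by (rule cSUP_upper[OF that bdd])
    have "y s \<le> y a + \<tau> * G * (2 * (m + G) + 1)" if s: "s \<in> {a..t}" for s
    proof -
      have "y s \<le> y a + (s - a) * G * (2 * (m + G) + 1)"
        unfolding y_def
      proof (rule variation_increment)
        fix r assume r: "r \<in> {a..s}"
        then have "r \<in> {0..L}" using a s by auto
        from y_g(1)[OF this] ym[of r] r s show "integral {0..1} (\<lambda>x. \<bar>g r x\<bar>) \<le> m + G" by auto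
      qed (use a s in auto)
      also have "(s - a) * G * (2 * (m + G) + 1) \<le> \<tau> * G * (2 * (m + G) + 1)"
        using ym[of a] y0[of a] a s G0 by (intro mult_right_mono) auto
      finally show ?thesis by simp
    qed
    then have "m \<le> y a + \<tau> * G * (2 * (m + G) + 1)" unfolding m_def by (intro cSUP_least) (use a in \<open>auto simp: m_def\<close>)
    also have "\<dots> = y a + (2 * \<tau> * G) * m + (\<tau> * G) * c" by (simp add: c_def algebra_simps)
    also have "\<dots> \<le> y a + (1/2) * m + (1/4) * c"
      using \<tau>(2) ym[of a] y0[of a] a G0 by (intro add_mono mult_right_mono) (auto simp: c_def)
    finally have "m \<le> y a + (1/2) * m + (1/4) * c" .
    moreover have "c \<ge> 0" using G0 by (simp add: c_def)
    ultimately have "m \<le> 2 * y a + c" by linarith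
    then show ?thesis using ym[of t] a by simp
  qed
  have iter: "\<forall>t\<in>{0..L}. t \<le> real n * \<tau> \<longrightarrow> y t + c \<le> 2 ^ n * (y 0 + c)" for n
  proof (induction n)
    case 0
    then show ?case by auto
  next
    case (Suc n)
    show ?case
    proof (intro ballI impI)
      fix t assume t: "t \<in> {0..L}" "t \<le> real (Suc n) * \<tau>"
      define a where "a = max 0 (t - \<tau>)"
      have a: "a \<in> {0..L}" "a \<le> t" "t - a \<le> \<tau>" "a \<le> real n * \<tau>" using t \<tau> by (auto simp: a_def algebra_simps)
      have "y t + c \<le> 2 * (y a + c)" using a t by (intro step) auto
      also have "\<dots> \<le> 2 * (2 ^ n * (y 0 + c))" using Suc a by (intro mult_left_mono) auto
      finally show "y t + c \<le> 2 ^ Suc n * (y 0 + c)" by simp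
    qed
  qed
  \<comment> \<open>L / \<tau> = 4 (G + 1) L steps, plus at most one for rounding up: the exponent
    in the statement.\<close>
  define n where "n = nat \<lceil>L / \<tau>\<rceil>"
  have "real n = of_int \<lceil>L / \<tau>\<rceil>" unfolding n_def using L \<tau> by simp
  then have n: "L / \<tau> \<le> real n" "real n \<le> L / \<tau> + 1" using le_of_int_ceiling[of "L / \<tau>"] of_int_ceiling_le_add_one[of "L / \<tau>"] by auto
  have L0: "0 \<in> {0..L}" using L by simp
  \<comment> \<open>The force has no spatial derivative at time 0, so the iteration starts from the
    variation of the initial value, which is free of the viscosity.\<close>
  have y00: "y 0 = integral {0..1} (\<lambda>x. \<bar>dx u0 x\<bar>)"
  proof -
    have u0H: "u0 \<in> H_space" using u0 by (auto simp: H1_space_def)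
    have "AE x in lborel. v 0 x = u0 x" using path by (simp add: burgers_path_def)
    then have "AE x in lborel. u0 x = f 0 x" using fg(2)[OF order_refl] by eventually_elim simp
    from dx_unique(2)[OF u0H fg(1)[OF order_refl] this] have ae: "AE x in lborel. dx u0 x = g 0 x" .
    have "y 0 = integral {0..1} (\<lambda>x. \<bar>g 0 x\<bar>)" unfolding y_def z'_def by (simp add: \<xi>0)
    also have "\<dots> = integral {0..1} (\<lambda>x. \<bar>dx u0 x\<bar>)"
      by (rule integral_cong_AE[OF L1p_intros(5)[OF L2p_L1p[OF g_L2[OF order_refl]]] L1p_intros(5)[OF L2p_L1p[OF H_spaceD(1)[OF H1_space_ac(2)[OF u0]]]]])
         (use ae in \<open>eventually_elim, simp\<close>)
    finally show ?thesis .
  qed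
  have "t \<le> real n * \<tau>" using n(1) \<tau> t by (auto simp: field_simps)
  then have "y t + c \<le> 2 ^ n * (y 0 + c)" using iter[of n] t by blast
  also have "(2::real) ^ n = 2 powr real n" by (simp add: powr_realpow)
  also have "2 powr real n * (y 0 + c) \<le> 2 powr (4 * (G + 1) * L + 1) * (y 0 + c)"
  proof (rule mult_right_mono)
    have "L / \<tau> = 4 * (G + 1) * L" unfolding \<tau>_def using G0 by (simp add: field_simps)
    then show "2 powr real n \<le> 2 powr (4 * (G + 1) * L + 1)" using n(2) by simp
    show "0 \<le> y 0 + c" using y0[OF L0] G0 by (simp add: c_def)
  qed
  finally have "y t + c \<le> 2 powr (4 * (G + 1) * L + 1) * (integral {0..1} (\<lambda>x. \<bar>dx u0 x\<bar>) + 2 * G + 1)"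
    unfolding y00 by (simp add: c_def add.assoc)
  then show ?thesis using y_g(1)[OF t] G0 by (simp add: c_def)
qed

end

section \<open>Exponential moments of the noise\<close>

text \<open>Completing the square evaluates the moment generating function, and exp |x| \<le> exp x
  + exp (-x) accounts for the factor 2.\<close>

lemma (in prob_space) normal_exp_abs_le:
  assumes X: "distributed M lborel X (normal_density 0 \<sigma>)" and s: "\<sigma> > 0"
  shows "(\<integral>\<^sup>+\<omega>. ennreal (exp (\<mu> * \<bar>X \<omega>\<bar>)) \<partial>M) \<le> ennreal (2 * exp (\<mu>\<^sup>2 * \<sigma>\<^sup>2 / 2))"
proof -
  have 1: "(\<integral>\<^sup>+\<omega>. ennreal (exp (m * X \<omega>)) \<partial>M) = ennreal (exp (m\<^sup>2 * \<sigma>\<^sup>2 / 2))" for m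
  proof -
    have "(\<integral>\<^sup>+\<omega>. ennreal (exp (m * X \<omega>)) \<partial>M) = (\<integral>\<^sup>+x. ennreal (normal_density 0 \<sigma> x) * ennreal (exp (m * x)) \<partial>lborel)"
      by (rule distributed_nn_integral[OF X, symmetric]) simp
    also have "\<dots> = (\<integral>\<^sup>+x. ennreal (exp (m\<^sup>2 * \<sigma>\<^sup>2 / 2)) * ennreal (normal_density (m * \<sigma>\<^sup>2) \<sigma> x) \<partial>lborel)"
    proof (rule nn_integral_cong)
      fix x :: real
      have "-(x\<^sup>2) / (2 * \<sigma>\<^sup>2) + m * x = m\<^sup>2 * \<sigma>\<^sup>2 / 2 + (-(x - m * \<sigma>\<^sup>2)\<^sup>2 / (2 * \<sigma>\<^sup>2))"
        using s by (simp add: field_simps power2_eq_square)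
      then have "exp (-(x\<^sup>2) / (2 * \<sigma>\<^sup>2)) * exp (m * x) = exp (m\<^sup>2 * \<sigma>\<^sup>2 / 2) * exp (-(x - m * \<sigma>\<^sup>2)\<^sup>2 / (2 * \<sigma>\<^sup>2))"
        unfolding exp_add[symmetric] by simp
      then have "normal_density 0 \<sigma> x * exp (m * x) = exp (m\<^sup>2 * \<sigma>\<^sup>2 / 2) * normal_density (m * \<sigma>\<^sup>2) \<sigma> x"
        unfolding normal_density_def by simp
      then show "ennreal (normal_density 0 \<sigma> x) * ennreal (exp (m * x)) = ennreal (exp (m\<^sup>2 * \<sigma>\<^sup>2 / 2)) * ennreal (normal_density (m * \<sigma>\<^sup>2) \<sigma> x)"
        by (simp add: ennreal_mult'[symmetric])
    qed
    also have "\<dots> = ennreal (exp (m\<^sup>2 * \<sigma>\<^sup>2 / 2)) * (\<integral>\<^sup>+x. ennreal (normal_density (m * \<sigma>\<^sup>2) \<sigma> x) \<partial>lborel)"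
      by (rule nn_integral_cmult) simp
    also have "(\<integral>\<^sup>+x. ennreal (normal_density (m * \<sigma>\<^sup>2) \<sigma> x) \<partial>lborel) = 1"
      using s by (subst nn_integral_eq_integral) auto
    finally show ?thesis by simp
  qed
  have [measurable]: "X \<in> borel_measurable M" using distributed_measurable[OF X] by simp
  have "(\<integral>\<^sup>+\<omega>. ennreal (exp (\<mu> * \<bar>X \<omega>\<bar>)) \<partial>M) \<le> (\<integral>\<^sup>+\<omega>. ennreal (exp (\<mu> * X \<omega>)) + ennreal (exp ((-\<mu>) * X \<omega>)) \<partial>M)"
    by (intro nn_integral_mono) (auto simp: ennreal_plus[symmetric] abs_if simp del: ennreal_plus intro!: ennreal_leI)
  also have "\<dots> = ennreal (2 * exp (\<mu>\<^sup>2 * \<sigma>\<^sup>2 / 2))"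
    by (subst nn_integral_add) (auto simp: 1[of \<mu>] 1[of "-\<mu>", simplified] ennreal_plus[symmetric] simp del: ennreal_plus)
  finally show ?thesis .
qed

text \<open>Jensen's inequality for weights of total mass at most 1: the missing mass sits at 0,
  where exp is 1, and costs at most the summand 1. The proof compares exp with its tangent at the
  weighted sum.\<close>

lemma exp_sum_le:
  fixes p x :: "'a \<Rightarrow> real"
  assumes p: "\<And>i. i \<in> I \<Longrightarrow> p i \<ge> 0" "sum p I \<le> 1" and x: "\<And>i. i \<in> I \<Longrightarrow> x i \<ge> 0"
  shows "exp (\<Sum>i\<in>I. p i * x i) \<le> 1 + (\<Sum>i\<in>I. p i * exp (x i))"
proof -
  define m where "m = (\<Sum>i\<in>I. p i * x i)"
  define q where "q = sum p I"
  have m: "m \<ge> 0" unfolding m_def using p x by (intro sum_nonneg) auto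
  have "(\<Sum>i\<in>I. p i * exp (x i)) \<ge> (\<Sum>i\<in>I. p i * (exp m * (1 + (x i - m))))"
  proof (intro sum_mono mult_left_mono p)
    fix i
    have "exp m * (1 + (x i - m)) \<le> exp m * exp (x i - m)" by (intro mult_left_mono exp_ge_add_one_self) auto
    then show "exp m * (1 + (x i - m)) \<le> exp (x i)" by (simp add: exp_add[symmetric])
  qed
  moreover have "(\<Sum>i\<in>I. p i * (exp m * (1 + (x i - m)))) = exp m * (q + m - q * m)"
  proof -
    have "(\<Sum>i\<in>I. p i * (E * (1 + (x i - m)))) = E * (q + m - q * m)" for E
    proof -
      have "(\<Sum>i\<in>I. p i * (E * (1 + (x i - m)))) = (\<Sum>i\<in>I. E * p i + E * (p i * x i) - (E * m) * p i)"
        by (intro sum.cong) (auto simp: algebra_simps)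
      also have "\<dots> = E * q + E * m - (E * m) * q"
        unfolding sum_subtractf sum.distrib sum_distrib_left[symmetric] m_def[symmetric] q_def ..
      finally show ?thesis by (simp add: algebra_simps)
    qed
    then show ?thesis .
  qed
  \<comment> \<open>Since 1 - (q + m - q m) = (1 - q) (1 - m), this says exp m (1 - q) (1 - m) \<le>
    1.\<close>
  moreover have "exp m * (q + m - q * m) + 1 \<ge> exp m"
  proof (cases "m \<le> 1")
    case True
    have "1 + (-m) \<le> exp (-m)" by (rule exp_ge_add_one_self)
    then have "exp m * (1 - m) \<le> exp m * exp (-m)" by (intro mult_left_mono) auto
    then have e: "exp m * (1 - m) \<le> 1" by (simp add: exp_minus)
    have q: "0 \<le> q" "q \<le> 1" unfolding q_def using p by (auto intro: sum_nonneg)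
    have "(1 - q) * (exp m * (1 - m)) \<le> 1 * 1" by (rule mult_mono) (use e q True in auto)
    then show ?thesis by (simp add: algebra_simps)
  next
    case False
    have "q \<le> 1" unfolding q_def by (rule p)
    then have "(1 - q) * (m - 1) \<ge> 0" using False by simp
    then have "q + m - q * m \<ge> 1" by (simp add: algebra_simps)
    then have "exp m * 1 \<le> exp m * (q + m - q * m)" by (intro mult_left_mono) auto
    then have "exp m \<le> exp m * (q + m - q * m)" by (simp only: mult_1_right)
    then show ?thesis by linarith
  qed
  ultimately show ?thesis unfolding m_def[symmetric] by linarith
qed

text \<open>Chaining along dyadic points: level \<open>n\<close> enters with weight \<open>\<rho>\<^sup>2\<^sup>n\<close>, where \<open>\<rho>\<^sup>4 = 1/2\<close>, and a maximum over
  \<open>2\<^sup>n\<close> increments is controlled by \<open>y \<le> r + y\<^sup>4 / r\<^sup>3\<close> with \<open>r = \<rho>\<^sup>-\<^sup>n\<close>. Only the laws of the increments are used.\<close>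

lemma wiener_exp_bound:
  fixes P :: "'w measure"
  assumes P: "prob_space P" and L: "L > 0" and lam0: "lam > 0"
  shows "\<exists>C\<ge>0. \<forall>w. standard_wiener P w \<longrightarrow>
    (\<exists>W\<in>borel_measurable P. (\<integral>\<^sup>+\<omega>. W \<omega> \<partial>P) \<le> ennreal C \<and>
      (AE \<omega> in P. \<forall>t\<in>{0..L}. ennreal (exp (lam * \<bar>w t \<omega>\<bar>)) \<le> W \<omega>))"
proof -
  interpret prob_space P by fact
  \<comment> \<open>With \<rho>^4 = 1/2 the squared weight \<open>(p n)^2\<close> decays like the
    variance L / 2^n of a level-n increment. Hence the exponential moments at all levels have one
    bound \<open>C0\<close>; the factor \<gamma> gives the weights total mass 1.\<close>
  define \<rho> :: real where "\<rho> = (1/2) powr (1/4)"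
  have \<rho>: "0 < \<rho>" "\<rho> < 1" "\<rho> ^ 4 = 1/2"
  proof -
    show "0 < \<rho>" by (simp add: \<rho>_def)
    have "\<rho> < 1 powr (1/4)" unfolding \<rho>_def by (rule powr_less_mono2) auto
    then show "\<rho> < 1" by simp
    have "\<rho> ^ 4 = \<rho> powr real 4" using \<open>0 < \<rho>\<close> by (subst powr_realpow) auto
    also have "\<dots> = 1/2" unfolding \<rho>_def by (subst powr_powr) simp
    finally show "\<rho> ^ 4 = 1/2" .
  qed
  define \<gamma> where "\<gamma> = 1 - \<rho>\<^sup>2"
  have \<gamma>: "\<gamma> > 0" unfolding \<gamma>_def using \<rho> by (simp add: power_less_one_iff abs_square_less_1)
  define p where "p n = \<gamma> * \<rho> ^ (2 * n)" for n
  define r where "r n = (1 / \<rho>) ^ n" for n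
  define \<mu> where "\<mu> n = lam / p n" for n
  define C0 where "C0 = 2 * exp (8 * lam\<^sup>2 * L / \<gamma>\<^sup>2)"
  have p: "p n > 0" and r: "r n > 0" for n using \<rho> \<gamma> by (auto simp: p_def r_def)
  have \<mu>: "\<mu> n > 0" for n using p[of n] lam0 by (simp add: \<mu>_def)
  have psum: "(\<Sum>n\<in>{..N}. p n) \<le> 1" for N
  proof -
    have "(\<Sum>n\<in>{..N}. p n) = \<gamma> * (\<Sum>n\<in>{..N}. (\<rho>\<^sup>2) ^ n)" by (simp add: p_def sum_distrib_left power_mult)
    also have "\<dots> = 1 - (\<rho>\<^sup>2) ^ Suc N" using sum_gp_basic[of "\<rho>\<^sup>2" N] by (simp add: \<gamma>_def)
    also have "\<dots> \<le> 1" by simp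
    finally show ?thesis .
  qed
  have pow: "\<rho> ^ (4 * n) = (1/2) ^ n" for n by (simp add: power_mult \<rho>)
  \<comment> \<open>The sum over 2^n increments, divided by \<open>r n ^ 3\<close>, is again of size
    \<open>r n\<close> in expectation; and \<open>p n * r n\<close> is \<gamma> \<rho>^n, which is
    summable.\<close>
  have r4: "2 ^ n / r n ^ 3 = r n" for n
  proof -
    have "r n ^ 4 = 2 ^ n" unfolding r_def by (simp add: power_mult[symmetric] mult.commute[of n] power_one_over pow del: power_mult)
    then show ?thesis using r[of n] by (simp add: field_simps power4_eq_xxxx power3_eq_cube)
  qed
  have var: "(4 * \<mu> n)\<^sup>2 * (L / 2 ^ n) / 2 = 8 * lam\<^sup>2 * L / \<gamma>\<^sup>2" for n
  proof -
    have "(p n)\<^sup>2 = \<gamma>\<^sup>2 * \<rho> ^ (4 * n)" by (simp add: p_def power_mult_distrib power_mult[symmetric])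
    then have "(p n)\<^sup>2 * 2 ^ n = \<gamma>\<^sup>2" by (simp add: pow power_one_over)
    then have "(\<mu> n)\<^sup>2 * (1 / 2 ^ n) = lam\<^sup>2 / \<gamma>\<^sup>2" unfolding \<mu>_def power_divide by (metis divide_divide_eq_left times_divide_eq_right mult.right_neutral)
    then show ?thesis by (simp add: power_mult_distrib field_simps)
  qed
  define C where "C = 1 + \<gamma> * (1 + C0) / (1 - \<rho>)"
  show ?thesis
  \<comment> \<open>\<open>C\<close> is fixed before the process is given: one constant has to serve
    infinitely many modes in \<open>noise_exp_bound\<close>.\<close>
  proof (intro exI[of _ C] conjI allI impI)
    show "0 \<le> C" unfolding C_def C0_def using \<gamma> \<rho> by (auto intro!: add_nonneg_nonneg divide_nonneg_pos mult_nonneg_nonneg)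
    fix w :: "real \<Rightarrow> 'w \<Rightarrow> real"
    assume w: "standard_wiener P w"
    define tt where "tt n j = real j * L / 2 ^ n" for n j
    define \<Delta> where "\<Delta> n j \<omega> = w (tt n (Suc j)) \<omega> - w (tt n j) \<omega>" for n j \<omega>
    define S where "S n \<omega> = r n + (\<Sum>j<2^n. exp (4 * \<mu> n * \<bar>\<Delta> n j \<omega>\<bar>)) / r n ^ 3" for n \<omega>
    define W where "W \<omega> = 1 + (\<Sum>n. ennreal (p n * S n \<omega>))" for \<omega>
    have tt0: "tt n j \<ge> 0" for n j using L by (simp add: tt_def)
    have [measurable]: "w (tt n j) \<in> borel_measurable P" for n j using w tt0 by (auto simp: standard_wiener_def)
    have [measurable]: "\<Delta> n j \<in> borel_measurable P" for n j unfolding \<Delta>_def by measurable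
    have [measurable]: "S n \<in> borel_measurable P" for n unfolding S_def by measurable
    have S0: "S n \<omega> \<ge> 0" for n \<omega> unfolding S_def using r[of n] by (auto intro!: add_nonneg_nonneg divide_nonneg_pos sum_nonneg)
    have ES: "(\<integral>\<^sup>+\<omega>. ennreal (S n \<omega>) \<partial>P) \<le> ennreal (r n * (1 + C0))" for n
    proof -
      have E: "(\<integral>\<^sup>+\<omega>. ennreal (exp (4 * \<mu> n * \<bar>\<Delta> n j \<omega>\<bar>)) \<partial>P) \<le> ennreal C0" for j
      proof -
        have lt: "tt n j < tt n (Suc j)" "tt n (Suc j) - tt n j = L / 2 ^ n" using L by (auto simp: tt_def field_simps)
        then have "distributed P lborel (\<Delta> n j) (normal_density 0 (sqrt (L / 2 ^ n)))"
          using w tt0[of n j] unfolding standard_wiener_def \<Delta>_def[abs_def] by metis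
        from normal_exp_abs_le[OF this, of "4 * \<mu> n"] L
        show ?thesis unfolding C0_def using var[of n] by simp
      qed
      have "(\<integral>\<^sup>+\<omega>. ennreal (S n \<omega>) \<partial>P) = (\<integral>\<^sup>+\<omega>. ennreal (r n) + (\<Sum>j<2^n. ennreal (1 / r n ^ 3) * ennreal (exp (4 * \<mu> n * \<bar>\<Delta> n j \<omega>\<bar>))) \<partial>P)"
        by (intro nn_integral_cong) (use r[of n] in \<open>simp add: S_def ennreal_plus[symmetric] ennreal_mult'[symmetric] sum_ennreal sum_divide_distrib sum_nonneg del: ennreal_plus\<close>)
      also have "\<dots> = ennreal (r n) + (\<Sum>j<2^n. ennreal (1 / r n ^ 3) * (\<integral>\<^sup>+\<omega>. ennreal (exp (4 * \<mu> n * \<bar>\<Delta> n j \<omega>\<bar>)) \<partial>P))"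
        by (subst nn_integral_add, simp, simp, subst nn_integral_sum, simp, subst nn_integral_cmult, simp) (simp add: emeasure_space_1)
      also have "\<dots> \<le> ennreal (r n) + (\<Sum>j<(2^n::nat). ennreal (1 / r n ^ 3) * ennreal C0)"
        by (intro add_left_mono sum_mono mult_left_mono E) auto
      also have "(\<Sum>j<(2^n::nat). ennreal (1 / r n ^ 3) * ennreal C0) = ennreal (2 ^ n * (1 / r n ^ 3 * C0))"
      proof -
        have "(\<Sum>j<(2^n::nat). ennreal (1 / r n ^ 3) * ennreal C0) = (\<Sum>j<(2^n::nat). ennreal (1 / r n ^ 3 * C0))"
          by (intro sum.cong refl ennreal_mult'[symmetric]) (use r[of n] in simp)
        also have "\<dots> = ennreal (\<Sum>j<(2^n::nat). 1 / r n ^ 3 * C0)"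
          using r[of n] by (intro sum_ennreal) (simp add: C0_def)
        finally show ?thesis by simp
      qed
      also have "ennreal (r n) + ennreal (2 ^ n * (1 / r n ^ 3 * C0)) = ennreal (r n * (1 + C0))"
      proof -
        have "2 ^ n * (1 / r n ^ 3 * C0) = (2 ^ n / r n ^ 3) * C0" by simp
        then have eq: "2 ^ n * (1 / r n ^ 3 * C0) = r n * C0" by (simp only: r4)
        have "C0 \<ge> 0" by (simp add: C0_def)
        then show ?thesis unfolding eq distrib_left mult_1_right
          using r[of n] by (intro ennreal_plus[symmetric]) auto
      qed
      finally show ?thesis .
    qed
    have "W \<in> borel_measurable P" unfolding W_def by measurable
    moreover have "(\<integral>\<^sup>+\<omega>. W \<omega> \<partial>P) \<le> ennreal C"
    proof -
      have "(\<integral>\<^sup>+\<omega>. W \<omega> \<partial>P) = 1 + (\<Sum>n. \<integral>\<^sup>+\<omega>. ennreal (p n * S n \<omega>) \<partial>P)"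
        unfolding W_def by (subst nn_integral_add, simp, simp, subst nn_integral_suminf, simp) (simp add: emeasure_space_1)
      also have "(\<Sum>n. \<integral>\<^sup>+\<omega>. ennreal (p n * S n \<omega>) \<partial>P) \<le> (\<Sum>n. ennreal (\<gamma> * (1 + C0) * \<rho> ^ n))"
      proof (intro suminf_le summableI)
        fix n
        have "(\<integral>\<^sup>+\<omega>. ennreal (p n * S n \<omega>) \<partial>P) = ennreal (p n) * (\<integral>\<^sup>+\<omega>. ennreal (S n \<omega>) \<partial>P)"
          using p[of n] S0 by (subst nn_integral_cmult[symmetric]) (auto simp: ennreal_mult' less_imp_le)
        also have "\<dots> \<le> ennreal (p n) * ennreal (r n * (1 + C0))" by (intro mult_left_mono ES) auto
        also have "\<dots> = ennreal (\<gamma> * (1 + C0) * \<rho> ^ n)"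
        proof -
          have "\<rho> ^ (2 * n) * (1 / \<rho>) ^ n = (\<rho>\<^sup>2 * (1 / \<rho>)) ^ n"
            unfolding power_mult power_mult_distrib ..
          also have "\<rho>\<^sup>2 * (1 / \<rho>) = \<rho>" using \<rho> by (simp add: power2_eq_square)
          finally have pr: "p n * r n = \<gamma> * \<rho> ^ n" by (simp only: p_def r_def mult.assoc)
          have "p n * (r n * (1 + C0)) = (p n * r n) * (1 + C0)" by (simp only: mult.assoc)
          also have "\<dots> = \<gamma> * (1 + C0) * \<rho> ^ n" unfolding pr by (simp only: mult.assoc mult.commute[of "\<rho> ^ n"])
          finally have "p n * (r n * (1 + C0)) = \<gamma> * (1 + C0) * \<rho> ^ n" .
          then show ?thesis using ennreal_mult'[of "p n" "r n * (1 + C0)"] p[of n] by (simp only: less_imp_le)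
        qed
        finally show "(\<integral>\<^sup>+\<omega>. ennreal (p n * S n \<omega>) \<partial>P) \<le> ennreal (\<gamma> * (1 + C0) * \<rho> ^ n)" .
      qed
      also have "(\<Sum>n. ennreal (\<gamma> * (1 + C0) * \<rho> ^ n)) = ennreal (\<Sum>n. \<gamma> * (1 + C0) * \<rho> ^ n)"
        using \<rho> \<gamma> by (intro suminf_ennreal2 summable_mult summable_geometric) (auto simp: C0_def)
      also have "(\<Sum>n. \<gamma> * (1 + C0) * \<rho> ^ n) = \<gamma> * (1 + C0) / (1 - \<rho>)"
        using \<rho> by (subst suminf_mult) (auto simp: suminf_geometric summable_geometric)
      finally have "(\<integral>\<^sup>+\<omega>. W \<omega> \<partial>P) \<le> 1 + ennreal (\<gamma> * (1 + C0) / (1 - \<rho>))" by (simp add: add_left_mono)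
      also have "\<dots> = ennreal C" unfolding C_def using \<rho> \<gamma> by (subst ennreal_plus) (auto simp: C0_def intro!: divide_nonneg_pos mult_nonneg_nonneg)
      finally show ?thesis .
    qed
    moreover have "AE \<omega> in P. \<forall>t\<in>{0..L}. ennreal (exp (lam * \<bar>w t \<omega>\<bar>)) \<le> W \<omega>"
    proof -
      have "AE \<omega> in P. w 0 \<omega> = 0 \<and> continuous_on {0..} (\<lambda>t. w t \<omega>)" using w by (simp add: standard_wiener_def)
      then show ?thesis
      proof eventually_elim
        case (elim \<omega>)
        then have w0: "w 0 \<omega> = 0" and cont: "continuous_on {0..} (\<lambda>t. w t \<omega>)" by auto
        define m where "m n = Max ((\<lambda>j. \<bar>\<Delta> n j \<omega>\<bar>) ` {..<2^n})" for n
        have mge: "\<bar>\<Delta> n j \<omega>\<bar> \<le> m n" if "j < 2^n" for n j unfolding m_def using that by (intro Max_ge) auto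
        have m0: "m n \<ge> 0" for n using mge[of 0 n] abs_ge_zero[of "\<Delta> n 0 \<omega>"] by (simp del: abs_ge_zero)
        \<comment> \<open>One increment per level suffices: an even index is already a point of the
          previous level, and an odd one has such a point as left neighbour.\<close>
        have chain: "\<bar>w (tt n j) \<omega>\<bar> \<le> (\<Sum>i\<in>{..n}. m i)" if "j \<le> 2^n" for n j
          using that
        proof (induction n arbitrary: j)
          case 0
          then have "j = 0 \<or> j = 1" by auto
          then show ?case
          proof
            assume "j = 0"
            then show ?thesis using w0 m0[of 0] by (simp add: tt_def)
          next
            assume "j = 1"
            then show ?thesis using w0 mge[of 0 0] by (simp add: tt_def \<Delta>_def)
          qed
        next
          case (Suc n)
          have tt2: "tt (Suc n) (2 * i) = tt n i" for i by (simp add: tt_def)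
          show ?case
          proof (cases "even j")
            case True
            then obtain i where i: "j = 2 * i" by (elim evenE)
            then have "i \<le> 2 ^ n" using Suc.prems by simp
            from Suc.IH[OF this] have "\<bar>w (tt (Suc n) j) \<omega>\<bar> \<le> (\<Sum>i\<in>{..n}. m i)" unfolding i tt2 .
            then show ?thesis using m0[of "Suc n"] by simp
          next
            case False
            then obtain i where i: "j = 2 * i + 1" by (elim oddE)
            have "2 * i < 2 ^ Suc n" "i \<le> 2 ^ n" using Suc.prems i by auto
            from Suc.IH[OF this(2)] have a: "\<bar>w (tt (Suc n) (2 * i)) \<omega>\<bar> \<le> (\<Sum>i\<in>{..n}. m i)" unfolding tt2 .
            note \<open>2 * i < 2 ^ Suc n\<close>
            from mge[OF this] have b: "\<bar>w (tt (Suc n) j) \<omega> - w (tt (Suc n) (2 * i)) \<omega>\<bar> \<le> m (Suc n)" by (simp add: \<Delta>_def i)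
            show ?thesis using a b by simp
          qed
        qed
        have SW: "ennreal (1 + (\<Sum>n\<in>{..N}. p n * S n \<omega>)) \<le> W \<omega>" for N
        proof -
          have "ennreal (1 + (\<Sum>n\<in>{..N}. p n * S n \<omega>)) = 1 + (\<Sum>n\<in>{..N}. ennreal (p n * S n \<omega>))"
            using p S0 by (subst ennreal_plus) (auto simp: sum_ennreal less_imp_le intro!: sum_nonneg)
          also have "\<dots> \<le> W \<omega>" unfolding W_def by (intro add_left_mono sum_le_suminf) auto
          finally show ?thesis .
        qed
        have dy: "ennreal (exp (lam * \<bar>w (tt n j) \<omega>\<bar>)) \<le> W \<omega>" if j: "j \<le> 2^n" for n j
        proof (rule order_trans[OF ennreal_leI SW])
          have "exp (lam * \<bar>w (tt n j) \<omega>\<bar>) \<le> exp (lam * (\<Sum>i\<in>{..n}. m i))" using chain[OF j] lam0 by simp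
          also have "lam * (\<Sum>i\<in>{..n}. m i) = (\<Sum>i\<in>{..n}. p i * (\<mu> i * m i))"
            unfolding sum_distrib_left using p by (intro sum.cong) (auto simp: \<mu>_def less_imp_neq[THEN not_sym])
          also have "exp (\<Sum>i\<in>{..n}. p i * (\<mu> i * m i)) \<le> 1 + (\<Sum>i\<in>{..n}. p i * exp (\<mu> i * m i))"
            by (rule exp_sum_le) (use p psum \<mu> m0 in \<open>auto simp: less_imp_le\<close>)
          also have "\<dots> \<le> 1 + (\<Sum>i\<in>{..n}. p i * S i \<omega>)"
          proof (intro add_left_mono sum_mono mult_left_mono)
            fix i
            have "m i \<in> (\<lambda>j. \<bar>\<Delta> i j \<omega>\<bar>) ` {..<2^i}" unfolding m_def by (intro Max_in) (auto simp: lessThan_empty_iff)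
            then obtain j where j: "j < 2^i" "m i = \<bar>\<Delta> i j \<omega>\<bar>" by auto
            define y where "y = exp (\<mu> i * m i)"
            have y4: "y ^ 4 = exp (4 * \<mu> i * \<bar>\<Delta> i j \<omega>\<bar>)" unfolding y_def j(2) by (simp add: exp_of_nat_mult[symmetric] mult.assoc)
            have yr: "y \<le> r i + y ^ 4 / r i ^ 3"
            proof (cases "y \<le> r i")
              case True
              then show ?thesis using r[of i] by (intro order_trans[OF True]) (simp add: y_def)
            next
              case False
              then have "r i ^ 3 \<le> y ^ 3" using r[of i] by (intro power_mono) auto
              then have "y * r i ^ 3 \<le> y * y ^ 3" by (intro mult_left_mono) (auto simp: y_def)
              then have "y \<le> y ^ 4 / r i ^ 3" using r[of i] by (simp add: field_simps power4_eq_xxxx power3_eq_cube)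
              then show ?thesis using r[of i] by linarith
            qed
            also have "y ^ 4 \<le> (\<Sum>j<2^i. exp (4 * \<mu> i * \<bar>\<Delta> i j \<omega>\<bar>))" unfolding y4
              using j(1) by (intro member_le_sum) auto
            finally show "exp (\<mu> i * m i) \<le> S i \<omega>" unfolding S_def y_def using r[of i] by (simp add: divide_right_mono)
          qed (use p in \<open>auto simp: less_imp_le\<close>)
          finally show "exp (lam * \<bar>w (tt n j) \<omega>\<bar>) \<le> 1 + (\<Sum>i\<in>{..n}. p i * S i \<omega>)" .
        qed
        show ?case
        proof
          fix t assume t: "t \<in> {0..L}"
          \<comment> \<open>The grid point of level \<open>n\<close> at or just below
            \<open>t\<close>; continuity of the path carries the bound from dyadic points to all
            times.\<close>
          define j where "j n = nat \<lfloor>t * 2 ^ n / L\<rfloor>" for n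
          have rj: "real (j n) = of_int \<lfloor>t * 2 ^ n / L\<rfloor>" for n using t L by (simp add: j_def)
          have j: "j n \<le> 2 ^ n" for n
          proof -
            have "t * 2 ^ n / L \<le> 2 ^ n" using t L by (simp add: field_simps)
            then have "real (j n) \<le> real (2 ^ n)" unfolding rj using of_int_floor_le[of "t * 2 ^ n / L"] by (simp only: of_nat_power of_nat_numeral)
            then show ?thesis by (simp only: of_nat_le_iff)
          qed
          have close: "\<bar>tt n (j n) - t\<bar> \<le> L * (1/2) ^ n" for n
          proof -
            have "\<bar>of_int \<lfloor>t * 2 ^ n / L\<rfloor> - t * 2 ^ n / L\<bar> \<le> 1" by linarith
            then have "\<bar>of_int \<lfloor>t * 2 ^ n / L\<rfloor> - t * 2 ^ n / L\<bar> * (L / 2 ^ n) \<le> 1 * (L / 2 ^ n)" using L by (intro mult_right_mono) auto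
            also have "\<bar>of_int \<lfloor>t * 2 ^ n / L\<rfloor> - t * 2 ^ n / L\<bar> * (L / 2 ^ n) = \<bar>(of_int \<lfloor>t * 2 ^ n / L\<rfloor> - t * 2 ^ n / L) * (L / 2 ^ n)\<bar>"
              using L by (simp add: abs_mult)
            also have "(of_int \<lfloor>t * 2 ^ n / L\<rfloor> - t * 2 ^ n / L) * (L / 2 ^ n) = tt n (j n) - t"
              unfolding tt_def rj using L by (simp add: field_simps)
            finally show ?thesis by (simp add: power_one_over)
          qed
          have "(\<lambda>n. L * (1/2) ^ n) \<longlonglongrightarrow> L * 0" by (intro tendsto_intros LIMSEQ_power_zero) auto
          then have "(\<lambda>n. tt n (j n) - t) \<longlonglongrightarrow> 0" by (intro Lim_null_comparison[of "\<lambda>n. tt n (j n) - t" "\<lambda>n. L * (1/2) ^ n"]) (use close in auto)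
          then have lim: "(\<lambda>n. tt n (j n)) \<longlonglongrightarrow> t" by (rule LIM_zero_cancel)
          have "(\<lambda>n. w (tt n (j n)) \<omega>) \<longlonglongrightarrow> w t \<omega>"
            by (rule continuous_on_tendsto_compose[OF cont lim]) (use t tt0 in auto)
          then have "(\<lambda>n. ennreal (exp (lam * \<bar>w (tt n (j n)) \<omega>\<bar>))) \<longlonglongrightarrow> ennreal (exp (lam * \<bar>w t \<omega>\<bar>))"
            by (intro tendsto_ennrealI tendsto_intros)
          then show "ennreal (exp (lam * \<bar>w t \<omega>\<bar>)) \<le> W \<omega>"
            by (rule LIMSEQ_le_const2) (use dy j in auto)
        qed
      qed
    qed
    ultimately show "\<exists>W\<in>borel_measurable P. (\<integral>\<^sup>+\<omega>. W \<omega> \<partial>P) \<le> ennreal C \<and>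
      (AE \<omega> in P. \<forall>t\<in>{0..L}. ennreal (exp (lam * \<bar>w t \<omega>\<bar>)) \<le> W \<omega>)" by blast
  qed
qed

section \<open>Exponential moments of the whole series\<close>

lemma nonzero_int_enum: obtains e :: "nat \<Rightarrow> int" where "bij_betw e UNIV (-{0})"
proof -
  have "infinite (-{0::int})" using infinite_UNIV_int by (simp add: Compl_eq_Diff_UNIV)
  then show thesis using that bij_betw_from_nat_into[of "-{0::int}"] by auto
qed

lemma summable_on_enum:
  assumes e: "bij_betw e (UNIV :: nat set) A" and f: "f summable_on A"
  shows "summable (\<lambda>n. \<bar>f (e n) :: real\<bar>)" "(\<lambda>n. f (e n)) sums (\<Sum>\<^sub>\<infinity>s\<in>A. f s)"
proof -
  have 1: "(\<lambda>n. f (e n)) summable_on UNIV" using f summable_on_reindex_bij_betw[OF e, of f] by simp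
  then have "(\<lambda>n. norm (f (e n))) summable_on UNIV" by (rule summable_on_iff_abs_summable_on_real[THEN iffD1])
  from summable_on_imp_summable[OF this] show "summable (\<lambda>n. \<bar>f (e n)\<bar>)" unfolding real_norm_def .
  have "((\<lambda>n. f (e n)) has_sum (\<Sum>\<^sub>\<infinity>n\<in>UNIV. f (e n))) UNIV" by (rule has_sum_infsum[OF 1])
  then show "(\<lambda>n. f (e n)) sums (\<Sum>\<^sub>\<infinity>s\<in>A. f s)"
    unfolding infsum_reindex_bij_betw[OF e, of f] by (rule has_sum_imp_sums)
qed

text \<open>Scaled by their total, the coefficients become the weights of a convex combination of
  the modes, so \<open>exp_sum_le\<close> bounds the exponential of the series by 1 plus a weighted
  sum of majorants with a common bound on their expectations. The majorant \<open>D\<close> does not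
  depend on \<open>t\<close>.\<close>

lemma noise_exp_bound:
  fixes P :: "'w measure" and \<beta> :: "int \<Rightarrow> real \<Rightarrow> 'w \<Rightarrow> real"
  assumes P: "prob_space P" and w: "\<And>s. s \<noteq> 0 \<Longrightarrow> standard_wiener P (\<beta> s)"
    and a: "\<And>s. a s \<ge> 0" "a summable_on (-{0})" and L: "L > 0" and lam: "lam > 0"
  shows "\<exists>D\<in>borel_measurable P. (\<integral>\<^sup>+\<omega>. D \<omega> \<partial>P) < \<infinity> \<and>
    (AE \<omega> in P. \<forall>t\<in>{0..L}. (\<lambda>s. a s * \<bar>\<beta> s t \<omega>\<bar>) summable_on (-{0}) \<and>
      ennreal (exp (lam * (\<Sum>\<^sub>\<infinity>s\<in>-{0}. a s * \<bar>\<beta> s t \<omega>\<bar>))) \<le> D \<omega>)"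
proof -
  interpret prob_space P by fact
  obtain e :: "nat \<Rightarrow> int" where e: "bij_betw e UNIV (-{0})" by (rule nonzero_int_enum)
  have e0: "e n \<noteq> 0" for n using e by (auto simp: bij_betw_def)
  have asum: "(\<lambda>n. a (e n)) sums (\<Sum>\<^sub>\<infinity>s\<in>-{0}. a s)" by (rule summable_on_enum(2)[OF e a(2)])
  \<comment> \<open>The added 1 keeps the divisor positive even if all coefficients vanish.\<close>
  define A where "A = 1 + (\<Sum>\<^sub>\<infinity>s\<in>-{0}. a s)"
  have A: "A \<ge> 1" unfolding A_def using a by (auto intro: infsum_nonneg)
  define p where "p n = a (e n) / A" for n
  have p0: "p n \<ge> 0" for n unfolding p_def using a A by simp
  have psums: "p sums ((A - 1) / A)" unfolding p_def using sums_divide[OF asum, of A] by (simp add: A_def)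
  have psum: "sum p {..<N} \<le> 1" for N
  proof -
    have "sum p {..<N} \<le> (A - 1) / A" using sum_le_suminf[OF sums_summable[OF psums], of "{..<N}"] p0 psums sums_unique by fastforce
    also have "\<dots> \<le> 1" using A by simp
    finally show ?thesis .
  qed
  have lA: "lam * A > 0" using lam A by simp
  from wiener_exp_bound[OF P L lA] obtain C where C: "C \<ge> 0" "\<forall>w. standard_wiener P w \<longrightarrow>
    (\<exists>W\<in>borel_measurable P. (\<integral>\<^sup>+\<omega>. W \<omega> \<partial>P) \<le> ennreal C \<and> (AE \<omega> in P. \<forall>t\<in>{0..L}. ennreal (exp (lam * A * \<bar>w t \<omega>\<bar>)) \<le> W \<omega>))"
    by (elim exE conjE)
  have "\<exists>W. \<forall>n. W n \<in> borel_measurable P \<and> (\<integral>\<^sup>+\<omega>. W n \<omega> \<partial>P) \<le> ennreal C \<and> (AE \<omega> in P. \<forall>t\<in>{0..L}. ennreal (exp (lam * A * \<bar>\<beta> (e n) t \<omega>\<bar>)) \<le> W n \<omega>)"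
    by (rule choice) (use C(2)[rule_format, OF w[OF e0]] in blast)
  then obtain W :: "nat \<Rightarrow> 'w \<Rightarrow> ennreal" where W: "\<And>n. W n \<in> borel_measurable P" "\<And>n. (\<integral>\<^sup>+\<omega>. W n \<omega> \<partial>P) \<le> ennreal C"
    "\<And>n. AE \<omega> in P. \<forall>t\<in>{0..L}. ennreal (exp (lam * A * \<bar>\<beta> (e n) t \<omega>\<bar>)) \<le> W n \<omega>" by blast
  note [measurable] = W(1)
  define D where "D \<omega> = 1 + (\<Sum>n. ennreal (p n) * W n \<omega>)" for \<omega>
  have Dm[measurable]: "D \<in> borel_measurable P" unfolding D_def by measurable
  have "(\<integral>\<^sup>+\<omega>. D \<omega> \<partial>P) = 1 + (\<Sum>n. ennreal (p n) * (\<integral>\<^sup>+\<omega>. W n \<omega> \<partial>P))"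
    unfolding D_def by (subst nn_integral_add, simp, simp, subst nn_integral_suminf, simp, subst nn_integral_cmult) (auto simp: emeasure_space_1)
  also have "\<dots> \<le> 1 + (\<Sum>n. ennreal (p n) * ennreal C)"
    by (intro add_left_mono suminf_le summableI mult_left_mono W) auto
  also have "(\<Sum>n. ennreal (p n) * ennreal C) = (\<Sum>n. ennreal (p n)) * ennreal C" by simp
  also have "(\<Sum>n. ennreal (p n)) = ennreal (\<Sum>n. p n)" by (rule suminf_ennreal2[OF p0 sums_summable[OF psums]])
  also have "1 + ennreal (\<Sum>n. p n) * ennreal C < \<infinity>" by (simp add: ennreal_mult_less_top ennreal_add_less_top)
  finally have Dfin: "(\<integral>\<^sup>+\<omega>. D \<omega> \<partial>P) < \<infinity>" .
  then have "AE \<omega> in P. D \<omega> \<noteq> \<infinity>" by (intro nn_integral_PInf_AE) auto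
  moreover have "AE \<omega> in P. \<forall>n. \<forall>t\<in>{0..L}. ennreal (exp (lam * A * \<bar>\<beta> (e n) t \<omega>\<bar>)) \<le> W n \<omega>"
    using W(3) by (simp add: AE_all_countable)
  ultimately have "AE \<omega> in P. \<forall>t\<in>{0..L}. (\<lambda>s. a s * \<bar>\<beta> s t \<omega>\<bar>) summable_on (-{0}) \<and>
      ennreal (exp (lam * (\<Sum>\<^sub>\<infinity>s\<in>-{0}. a s * \<bar>\<beta> s t \<omega>\<bar>))) \<le> D \<omega>"
  proof eventually_elim
    case (elim \<omega>)
    show ?case
    proof
      fix t assume t: "t \<in> {0..L}"
      define x where "x n = lam * A * \<bar>\<beta> (e n) t \<omega>\<bar>" for n
      have x0: "x n \<ge> 0" for n using lA by (simp add: x_def)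
      obtain d where d: "D \<omega> = ennreal d" "d \<ge> 0" using elim(1) by (cases "D \<omega>") auto
      have le: "exp (\<Sum>i<N. p i * x i) \<le> d" for N
      proof -
        have "exp (\<Sum>i<N. p i * x i) \<le> 1 + (\<Sum>i<N. p i * exp (x i))"
          by (rule exp_sum_le) (use p0 psum x0 in auto)
        then have "ennreal (exp (\<Sum>i<N. p i * x i)) \<le> ennreal (1 + (\<Sum>i<N. p i * exp (x i)))" by (rule ennreal_leI)
        also have "\<dots> = 1 + (\<Sum>i<N. ennreal (p i) * ennreal (exp (x i)))"
        proof -
          have "(\<Sum>i<N. ennreal (p i) * ennreal (exp (x i))) = (\<Sum>i<N. ennreal (p i * exp (x i)))"
            by (intro sum.cong refl ennreal_mult'[symmetric] p0)
          also have "\<dots> = ennreal (\<Sum>i<N. p i * exp (x i))" by (rule sum_ennreal) (simp add: p0)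
          finally show ?thesis using p0 by (simp add: ennreal_plus sum_nonneg)
        qed
        also have "\<dots> \<le> 1 + (\<Sum>i<N. ennreal (p i) * W i \<omega>)"
          using elim(2) t by (intro add_left_mono sum_mono mult_left_mono) (auto simp: x_def)
        also have "\<dots> \<le> D \<omega>" unfolding D_def by (intro add_left_mono sum_le_suminf) auto
        finally show ?thesis using d by simp
      qed
      have px: "p n * x n = lam * (a (e n) * \<bar>\<beta> (e n) t \<omega>\<bar>)" for n using A by (simp add: p_def x_def)
      have "d > 0" using le[of 0] by simp
      \<comment> \<open>Convergence is a by-product of the estimate: the partial sums stay below the
        logarithm of the finite majorant.\<close>
      have sm: "summable (\<lambda>n. p n * x n)"
      proof (rule bounded_imp_summable[where B = "ln d"])
        show "0 \<le> p n * x n" for n using p0 x0 by simp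
        fix N
        have "(\<Sum>k\<le>N. p k * x k) = (\<Sum>i<Suc N. p i * x i)" by (simp add: lessThan_Suc_atMost)
        also have "\<dots> \<le> ln d" using le[of "Suc N"] \<open>d > 0\<close> by (simp only: ln_ge_iff)
        finally show "(\<Sum>k\<le>N. p k * x k) \<le> ln d" .
      qed
      then have sm1: "summable (\<lambda>n. a (e n) * \<bar>\<beta> (e n) t \<omega>\<bar>)" unfolding px using lam by (simp add: summable_cmult_iff)
      then have hs: "((\<lambda>n. a (e n) * \<bar>\<beta> (e n) t \<omega>\<bar>) has_sum (\<Sum>n. a (e n) * \<bar>\<beta> (e n) t \<omega>\<bar>)) UNIV"
        by (intro sums_nonneg_imp_has_sum summable_sums) (use a in auto)
      then have "(\<lambda>n. a (e n) * \<bar>\<beta> (e n) t \<omega>\<bar>) summable_on UNIV" by (auto simp: summable_on_def)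
      then have s1: "(\<lambda>s. a s * \<bar>\<beta> s t \<omega>\<bar>) summable_on (-{0})"
        using summable_on_reindex_bij_betw[OF e, of "\<lambda>s. a s * \<bar>\<beta> s t \<omega>\<bar>"] by simp
      have "(\<Sum>\<^sub>\<infinity>s\<in>-{0}. a s * \<bar>\<beta> s t \<omega>\<bar>) = (\<Sum>n. a (e n) * \<bar>\<beta> (e n) t \<omega>\<bar>)"
        using infsum_reindex_bij_betw[OF e, of "\<lambda>s. a s * \<bar>\<beta> s t \<omega>\<bar>"] infsumI[OF hs] by simp
      then have "lam * (\<Sum>\<^sub>\<infinity>s\<in>-{0}. a s * \<bar>\<beta> s t \<omega>\<bar>) = (\<Sum>n. p n * x n)"
        unfolding px using suminf_mult[OF sm1, of lam] by simp
      also have "\<dots> \<le> ln d"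
        using sm le \<open>d > 0\<close> by (intro suminf_le_const) (auto simp: ln_ge_iff)
      finally have "exp (lam * (\<Sum>\<^sub>\<infinity>s\<in>-{0}. a s * \<bar>\<beta> s t \<omega>\<bar>)) \<le> d" using \<open>d > 0\<close> by (simp add: ln_ge_iff)
      then show "(\<lambda>s. a s * \<bar>\<beta> s t \<omega>\<bar>) summable_on (-{0}) \<and> ennreal (exp (lam * (\<Sum>\<^sub>\<infinity>s\<in>-{0}. a s * \<bar>\<beta> s t \<omega>\<bar>))) \<le> D \<omega>"
        using s1 d by (simp add: ennreal_leI)
    qed
  qed
  then show ?thesis using Dfin Dm by blast
qed

section \<open>Trigonometric series\<close>

definition tser :: "(int \<Rightarrow> real) \<Rightarrow> real \<Rightarrow> real" where
  "tser c x = (\<Sum>\<^sub>\<infinity>s\<in>-{0}. c s * trig_basis s x)"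

text \<open>Differentiation exchanges the sine and the cosine of the same frequency.\<close>

definition tder :: "(int \<Rightarrow> real) \<Rightarrow> int \<Rightarrow> real" where
  "tder c s = 2 * pi * of_int s * c (- s)"

lemma trig_basis_le: "\<bar>trig_basis s x\<bar> \<le> sqrt 2"
  unfolding trig_basis_def by (auto simp: abs_mult intro!: mult_left_le)

lemma trig_basis_per: "per (trig_basis s)"
proof -
  have "cos (2 * pi * of_int n * (x + 1)) = cos (2 * pi * of_int n * x)" "sin (2 * pi * of_int n * (x + 1)) = sin (2 * pi * of_int n * x)" for n :: int and x :: real
  proof -
    have "2 * pi * of_int n * (x + 1) = 2 * pi * of_int n * x + 2 * pi * of_int n" by (simp add: algebra_simps)
    then show "cos (2 * pi * of_int n * (x + 1)) = cos (2 * pi * of_int n * x)" "sin (2 * pi * of_int n * (x + 1)) = sin (2 * pi * of_int n * x)"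
      by (simp_all only: cos_add sin_add cos_int_2pin sin_int_2pin)
  qed
  from this this[of "-s"] show ?thesis unfolding per_def trig_basis_def by auto
qed

lemma trig_basis_deriv: "s \<noteq> 0 \<Longrightarrow> (trig_basis s has_real_derivative (- (2 * pi * of_int s) * trig_basis (- s) x)) (at x)"
  unfolding trig_basis_def[abs_def] by (cases "s > 0") (auto intro!: derivative_eq_intros)

lemma trig_basis_cont: "continuous_on UNIV (trig_basis s)"
  unfolding trig_basis_def[abs_def] by (cases "s > 0") (auto intro!: continuous_intros)

lemma trig_basis_ac: "s \<noteq> 0 \<Longrightarrow> ac (trig_basis s) (\<lambda>x. - (2 * pi * of_int s) * trig_basis (- s) x)"
  by (intro ac_C1 trig_basis_per trig_basis_deriv continuous_intros trig_basis_cont)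

lemma abs_summable_trig:
  assumes "(\<lambda>s. \<bar>c s\<bar>) summable_on (-{0})"
  shows "(\<lambda>s. c s * trig_basis s x) summable_on (-{0})" "\<bar>tser c x\<bar> \<le> sqrt 2 * (\<Sum>\<^sub>\<infinity>s\<in>-{0}. \<bar>c s\<bar>)"
proof -
  have le: "norm (c s * trig_basis s x) \<le> \<bar>c s\<bar> * sqrt 2" for s
    using trig_basis_le[of s x] by (simp add: abs_mult mult_left_mono)
  have s1: "(\<lambda>s. \<bar>c s\<bar> * sqrt 2) summable_on (-{0})" by (intro summable_on_cmult_left assms)
  have abs: "(\<lambda>s. norm (c s * trig_basis s x)) summable_on (-{0})"
    by (rule summable_on_comparison_test[OF s1]) (use le in auto)
  then show "(\<lambda>s. c s * trig_basis s x) summable_on (-{0})" by (rule abs_summable_summable)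
  have "\<bar>tser c x\<bar> \<le> (\<Sum>\<^sub>\<infinity>s\<in>-{0}. norm (c s * trig_basis s x))"
    unfolding tser_def real_norm_def[symmetric] using norm_infsum_bound[OF abs] by simp
  also have "\<dots> \<le> (\<Sum>\<^sub>\<infinity>s\<in>-{0}. \<bar>c s\<bar> * sqrt 2)" by (intro infsum_mono abs s1 le)
  also have "\<dots> = sqrt 2 * (\<Sum>\<^sub>\<infinity>s\<in>-{0}. \<bar>c s\<bar>)" by (simp add: infsum_cmult_left' mult.commute)
  finally show "\<bar>tser c x\<bar> \<le> sqrt 2 * (\<Sum>\<^sub>\<infinity>s\<in>-{0}. \<bar>c s\<bar>)" .
qed

lemma tser_ac:
  assumes c: "(\<lambda>s. \<bar>of_int s\<bar> * \<bar>c s\<bar>) summable_on (-{0})"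
  shows "ac (tser c) (tser (tder c))"
proof -
  obtain e :: "nat \<Rightarrow> int" where e: "bij_betw e UNIV (-{0})" by (rule nonzero_int_enum)
  have e0: "e n \<noteq> 0" for n using e by (auto simp: bij_betw_def)
  have c0: "(\<lambda>s. \<bar>c s\<bar>) summable_on (-{0})"
  proof (rule summable_on_comparison_test[OF c])
    fix s :: int assume "s \<in> -{0}"
    then have "1 \<le> \<bar>real_of_int s\<bar>" by auto
    then show "\<bar>c s\<bar> \<le> \<bar>of_int s\<bar> * \<bar>c s\<bar>" using mult_right_mono[of 1 "\<bar>real_of_int s\<bar>" "\<bar>c s\<bar>"] by simp
  qed auto
  define F where "F n x = c (e n) * trig_basis (e n) x" for n x
  define F' where "F' n x = c (e n) * (- (2 * pi * of_int (e n)) * trig_basis (- e n) x)" for n x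
  have bd: "norm (F' n x) \<le> (2 * pi * sqrt 2) * \<bar>\<bar>of_int (e n)\<bar> * \<bar>c (e n)\<bar>\<bar>" for n x
  proof -
    have "norm (F' n x) = (2 * pi * \<bar>of_int (e n)\<bar> * \<bar>c (e n)\<bar>) * \<bar>trig_basis (- e n) x\<bar>" by (simp add: F'_def abs_mult)
    also have "\<dots> \<le> (2 * pi * \<bar>of_int (e n)\<bar> * \<bar>c (e n)\<bar>) * sqrt 2" by (intro mult_left_mono trig_basis_le) auto
    finally show ?thesis by (simp add: abs_mult mult_ac)
  qed
  have sm: "summable (\<lambda>n. (2 * pi * sqrt 2) * \<bar>\<bar>of_int (e n)\<bar> * \<bar>c (e n)\<bar>\<bar>)"
    by (rule summable_mult[OF summable_on_enum(1)[OF e c]])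
  have uc: "uniformly_convergent_on UNIV (\<lambda>n x. \<Sum>i<n. F' i x)"
    by (rule Weierstrass_m_test'[OF _ sm]) (use bd in auto)
  have Fs: "(\<lambda>n. F n x) sums tser c x" for x
    unfolding F_def tser_def by (rule summable_on_enum(2)[OF e abs_summable_trig(1)[OF c0]])
  have dF: "(F n has_real_derivative F' n x) (at x within UNIV)" for n x
    unfolding F_def[abs_def] F'_def using trig_basis_deriv[OF e0[of n], of x] by (auto intro!: derivative_eq_intros)
  have d: "((\<lambda>x. \<Sum>n. F n x) has_real_derivative (\<Sum>n. F' n x)) (at x)" for x
    by (rule has_field_derivative_series'(2)[OF convex_UNIV dF uc UNIV_I sums_summable[OF Fs]]) simp
  have t0: "(\<lambda>x. \<Sum>n. F n x) = tser c" by (rule ext) (rule sums_unique[OF Fs, symmetric])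
  \<comment> \<open>Mode \<open>e n\<close> differentiates into mode \<open>- e n\<close>, so the
    sum is identified along the enumeration \<open>\<lambda>n. - e n\<close>.\<close>
  have t1: "(\<lambda>x. \<Sum>n. F' n x) = tser (tder c)"
  proof
    fix x
    have bij: "bij_betw uminus (-{0::int}) (-{0})" by (rule bij_betwI[of _ _ _ uminus]) auto
    have bij': "bij_betw (\<lambda>n. - e n) UNIV (-{0})" using bij_betw_trans[OF e bij] by (simp add: o_def)
    have s1: "(\<lambda>s. \<bar>tder c s\<bar>) summable_on (-{0})"
    proof -
      have "(\<lambda>s. \<bar>of_int (-s)\<bar> * \<bar>c (-s)\<bar>) summable_on (-{0})"
        using summable_on_reindex_bij_betw[OF bij, of "\<lambda>s. \<bar>of_int s\<bar> * \<bar>c s\<bar>"] c by blast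
      from summable_on_cmult_right[OF this, of "2 * pi"] show ?thesis by (simp add: tder_def abs_mult mult_ac)
    qed
    have "(\<lambda>n. tder c (- e n) * trig_basis (- e n) x) sums tser (tder c) x"
      unfolding tser_def by (rule summable_on_enum(2)[OF bij' abs_summable_trig(1)[OF s1]])
    moreover have "tder c (- e n) * trig_basis (- e n) x = F' n x" for n by (simp add: tder_def F'_def)
    ultimately have "(\<lambda>n. F' n x) sums tser (tder c) x" by simp
    then show "(\<Sum>n. F' n x) = tser (tder c) x" by (rule sums_unique[symmetric])
  qed
  have p: "per (tser c)" using trig_basis_per unfolding per_def tser_def by simp
  have cont: "continuous_on UNIV (\<lambda>x. \<Sum>n. F' n x)"
  proof (rule uniform_limit_theorem[OF _ uniform_limit_suminf[OF uc]])
    show "\<forall>\<^sub>F n in sequentially. continuous_on UNIV (\<lambda>x. \<Sum>i<n. F' i x)"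
      unfolding F'_def by (intro always_eventually allI continuous_intros continuous_on_subset[OF trig_basis_cont]) auto
  qed simp
  show ?thesis by (rule ac_C1[OF p d[unfolded t0 fun_cong[OF t1]] cont[unfolded t1]])
qed

section \<open>A variation bound uniform in the viscosity\<close>

lemma inverse_square_int_summable: "(\<lambda>s. 1 / (of_int s)\<^sup>2 :: real) summable_on (-{0})"
proof -
  define f where "f s = 1 / (of_int s :: real)\<^sup>2" for s :: int
  have 1: "(\<lambda>n. 1 / (real n)\<^sup>2) summable_on UNIV"
  proof (rule norm_summable_imp_summable_on)
    have "summable (\<lambda>n. inverse ((real n) ^ 2))" by (rule inverse_power_summable) simp
    then show "summable (\<lambda>n. norm (1 / (real n)\<^sup>2))" by (simp add: divide_inverse)
  qed
  have "f summable_on range int" "f summable_on range (\<lambda>n. - int n)"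
    using 1 by (subst summable_on_reindex; simp add: inj_on_def f_def o_def)+
  then have "f summable_on (range int \<union> range (\<lambda>n. - int n))" by (rule summable_on_union)
  then have "f summable_on (-{0})"
  proof (rule summable_on_subset_banach)
    show "- {0} \<subseteq> range int \<union> range (\<lambda>n. - int n)"
    proof
      fix s :: int
      show "s \<in> range int \<union> range (\<lambda>n. - int n)" by (cases s rule: int_cases2) auto
    qed
  qed
  then show ?thesis unfolding f_def .
qed

section \<open>Weighted coefficient sums and regularity of the force\<close>

text \<open>The factor 2 pi makes \<open>tder\<close> raise \<open>k\<close> by exactly one
  (\<open>tder_wsum\<close>).\<close>

definition wsum :: "nat \<Rightarrow> (int \<Rightarrow> real) \<Rightarrow> real" where
  "wsum k c = (\<Sum>\<^sub>\<infinity>s\<in>-{0}. (2 * pi * \<bar>of_int s\<bar>) ^ k * \<bar>c s\<bar>)"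

definition wsummable :: "nat \<Rightarrow> (int \<Rightarrow> real) \<Rightarrow> bool" where
  "wsummable k c \<longleftrightarrow> (\<lambda>s. (2 * pi * \<bar>of_int s\<bar>) ^ k * \<bar>c s\<bar>) summable_on (-{0})"

lemma tder_wsum: "wsummable k (tder c) \<longleftrightarrow> wsummable (Suc k) c" "wsum k (tder c) = wsum (Suc k) c"
proof -
  have bij: "bij_betw uminus (-{0::int}) (-{0})" by (rule bij_betwI[of _ _ _ uminus]) auto
  let ?f = "\<lambda>s. (2 * pi * \<bar>of_int s\<bar>) ^ Suc k * \<bar>c s\<bar>"
  have eq: "(\<lambda>s. (2 * pi * \<bar>of_int s\<bar>) ^ k * \<bar>tder c s\<bar>) = (\<lambda>s. ?f (- s))"
    by (simp add: tder_def abs_mult fun_eq_iff)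
  show "wsummable k (tder c) \<longleftrightarrow> wsummable (Suc k) c"
    unfolding wsummable_def eq by (rule summable_on_reindex_bij_betw[OF bij])
  show "wsum k (tder c) = wsum (Suc k) c"
    unfolding wsum_def eq by (rule infsum_reindex_bij_betw[OF bij])
qed

lemma wsum_mono: assumes "wsummable m c" "k \<le> m" shows "wsummable k c" "wsum k c \<le> wsum m c"
proof -
  have le: "(2 * pi * \<bar>of_int s\<bar>) ^ k * \<bar>c s\<bar> \<le> (2 * pi * \<bar>of_int s\<bar>) ^ m * \<bar>c s\<bar>" if "s \<in> -{0}" for s
  proof (intro mult_right_mono power_increasing assms)
    have "1 \<le> \<bar>real_of_int s\<bar>" using that by auto
    moreover have "1 \<le> 2 * pi" using pi_gt3 by linarith
    ultimately show "1 \<le> 2 * pi * \<bar>real_of_int s\<bar>" using mult_mono[of 1 "2 * pi" 1 "\<bar>real_of_int s\<bar>"] by simp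
  qed auto
  show 1: "wsummable k c" unfolding wsummable_def
    by (rule summable_on_comparison_test[OF assms(1)[unfolded wsummable_def] le]) auto
  show "wsum k c \<le> wsum m c" unfolding wsum_def
    by (rule infsum_mono[OF 1[unfolded wsummable_def] assms(1)[unfolded wsummable_def] le])
qed

lemma wsummable_ac: assumes "wsummable (Suc 0) c" shows "ac (tser c) (tser (tder c))"
proof (rule tser_ac)
  show "(\<lambda>s. \<bar>of_int s\<bar> * \<bar>c s\<bar>) summable_on (-{0})"
    using summable_on_cmult_right[OF assms[unfolded wsummable_def], of "1 / (2 * pi)"] by (simp add: mult.assoc)
qed

lemma wsummable_bound: assumes "wsummable 0 c" shows "\<bar>tser c x\<bar> \<le> sqrt 2 * wsum 0 c"
  using abs_summable_trig(2)[of c x] assms by (simp add: wsummable_def wsum_def)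

lemma tser_smooth:
  assumes c: "wsummable 3 c" and G: "sqrt 2 * wsum 3 c \<le> G"
  shows "ac (tser c) (tser (tder c))" "ac (tser (tder c)) (tser (tder (tder c)))"
    "ac (tser (tder (tder c))) (tser (tder (tder (tder c))))"
    "\<bar>tser (tder c) x\<bar> \<le> G" "\<bar>tser (tder (tder c)) x\<bar> \<le> G" "\<bar>tser (tder (tder (tder c))) x\<bar> \<le> G"
proof -
  have w: "wsummable k c" "sqrt 2 * wsum k c \<le> G" if "k \<le> 3" for k
    using wsum_mono[OF c that] G by (auto intro: order_trans[OF mult_left_mono])
  show "ac (tser c) (tser (tder c))" "ac (tser (tder c)) (tser (tder (tder c)))"
    "ac (tser (tder (tder c))) (tser (tder (tder (tder c))))"
    by (intro wsummable_ac; simp add: tder_wsum w)+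
  show "\<bar>tser (tder c) x\<bar> \<le> G" "\<bar>tser (tder (tder c)) x\<bar> \<le> G" "\<bar>tser (tder (tder (tder c))) x\<bar> \<le> G"
    by (rule order_trans[OF wsummable_bound]; simp add: tder_wsum w)+
qed

text \<open>Three derivatives come from \<open>B_finite b 4\<close>: |s|^3 |b s| is the product of
  the square summable sequences |s|^4 |b s| and 1 / |s|.\<close>

lemma wsummable_3: assumes "B_finite b 4" shows "wsummable 3 b"
  unfolding wsummable_def
proof (rule summable_on_comparison_test)
  show "(\<lambda>s. (2 * pi) ^ 3 * (\<bar>of_int s\<bar> ^ (2 * 4) * (b s)\<^sup>2 + 1 / (of_int s)\<^sup>2)) summable_on (-{0})"
    by (intro summable_on_cmult_right summable_on_add inverse_square_int_summable assms[unfolded B_finite_def])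
  fix s :: int assume s: "s \<in> -{0}"
  define x where "x = \<bar>real_of_int s\<bar>"
  have x: "x > 0" using s by (simp add: x_def)
  have "0 \<le> (x ^ 4 * \<bar>b s\<bar> - 1 / x)\<^sup>2" by simp
  also have "\<dots> = x ^ 8 * (b s)\<^sup>2 + 1 / x\<^sup>2 - 2 * (x ^ 3 * \<bar>b s\<bar>)"
    using x by (simp add: power2_diff power_mult_distrib power_divide power_mult[symmetric] field_simps eval_nat_numeral)
  finally have "2 * (x ^ 3 * \<bar>b s\<bar>) \<le> x ^ 8 * (b s)\<^sup>2 + 1 / x\<^sup>2" by simp
  moreover have "0 \<le> x ^ 3 * \<bar>b s\<bar>" using x by simp
  ultimately have "x ^ 3 * \<bar>b s\<bar> \<le> x ^ 8 * (b s)\<^sup>2 + 1 / x\<^sup>2" by linarith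
  then have "(2 * pi) ^ 3 * (x ^ 3 * \<bar>b s\<bar>) \<le> (2 * pi) ^ 3 * (x ^ 8 * (b s)\<^sup>2 + 1 / x\<^sup>2)" by (intro mult_left_mono) auto
  then show "(2 * pi * \<bar>of_int s\<bar>) ^ 3 * \<bar>b s\<bar> \<le> (2 * pi) ^ 3 * (\<bar>of_int s\<bar> ^ (2 * 4) * (b s)\<^sup>2 + 1 / (of_int s)\<^sup>2)"
    by (simp add: x_def power_mult_distrib mult.assoc)
qed auto

text \<open>Absorbs the powers of \<open>G\<close> into an exponential with exponent linear in
  \<open>G\<close>, the form covered by \<open>noise_exp_bound\<close>. The square is taken because
  squared Fourier coefficients are averaged.\<close>

lemma variation_bound_exp:
  fixes G L y :: real
  assumes "G \<ge> 0" "L \<ge> 0" "y \<ge> 0"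
  shows "(2 powr (4 * (G + 1) * L + 1) * (y + 2 * G + 1) + G)\<^sup>2 \<le> (exp (4 * L + 1) * (y + 4))\<^sup>2 * exp (2 * (4 * L + 1) * G)"
proof -
  define E where "E = exp (4 * L + 1) * exp ((4 * L + 1) * G)"
  have eG: "G \<le> exp G" "1 \<le> exp G" using exp_ge_add_one_self[of G] assms by linarith+
  have p: "2 powr (4 * (G + 1) * L + 1) \<le> exp (4 * (G + 1) * L + 1)"
    unfolding powr_def using assms ln_2_less_1 by (simp add: mult_left_le)
  have "2 powr (4 * (G + 1) * L + 1) * (y + 2 * G + 1) \<le> exp (4 * (G + 1) * L + 1) * ((y + 3) * exp G)"
  proof (intro mult_mono p)
    have "y * 1 \<le> y * exp G" using eG assms by (intro mult_left_mono) auto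
    then show "y + 2 * G + 1 \<le> (y + 3) * exp G" unfolding distrib_right using eG by linarith
  qed (use assms in auto)
  also have "\<dots> = (y + 3) * E"
  proof -
    have "exp (4 * (G + 1) * L + 1) * exp G = E"
      unfolding E_def exp_add[symmetric] by (simp add: algebra_simps)
    then show ?thesis by (metis mult.left_commute)
  qed
  finally have 1: "2 powr (4 * (G + 1) * L + 1) * (y + 2 * G + 1) \<le> (y + 3) * E" .
  have "exp G \<le> E" unfolding E_def exp_add[symmetric] using assms by (simp add: algebra_simps)
  then have "2 powr (4 * (G + 1) * L + 1) * (y + 2 * G + 1) + G \<le> (y + 4) * E" using 1 eG unfolding distrib_right by linarith
  then have "(2 powr (4 * (G + 1) * L + 1) * (y + 2 * G + 1) + G)\<^sup>2 \<le> ((y + 4) * E)\<^sup>2"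
    using assms by (intro power_mono) auto
  also have "\<dots> = (exp (4 * L + 1) * (y + 4))\<^sup>2 * exp (2 * (4 * L + 1) * G)"
    unfolding E_def power_mult_distrib exp_double[symmetric] by (simp add: mult_ac)
  finally show ?thesis .
qed

text \<open>One integrable majorant serves all viscosities, since \<open>variation_bound\<close> and
  the force are independent of \<nu>; only the exceptional null set may vary with \<nu>.\<close>

lemma solution_variation_bound:
  fixes P :: "'w measure"
  assumes P: "prob_space P" and \<beta>: "independent_wieners P \<beta>" and b: "B_finite b 4"
    and u0: "u0 \<in> H1_space"
    and u: "\<And>\<nu>. \<nu> \<in> {0<..1} \<Longrightarrow> burgers_solution P b \<beta> \<nu> u0 (u \<nu>)" and L: "L > 0"
  shows "\<exists>D\<in>borel_measurable P. (\<integral>\<^sup>+\<omega>. D \<omega> \<partial>P) < \<infinity> \<and>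
    (\<forall>\<nu>\<in>{0<..1}. AE \<omega> in P. \<forall>t\<in>{0..L}. ennreal ((integral {0..1} (\<lambda>x. \<bar>dx (u \<nu> t \<omega>) x\<bar>))\<^sup>2) \<le> D \<omega>)"
proof -
  have w: "standard_wiener P (\<beta> s)" if "s \<noteq> 0" for s using \<beta> that by (auto simp: independent_wieners_def)
  \<comment> \<open>The resulting series bounds the third derivative of the force, with sqrt 2 for
    the size of the basis functions; lower derivatives have smaller weights by
    \<open>wsum_mono\<close>.\<close>
  define a where "a s = sqrt 2 * ((2 * pi * \<bar>of_int s\<bar>) ^ 3 * \<bar>b s\<bar>)" for s :: int
  have a: "a s \<ge> 0" "a summable_on (-{0})" for s
    using summable_on_cmult_right[OF wsummable_3[OF b, unfolded wsummable_def], of "sqrt 2"] by (auto simp: a_def[abs_def])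
  define lam where "lam = 2 * (4 * L + 1)"
  have lam: "lam > 0" using L by (simp add: lam_def)
  define y where "y = integral {0..1} (\<lambda>x. \<bar>dx u0 x\<bar>)"
  have y: "y \<ge> 0" unfolding y_def
    by (intro integral_nonneg L1pD(5) L2p_L1p H_spaceD(1)[OF H1_space_ac(2)[OF u0]]) auto
  define A where "A = (exp (4 * L + 1) * (y + 4))\<^sup>2"
  have "\<exists>D\<in>borel_measurable P. (\<integral>\<^sup>+\<omega>. D \<omega> \<partial>P) < \<infinity> \<and>
    (AE \<omega> in P. \<forall>t\<in>{0..L}. (\<lambda>s. a s * \<bar>\<beta> s t \<omega>\<bar>) summable_on (-{0}) \<and>
      ennreal (exp (lam * (\<Sum>\<^sub>\<infinity>s\<in>-{0}. a s * \<bar>\<beta> s t \<omega>\<bar>))) \<le> D \<omega>)"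
    by (rule noise_exp_bound[OF P _ a L lam]) (rule w)
  then obtain D where D: "D \<in> borel_measurable P" "(\<integral>\<^sup>+\<omega>. D \<omega> \<partial>P) < \<infinity>"
    "AE \<omega> in P. \<forall>t\<in>{0..L}. (\<lambda>s. a s * \<bar>\<beta> s t \<omega>\<bar>) summable_on (-{0}) \<and>
      ennreal (exp (lam * (\<Sum>\<^sub>\<infinity>s\<in>-{0}. a s * \<bar>\<beta> s t \<omega>\<bar>))) \<le> D \<omega>"
    by (elim bexE conjE)
  note [measurable] = D(1)
  show ?thesis
  proof (intro bexI[of _ "\<lambda>\<omega>. ennreal A * D \<omega>"] conjI ballI)
    show "(\<lambda>\<omega>. ennreal A * D \<omega>) \<in> borel_measurable P" by measurable
    have "(\<integral>\<^sup>+\<omega>. ennreal A * D \<omega> \<partial>P) = ennreal A * (\<integral>\<^sup>+\<omega>. D \<omega> \<partial>P)" by (rule nn_integral_cmult) simp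
    then show "(\<integral>\<^sup>+\<omega>. ennreal A * D \<omega> \<partial>P) < \<infinity>" using D(2) by (simp add: ennreal_mult_less_top)
    fix \<nu> :: real assume \<nu>: "\<nu> \<in> {0<..1}"
    have "AE \<omega> in P. \<beta> s 0 \<omega> = 0" if "s \<noteq> 0" for s using w[OF that] by (auto simp: standard_wiener_def)
    then have "AE \<omega> in P. \<forall>s. s \<noteq> 0 \<longrightarrow> \<beta> s 0 \<omega> = 0" by (subst AE_all_countable) auto
    moreover have "AE \<omega> in P. D \<omega> \<noteq> \<infinity>" using D(1,2) by (intro nn_integral_PInf_AE) auto
    moreover have "AE \<omega> in P. burgers_path \<nu> u0 (\<lambda>t. force b \<beta> t \<omega>) (\<lambda>t. u \<nu> t \<omega>)"
      using u[OF \<nu>] by (simp add: burgers_solution_def)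
    ultimately show "AE \<omega> in P. \<forall>t\<in>{0..L}. ennreal ((integral {0..1} (\<lambda>x. \<bar>dx (u \<nu> t \<omega>) x\<bar>))\<^sup>2) \<le> ennreal A * D \<omega>"
      using D(3)
    proof eventually_elim
      case (elim \<omega>)
      obtain d where d: "D \<omega> = ennreal d" "d \<ge> 0" using elim(2) by (cases "D \<omega>") auto
      define c where "c t s = b s * \<beta> s t \<omega>" for t s
      have eq: "a s * \<bar>\<beta> s t \<omega>\<bar> = sqrt 2 * ((2 * pi * \<bar>of_int s\<bar>) ^ 3 * \<bar>c t s\<bar>)" for s t
        by (simp add: a_def c_def abs_mult)
      have ws: "wsummable 3 (c t)" "exp (lam * (sqrt 2 * wsum 3 (c t))) \<le> d" if t: "t \<in> {0..L}" for t
      proof -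
        have "(\<lambda>s. a s * \<bar>\<beta> s t \<omega>\<bar>) summable_on (-{0})" using elim(4) t by blast
        from summable_on_cmult_right[OF this, of "1 / sqrt 2"] show "wsummable 3 (c t)"
          unfolding eq wsummable_def by simp
        have "(\<Sum>\<^sub>\<infinity>s\<in>-{0}. a s * \<bar>\<beta> s t \<omega>\<bar>) = sqrt 2 * wsum 3 (c t)"
          unfolding eq wsum_def by (rule infsum_cmult_right')
        moreover have "ennreal (exp (lam * (\<Sum>\<^sub>\<infinity>s\<in>-{0}. a s * \<bar>\<beta> s t \<omega>\<bar>))) \<le> ennreal d"
          using elim(4) t unfolding d(1) by blast
        ultimately show "exp (lam * (sqrt 2 * wsum 3 (c t))) \<le> d" using d(2) by (simp only: ennreal_le_iff)
      qed
      have w0: "wsum 3 (c t) \<ge> 0" for t unfolding wsum_def by (rule infsum_nonneg) auto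
      \<comment> \<open>\<open>G\<close> is read off from the majorant instead of being a supremum
        over uncountably many times, so no measurability question arises, and
        \<open>exp (lam * G)\<close> is exactly \<open>d\<close>.\<close>
      define G where "G = ln d / lam"
      have L0: "0 \<in> {0..L}" using L by simp
      have "1 \<le> exp (lam * (sqrt 2 * wsum 3 (c 0)))" using lam w0 by simp
      then have d1: "d \<ge> 1" using ws(2)[OF L0] by linarith
      have G0: "G \<ge> 0" unfolding G_def using d1 lam by simp
      have eG: "exp (lam * G) = d" unfolding G_def using d1 lam by simp
      have wG: "sqrt 2 * wsum 3 (c t) \<le> G" if "t \<in> {0..L}" for t
      proof -
        have "exp (lam * (sqrt 2 * wsum 3 (c t))) \<le> exp (lam * G)" using ws(2)[OF that] eG by simp
        then show ?thesis using lam by simp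
      qed
      have force: "force b \<beta> t \<omega> = tser (c t)" for t
        by (rule ext) (simp add: force_def tser_def c_def)
      interpret burgers_flow \<nu> u0 "\<lambda>t. force b \<beta> t \<omega>" "\<lambda>t. u \<nu> t \<omega>" "\<lambda>t. tser (tder (c t))" "\<lambda>t. tser (tder (tder (c t)))"
        "\<lambda>t. tser (tder (tder (tder (c t))))" G L
      proof
        show "burgers_path \<nu> u0 (\<lambda>t. force b \<beta> t \<omega>) (\<lambda>t. u \<nu> t \<omega>)" by fact
        show "0 < \<nu>" "\<nu> \<le> 1" "u0 \<in> H1_space" "0 \<le> L" using \<nu> u0 L by auto
        show "tser (tder (c 0)) x = 0" for x
          unfolding tser_def by (rule infsum_0) (use elim(1) in \<open>auto simp: tder_def c_def\<close>)
      next
        fix t assume t: "t \<in> {0..L}"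
        note smooth = tser_smooth[OF ws(1)[OF t] wG[OF t]]
        show "ac (force b \<beta> t \<omega>) (tser (tder (c t)))" unfolding force by (rule smooth(1))
        show "ac (tser (tder (c t))) (tser (tder (tder (c t))))" by (rule smooth(2))
        show "ac (tser (tder (tder (c t)))) (tser (tder (tder (tder (c t)))))" by (rule smooth(3))
        show "\<bar>tser (tder (c t)) x\<bar> \<le> G" "\<bar>tser (tder (tder (c t))) x\<bar> \<le> G" "\<bar>tser (tder (tder (tder (c t)))) x\<bar> \<le> G" for x
          by (rule smooth(4) smooth(5) smooth(6))+
      qed
      show ?case
      proof
        fix t assume t: "t \<in> {0..L}"
        have J0: "0 \<le> integral {0..1} (\<lambda>x. \<bar>dx (u \<nu> t \<omega>) x\<bar>)"
          using acD(10)[OF fg(1), of t] t by (intro integral_nonneg) (auto simp: g_def)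
        have "integral {0..1} (\<lambda>x. \<bar>dx (u \<nu> t \<omega>) x\<bar>) \<le> 2 powr (4 * (G + 1) * L + 1) * (y + 2 * G + 1) + G"
          using variation_bound[OF t] unfolding g_def y_def .
        then have "(integral {0..1} (\<lambda>x. \<bar>dx (u \<nu> t \<omega>) x\<bar>))\<^sup>2 \<le> (2 powr (4 * (G + 1) * L + 1) * (y + 2 * G + 1) + G)\<^sup>2"
          using J0 by (rule power_mono)
        also have "\<dots> \<le> A * exp (lam * G)"
          unfolding A_def lam_def using L by (intro variation_bound_exp G0 y) simp
        also have "\<dots> = A * d" by (simp add: eG)
        finally show "ennreal ((integral {0..1} (\<lambda>x. \<bar>dx (u \<nu> t \<omega>) x\<bar>))\<^sup>2) \<le> ennreal A * D \<omega>"
          unfolding d by (subst ennreal_mult'[symmetric]) (auto simp: A_def intro: ennreal_leI)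
      qed
    qed
  qed
qed

section \<open>Completeness of the trigonometric system\<close>

text \<open>Generated linearly from single frequencies, so that orthogonality extends to all members
  by induction; closure under products, which Stone-Weierstrass requires, is proved afterwards
  (\<open>tp_mult\<close>).\<close>

inductive trig_poly :: "(real \<Rightarrow> real) \<Rightarrow> bool" where
  tp_cos: "trig_poly (\<lambda>x. cos (2 * pi * of_int n * x))"
| tp_sin: "trig_poly (\<lambda>x. sin (2 * pi * of_int n * x))"
| tp_add: "trig_poly p \<Longrightarrow> trig_poly q \<Longrightarrow> trig_poly (\<lambda>x. p x + q x)"
| tp_scale: "trig_poly p \<Longrightarrow> trig_poly (\<lambda>x. c * p x)"

lemma tp_const: "trig_poly (\<lambda>x. c)"
  using tp_scale[OF tp_cos[of 0], of c] by simp

lemma tp_diff: "trig_poly p \<Longrightarrow> trig_poly q \<Longrightarrow> trig_poly (\<lambda>x. p x - q x)"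
  using tp_add[OF _ tp_scale[of q "-1"], of p] by simp

lemma tp_mult_basic:
  assumes q: "trig_poly q"
  shows "trig_poly (\<lambda>x. cos (2 * pi * of_int n * x) * q x)" "trig_poly (\<lambda>x. sin (2 * pi * of_int n * x) * q x)"
  using q
proof (induction q rule: trig_poly.induct)
  case (tp_cos m)
  have eqs: "(\<lambda>x. cos (2 * pi * of_int n * x) * cos (2 * pi * of_int m * x)) = (\<lambda>x. (1/2) * (cos (2 * pi * of_int (n - m) * x) + cos (2 * pi * of_int (n + m) * x)))"
    "(\<lambda>x. sin (2 * pi * of_int n * x) * cos (2 * pi * of_int m * x)) = (\<lambda>x. (1/2) * (sin (2 * pi * of_int (n + m) * x) + sin (2 * pi * of_int (n - m) * x)))"
    by (simp_all add: fun_eq_iff algebra_simps cos_add cos_diff sin_add sin_diff)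
  show "trig_poly (\<lambda>x. cos (2 * pi * of_int n * x) * cos (2 * pi * of_int m * x))" "trig_poly (\<lambda>x. sin (2 * pi * of_int n * x) * cos (2 * pi * of_int m * x))"
    unfolding eqs by (rule trig_poly.tp_scale[OF trig_poly.tp_add[OF trig_poly.tp_cos trig_poly.tp_cos]]
        trig_poly.tp_scale[OF trig_poly.tp_add[OF trig_poly.tp_sin trig_poly.tp_sin]])+
next
  case (tp_sin m)
  have eqs: "(\<lambda>x. cos (2 * pi * of_int n * x) * sin (2 * pi * of_int m * x)) = (\<lambda>x. (1/2) * (sin (2 * pi * of_int (n + m) * x) - sin (2 * pi * of_int (n - m) * x)))"
    "(\<lambda>x. sin (2 * pi * of_int n * x) * sin (2 * pi * of_int m * x)) = (\<lambda>x. (1/2) * (cos (2 * pi * of_int (n - m) * x) - cos (2 * pi * of_int (n + m) * x)))"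
    by (simp_all add: fun_eq_iff algebra_simps cos_add cos_diff sin_add sin_diff)
  show "trig_poly (\<lambda>x. cos (2 * pi * of_int n * x) * sin (2 * pi * of_int m * x))" "trig_poly (\<lambda>x. sin (2 * pi * of_int n * x) * sin (2 * pi * of_int m * x))"
    unfolding eqs by (rule trig_poly.tp_scale[OF tp_diff[OF trig_poly.tp_cos trig_poly.tp_cos]]
        trig_poly.tp_scale[OF tp_diff[OF trig_poly.tp_sin trig_poly.tp_sin]])+
next
  case (tp_add p q)
  show "trig_poly (\<lambda>x. cos (2 * pi * of_int n * x) * (p x + q x))" "trig_poly (\<lambda>x. sin (2 * pi * of_int n * x) * (p x + q x))"
    unfolding distrib_left by (intro trig_poly.tp_add tp_add.IH)+
next
  case (tp_scale p c)
  show "trig_poly (\<lambda>x. cos (2 * pi * of_int n * x) * (c * p x))" "trig_poly (\<lambda>x. sin (2 * pi * of_int n * x) * (c * p x))"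
    unfolding mult.left_commute[of _ c] by (intro trig_poly.tp_scale tp_scale.IH)+
qed

lemma tp_mult: assumes "trig_poly p" "trig_poly q" shows "trig_poly (\<lambda>x. p x * q x)"
  using assms(1)
proof (induction p rule: trig_poly.induct)
  case (tp_add p p')
  then show ?case unfolding distrib_right by (intro trig_poly.tp_add)
next
  case (tp_scale p c)
  then show ?case unfolding mult.assoc by (intro trig_poly.tp_scale)
qed (intro tp_mult_basic assms(2))+

lemma tp_cper: "trig_poly p \<Longrightarrow> cper p"
proof (induction p rule: trig_poly.induct)
  case (tp_cos n)
  have "cper (\<lambda>x. cos (2 * pi * of_int k * x))" if "k > 0" for k
    using cper_intros(4)[OF cper_intros(1)[of "1 / sqrt 2"], of "trig_basis k"] trig_basis_per[of k] trig_basis_cont[of k] that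
    by (simp add: cper_def trig_basis_def[abs_def])
  from this[of n] this[of "-n"] cper_intros(1)[of 1] show ?case by (cases n "0::int" rule: linorder_cases) auto
next
  case (tp_sin n)
  have *: "cper (\<lambda>x. sin (2 * pi * of_int k * x))" if "k > 0" for k
    using cper_intros(4)[OF cper_intros(1)[of "1 / sqrt 2"], of "trig_basis (-k)"] trig_basis_per[of "-k"] trig_basis_cont[of "-k"] that
    by (simp add: cper_def trig_basis_def[abs_def])
  from *[of n] cper_intros(5)[OF *[of "-n"]] cper_intros(1)[of 0] show ?case by (cases n "0::int" rule: linorder_cases) auto
qed (auto intro: cper_intros)

lemma per_cis_eq: assumes "per f" "cis (2 * pi * a) = cis (2 * pi * b)" shows "f a = f b"
proof -
  have "sin (2 * pi * a) = sin (2 * pi * b) \<and> cos (2 * pi * a) = cos (2 * pi * b)"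
    using assms(2) by (auto simp: complex_eq_iff)
  then obtain n :: int where "2 * pi * a = 2 * pi * b + 2 * pi * of_int n" unfolding sin_cos_eq_iff by blast
  then have "2 * pi * a = 2 * pi * (b + of_int n)" by (simp only: distrib_left)
  then have "a = b + of_int n" by simp
  then show ?thesis using per_int[OF assms(1)] by simp
qed

text \<open>A periodic function descends to the complex unit circle, which is compact; there the
  functions that pull back to trigonometric polynomials form an algebra, and real and imaginary
  parts separate points.\<close>

lemma trig_poly_dense: assumes f: "cper f" and e: "e > 0"
  shows "\<exists>p. trig_poly p \<and> (\<forall>x. \<bar>f x - p x\<bar> < e)"
proof -
  define S where "S = sphere (0::complex) 1"
  define F where "F w = f (Arg w / (2 * pi))" for w
  have ArgS: "cis (Arg w) = w" if "w \<in> S" for w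
  proof -
    have "cmod w = 1" "w \<noteq> 0" using that by (auto simp: S_def)
    then show ?thesis using cis_Arg[of w] by (simp add: sgn_div_norm)
  qed
  have Fc: "continuous_on S F"
    unfolding continuous_on_eq_continuous_within
  proof
    fix z assume z: "z \<in> S"
    then have z0: "z \<noteq> 0" by (auto simp: S_def)
    define x0 where "x0 = Arg z / (2 * pi)"
    \<comment> \<open>\<open>Arg\<close> jumps across the negative real axis. Measured relative to
      \<open>z\<close>, the angle is near 0 for \<open>w\<close> near \<open>z\<close>, and
      periodicity of \<open>f\<close> absorbs whole turns.\<close>
    have eq: "F w = f (x0 + Arg (w / z) / (2 * pi))" if "w \<in> S" for w
    proof -
      have wz: "w / z \<in> S" using that z by (simp add: S_def norm_divide)
      have "cis (2 * pi * (x0 + Arg (w / z) / (2 * pi))) = cis (Arg z + Arg (w / z))"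
      proof -
        have "2 * pi * (x0 + A / (2 * pi)) = Arg z + A" for A by (simp add: x0_def distrib_left)
        then show ?thesis by simp
      qed
      also have "\<dots> = z * (w / z)" using ArgS[OF z] ArgS[OF wz] by (simp only: cis_mult[symmetric])
      also have "\<dots> = cis (2 * pi * (Arg w / (2 * pi)))" using z0 ArgS[OF that] by simp
      finally show ?thesis unfolding F_def by (intro per_cis_eq[OF cperD(2)[OF f]]) simp
    qed
    have "isCont (\<lambda>w. w / z) z" using z0 by (intro continuous_intros)
    moreover have "isCont Arg (z / z)" using z0 continuous_at_Arg[of 1] by simp
    ultimately have "isCont (\<lambda>w. Arg (w / z)) z" by (rule isCont_o2)
    then have "isCont (\<lambda>w. x0 + Arg (w / z) / (2 * pi)) z" by (intro continuous_intros) auto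
    moreover have "isCont f (x0 + Arg (z / z) / (2 * pi))" using cperD(1)[OF f] by (simp add: continuous_on_eq_continuous_at)
    ultimately have "isCont (\<lambda>w. f (x0 + Arg (w / z) / (2 * pi))) z" by (rule isCont_o2)
    then have "continuous (at z within S) (\<lambda>w. f (x0 + Arg (w / z) / (2 * pi)))" by (rule continuous_at_imp_continuous_at_within)
    then show "continuous (at z within S) F"
      by (rule continuous_transform_within[OF _ zero_less_one z]) (use eq in auto)
  qed
  have "\<exists>g. (continuous_on S g \<and> trig_poly (\<lambda>x. g (cis (2 * pi * x)))) \<and> (\<forall>w\<in>S. \<bar>F w - g w\<bar> < e)"
  proof (rule Stone_Weierstrass_HOL[of S "\<lambda>g. continuous_on S g \<and> trig_poly (\<lambda>x. g (cis (2 * pi * x)))"])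
    show "compact S" by (simp add: S_def)
    show "continuous_on S F" by (rule Fc)
    show "\<exists>g. (continuous_on S g \<and> trig_poly (\<lambda>x. g (cis (2 * pi * x)))) \<and> g w \<noteq> g z" if "w \<in> S \<and> z \<in> S \<and> w \<noteq> z" for w z
    proof (cases "Re w = Re z")
      case True
      then have "Im w \<noteq> Im z" using that by (auto simp: complex_eq_iff)
      then show ?thesis using tp_sin[of 1] by (intro exI[of _ Im]) (auto intro!: continuous_intros)
    next
      case False
      then show ?thesis using tp_cos[of 1] by (intro exI[of _ Re]) (auto intro!: continuous_intros)
    qed
  qed (use e in \<open>auto intro!: continuous_intros tp_const tp_add tp_mult\<close>)
  then obtain g where g: "trig_poly (\<lambda>x. g (cis (2 * pi * x)))" "\<And>w. w \<in> S \<Longrightarrow> \<bar>F w - g w\<bar> < e" by blast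
  have "\<bar>f x - g (cis (2 * pi * x))\<bar> < e" for x
  proof -
    have s: "cis (2 * pi * x) \<in> S" by (simp add: S_def)
    have "F (cis (2 * pi * x)) = f x" unfolding F_def
      by (rule per_cis_eq[OF cperD(2)[OF f]]) (use ArgS[OF s] in simp)
    then show ?thesis using g(2)[OF s] by simp
  qed
  then show ?thesis using g(1) by blast
qed

lemma trig_basis_cper: "cper (trig_basis s)"
  by (simp add: cper_def trig_basis_per trig_basis_cont)

lemma integral_trig_basis: "s \<noteq> 0 \<Longrightarrow> integral {0..1} (trig_basis s) = 0"
  using ac_integral_0[OF trig_basis_ac[of "-s"]] by simp

lemma integral_cos_sin:
  "integral {0..1} (\<lambda>x. cos (2 * pi * of_int n * x)) = (if n = 0 then 1 else 0)"
  "integral {0..1} (\<lambda>x. sin (2 * pi * of_int n * x)) = 0"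
proof -
  have c: "integral {0..1} (\<lambda>x. cos (2 * pi * of_int n * x)) = 0" if "n > 0" for n
    using integral_trig_basis[of n] that by (simp add: trig_basis_def[abs_def])
  have s: "integral {0..1} (\<lambda>x. sin (2 * pi * of_int n * x)) = 0" if "n > 0" for n
    using integral_trig_basis[of "-n"] that by (simp add: trig_basis_def[abs_def])
  show "integral {0..1} (\<lambda>x. cos (2 * pi * of_int n * x)) = (if n = 0 then 1 else 0)"
    using c[of n] c[of "-n"] by (cases n "0::int" rule: linorder_cases) auto
  show "integral {0..1} (\<lambda>x. sin (2 * pi * of_int n * x)) = 0"
    using s[of n] s[of "-n"] by (cases n "0::int" rule: linorder_cases) auto
qed

lemma cos_sin_integrable: "(\<lambda>x. cos (2 * pi * of_int n * x)) integrable_on {0..1::real}" "(\<lambda>x. sin (2 * pi * of_int n * x)) integrable_on {0..1::real}"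
  by (rule L1pD(4)[OF cper_L1p[OF tp_cper[OF tp_cos]]] L1pD(4)[OF cper_L1p[OF tp_cper[OF tp_sin]]])+

lemma trig_basis_orthonormal:
  assumes "m \<noteq> 0" "n \<noteq> 0"
  shows "integral {0..1} (\<lambda>x. trig_basis m x * trig_basis n x) = (if m = n then 1 else 0)"
proof -
  have s2: "sqrt 2 * a * (sqrt 2 * b) = 2 * a * b" for a b :: real
  proof -
    have "sqrt 2 * a * (sqrt 2 * b) = (sqrt 2 * sqrt 2) * (a * b)" by (simp only: mult_ac)
    then show ?thesis by simp
  qed
  note I = hk_integral_add hk_integral_diff
  have cc: "integral {0..1} (\<lambda>x. 2 * cos (2 * pi * of_int m * x) * cos (2 * pi * of_int n * x)) = (if m = n then 1 else 0) + (if m = -n then 1 else 0)" for m n :: int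
  proof -
    have "(\<lambda>x. 2 * cos (2 * pi * of_int m * x) * cos (2 * pi * of_int n * x)) = (\<lambda>x. cos (2 * pi * of_int (m - n) * x) + cos (2 * pi * of_int (m + n) * x))"
      by (simp add: fun_eq_iff algebra_simps cos_add cos_diff)
    then show ?thesis by (simp add: I(1)[OF cos_sin_integrable(1) cos_sin_integrable(1)] integral_cos_sin del: of_int_add of_int_diff)
  qed
  have ss: "integral {0..1} (\<lambda>x. 2 * sin (2 * pi * of_int m * x) * sin (2 * pi * of_int n * x)) = (if m = n then 1 else 0) - (if m = -n then 1 else 0)" for m n :: int
  proof -
    have "(\<lambda>x. 2 * sin (2 * pi * of_int m * x) * sin (2 * pi * of_int n * x)) = (\<lambda>x. cos (2 * pi * of_int (m - n) * x) - cos (2 * pi * of_int (m + n) * x))"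
      by (simp add: fun_eq_iff algebra_simps cos_add cos_diff)
    then show ?thesis by (simp add: I(2)[OF cos_sin_integrable(1) cos_sin_integrable(1)] integral_cos_sin del: of_int_add of_int_diff)
  qed
  have sc: "integral {0..1} (\<lambda>x. 2 * sin (2 * pi * of_int m * x) * cos (2 * pi * of_int n * x)) = 0" for m n :: int
  proof -
    have "(\<lambda>x. 2 * sin (2 * pi * of_int m * x) * cos (2 * pi * of_int n * x)) = (\<lambda>x. sin (2 * pi * of_int (m + n) * x) + sin (2 * pi * of_int (m - n) * x))"
      by (simp add: fun_eq_iff algebra_simps sin_add sin_diff)
    then show ?thesis by (simp add: I(1)[OF cos_sin_integrable(2) cos_sin_integrable(2)] integral_cos_sin del: of_int_add of_int_diff)
  qed
  consider "m > 0" "n > 0" | "m > 0" "n < 0" | "m < 0" "n > 0" | "m < 0" "n < 0" using assms by linarith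
  then show ?thesis
  proof cases
    case 1
    then show ?thesis using cc[of m n] by (simp add: trig_basis_def s2)
  next
    case 2
    then show ?thesis using sc[of "-n" m] by (simp add: trig_basis_def s2 mult_ac)
  next
    case 3
    then show ?thesis using sc[of "-m" n] by (simp add: trig_basis_def s2)
  next
    case 4
    then show ?thesis using ss[of "-m" "-n"] by (simp add: trig_basis_def s2)
  qed
qed

definition fc :: "(real \<Rightarrow> real) \<Rightarrow> int \<Rightarrow> real" where
  "fc f s = integral {0..1} (\<lambda>x. f x * trig_basis s x)"

definition fidx :: "nat \<Rightarrow> int set" where "fidx N = {s. s \<noteq> 0 \<and> \<bar>s\<bar> \<le> int N}"

lemma finite_fidx: "finite (fidx N)"
  by (rule finite_subset[of _ "{- int N..int N}"]) (auto simp: fidx_def)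

text \<open>The half of Parseval's identity that needs completeness. The remainder
  \<open>r N\<close> is eventually orthogonal to any given trigonometric polynomial, so its pairing
  with \<open>f\<close> is its pairing with \<open>f - p\<close>, which is small because the
  remainder is bounded in L1. The mean of \<open>f\<close> vanishes since \<open>fidx\<close> omits
  the constant mode.\<close>

lemma parseval_approx:
  assumes f: "cper f" and f0: "integral {0..1} f = 0" and e: "e > 0"
  shows "\<exists>N0. \<forall>N\<ge>N0. integral {0..1} (\<lambda>x. (f x)\<^sup>2) \<le> (\<Sum>s\<in>fidx N. (fc f s)\<^sup>2) + e"
proof -
  define S where "S N x = (\<Sum>s\<in>fidx N. fc f s * trig_basis s x)" for N x
  define r where "r N x = f x - S N x" for N x
  define J where "J f = integral {0..1::real} f" for f :: "real \<Rightarrow> real"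
  have Sc: "cper (S N)" for N
  proof -
    have "cper (\<lambda>x. \<Sum>s\<in>A. fc f s * trig_basis s x)" if "finite A" for A
      using that by (induction A rule: finite_induct) (auto intro!: cper_intros trig_basis_cper)
    then show ?thesis unfolding S_def[abs_def] using finite_fidx by blast
  qed
  have rc: "cper (r N)" for N unfolding r_def[abs_def] by (intro cper_intros f Sc)
  have int: "p integrable_on {0..1}" if "cper p" for p using L1pD(4)[OF cper_L1p[OF that]] .
  have JS: "J (\<lambda>x. S N x * q x) = (\<Sum>s\<in>fidx N. fc f s * J (\<lambda>x. trig_basis s x * q x))" if q: "cper q" for N q
  proof -
    have "J (\<lambda>x. S N x * q x) = J (\<lambda>x. \<Sum>s\<in>fidx N. fc f s * (trig_basis s x * q x))"
      by (simp add: S_def sum_distrib_right mult.assoc)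
    also have "\<dots> = (\<Sum>s\<in>fidx N. J (\<lambda>x. fc f s * (trig_basis s x * q x)))"
      unfolding J_def by (intro integral_sum finite_fidx int cper_intros trig_basis_cper q)
    finally show ?thesis by (simp add: J_def)
  qed
  have Jr: "J (\<lambda>x. r N x * q x) = J (\<lambda>x. f x * q x) - J (\<lambda>x. S N x * q x)" if q: "cper q" for N q
    unfolding r_def left_diff_distrib J_def
    by (intro hk_integral_diff int cper_intros(4) f Sc q)
  have orth: "J (\<lambda>x. r N x * trig_basis s x) = 0" if "s \<in> fidx N" for s N
  proof -
    have "J (\<lambda>x. S N x * trig_basis s x) = (\<Sum>s'\<in>fidx N. fc f s' * (if s' = s then 1 else 0))"
      unfolding JS[OF trig_basis_cper] J_def
      by (intro sum.cong refl) (use that in \<open>auto simp: trig_basis_orthonormal fidx_def\<close>)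
    also have "\<dots> = fc f s" using that finite_fidx by (simp add: sum.delta' if_distrib cong: if_cong)
    finally show ?thesis unfolding Jr[OF trig_basis_cper] by (simp add: fc_def J_def)
  qed
  have orth1: "J (\<lambda>x. r N x * 1) = 0" for N
  proof -
    have "J (\<lambda>x. S N x * 1) = 0" unfolding JS[OF cper_intros(1)]
      by (intro sum.neutral) (auto simp: J_def fidx_def integral_trig_basis)
    then show ?thesis unfolding Jr[OF cper_intros(1)] using f0 by (simp add: J_def)
  qed
  have scale: "J (\<lambda>x. r N x * (k * q x)) = k * J (\<lambda>x. r N x * q x)" for N k q
    by (simp add: J_def mult.left_commute[of _ k])
  have orthp: "\<exists>N0. \<forall>N\<ge>N0. J (\<lambda>x. r N x * p x) = 0" if "trig_poly p" for p
    using that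
  proof (induction p rule: trig_poly.induct)
    case (tp_cos n)
    show ?case
    proof (cases "n = 0")
      case True
      then show ?thesis using orth1 by auto
    next
      case False
      have "J (\<lambda>x. r N x * cos (2 * pi * of_int n * x)) = 0" if "N \<ge> nat \<bar>n\<bar>" for N
      proof -
        have "trig_basis \<bar>n\<bar> x = sqrt 2 * cos (2 * pi * of_int n * x)" for x
          using False by (cases "n > 0") (auto simp: trig_basis_def)
        moreover have "\<bar>n\<bar> \<in> fidx N" using that False by (auto simp: fidx_def)
        ultimately show ?thesis using orth[of "\<bar>n\<bar>" N] by (simp add: J_def mult.left_commute[of _ "sqrt 2"])
      qed
      then show ?thesis by blast
    qed
  next
    case (tp_sin n)
    show ?case
    proof (cases "n = 0")
      case True
      then show ?thesis by (auto simp: J_def)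
    next
      case False
      have "J (\<lambda>x. r N x * sin (2 * pi * of_int n * x)) = 0" if "N \<ge> nat \<bar>n\<bar>" for N
      proof -
        define k where "k = sqrt 2 * of_int (sgn n)"
        have eq: "trig_basis (-\<bar>n\<bar>) x = k * sin (2 * pi * of_int n * x)" for x
          using False by (cases "n > 0") (auto simp: trig_basis_def k_def)
        have "-\<bar>n\<bar> \<in> fidx N" using that False by (auto simp: fidx_def)
        from orth[OF this] have "k * J (\<lambda>x. r N x * sin (2 * pi * of_int n * x)) = 0" unfolding eq scale .
        moreover have "k \<noteq> 0" using False by (auto simp: k_def sgn_if)
        ultimately show ?thesis by simp
      qed
      then show ?thesis by blast
    qed
  next
    case (tp_add p q)
    then obtain N1 N2 where "\<And>N. N \<ge> N1 \<Longrightarrow> J (\<lambda>x. r N x * p x) = 0" "\<And>N. N \<ge> N2 \<Longrightarrow> J (\<lambda>x. r N x * q x) = 0" by blast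
    moreover have "J (\<lambda>x. r N x * (p x + q x)) = J (\<lambda>x. r N x * p x) + J (\<lambda>x. r N x * q x)" for N
      unfolding distrib_left J_def
      by (intro hk_integral_add int cper_intros(4) rc tp_cper tp_add.hyps)
    ultimately show ?case by (intro exI[of _ "max N1 N2"]) auto
  next
    case (tp_scale p c)
    then show ?case unfolding scale by auto
  qed
  define n2 where "n2 = J (\<lambda>x. (f x)\<^sup>2)"
  have n20: "n2 \<ge> 0" unfolding n2_def J_def by (intro integral_nonneg int cper_intros f) auto
  have fS: "J (\<lambda>x. S N x * f x) = (\<Sum>s\<in>fidx N. (fc f s)\<^sup>2)" for N
    unfolding JS[OF f] by (simp add: fc_def J_def power2_eq_square mult.commute)
  have rf: "J (\<lambda>x. r N x * f x) = n2 - (\<Sum>s\<in>fidx N. (fc f s)\<^sup>2)" for N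
    unfolding Jr[OF f] fS by (simp add: n2_def power2_eq_square)
  have rS: "J (\<lambda>x. r N x * S N x) = 0" for N
  proof -
    have "J (\<lambda>x. S N x * r N x) = 0" unfolding JS[OF rc]
      by (intro sum.neutral ballI) (use orth in \<open>simp add: mult.commute\<close>)
    then show ?thesis by (simp add: mult.commute)
  qed
  have rr: "J (\<lambda>x. (r N x)\<^sup>2) \<le> n2" for N
  proof -
    have "J (\<lambda>x. (r N x)\<^sup>2) = J (\<lambda>x. r N x * f x - r N x * S N x)" by (simp add: r_def power2_eq_square algebra_simps)
    also have "\<dots> = J (\<lambda>x. r N x * f x) - J (\<lambda>x. r N x * S N x)"
      unfolding J_def by (intro hk_integral_diff int cper_intros(4) rc f Sc)
    also have "\<dots> \<le> n2" unfolding rS rf by (simp add: sum_nonneg)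
    finally show ?thesis .
  qed
  have rL1: "J (\<lambda>x. \<bar>r N x\<bar>) \<le> sqrt n2" for N
  proof -
    have "J (\<lambda>x. \<bar>r N x\<bar>) \<le> H_norm (r N)" unfolding J_def by (rule L1_le_H_norm[OF cper_L2p[OF rc]])
    also have "\<dots> \<le> sqrt n2" unfolding H_norm_eq[OF cper_L2p[OF rc]] using rr by (simp add: J_def)
    finally show ?thesis .
  qed
  define e' where "e' = e / (sqrt n2 + 1)"
  have e': "e' > 0" unfolding e'_def using e n20 by (simp add: add_nonneg_pos)
  obtain p where p: "trig_poly p" "\<And>x. \<bar>f x - p x\<bar> < e'" using trig_poly_dense[OF f e'] by blast
  obtain N0 where N0: "\<And>N. N \<ge> N0 \<Longrightarrow> J (\<lambda>x. r N x * p x) = 0" using orthp[OF p(1)] by blast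
  have "n2 \<le> (\<Sum>s\<in>fidx N. (fc f s)\<^sup>2) + e" if N: "N \<ge> N0" for N
  proof -
    have "J (\<lambda>x. r N x * f x) = J (\<lambda>x. r N x * f x) - J (\<lambda>x. r N x * p x)" using N0[OF N] by simp
    also have "\<dots> = J (\<lambda>x. r N x * f x - r N x * p x)"
      unfolding J_def by (intro hk_integral_diff[symmetric] int cper_intros(4) rc f tp_cper p)
    also have "\<dots> \<le> J (\<lambda>x. e' * \<bar>r N x\<bar>)"
      unfolding J_def
    proof (rule integral_le)
      show "(\<lambda>x. r N x * f x - r N x * p x) integrable_on {0..1}" by (intro int cper_intros(3,4) rc f tp_cper p)
      show "(\<lambda>x. e' * \<bar>r N x\<bar>) integrable_on {0..1}" by (intro integrable_on_mult_right int cper_intros(6) rc)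
      fix x
      have "r N x * f x - r N x * p x \<le> \<bar>r N x * (f x - p x)\<bar>" by (simp add: right_diff_distrib)
      also have "\<dots> \<le> \<bar>r N x\<bar> * e'" unfolding abs_mult using p(2)[of x] by (intro mult_left_mono) auto
      finally show "r N x * f x - r N x * p x \<le> e' * \<bar>r N x\<bar>" by (simp add: mult.commute)
    qed
    also have "\<dots> = e' * J (\<lambda>x. \<bar>r N x\<bar>)" by (simp add: J_def)
    also have "\<dots> \<le> e' * sqrt n2" using rL1 e' by (intro mult_left_mono) auto
    also have "\<dots> = e * (sqrt n2 / (sqrt n2 + 1))" by (simp add: e'_def)
    also have "\<dots> \<le> e * 1"
    proof (rule mult_left_mono)
      have "sqrt n2 \<ge> 0" using n20 by simp
      then have "sqrt n2 + 1 > 0" by linarith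
      then show "sqrt n2 / (sqrt n2 + 1) \<le> 1" by (simp add: divide_le_eq_1_pos)
    qed (use e in simp)
    finally show ?thesis unfolding rf by simp
  qed
  then show ?thesis unfolding n2_def J_def by blast
qed

section \<open>Fourier coefficients and increments\<close>

text \<open>One integration by parts; the resulting constant sqrt 2 / (2 pi) is below 1 and
  dropped.\<close>

lemma fc_bound: assumes f: "ac f g" and n: "n \<noteq> 0"
  shows "\<bar>fc f n\<bar> \<le> integral {0..1} (\<lambda>x. \<bar>g x\<bar>) / \<bar>of_int n\<bar>"
proof -
  define K where "K = integral {0..1} (\<lambda>x. \<bar>g x\<bar>)"
  have n': "- n \<noteq> 0" using n by simp
  have L: "L1p (\<lambda>x. g x * trig_basis (- n) x)" by (rule L2p_mult[OF acD(2)[OF f] cper_L2p[OF trig_basis_cper]])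
  have "integral {0..1} (\<lambda>x. g x * trig_basis (- n) x) = - integral {0..1} (\<lambda>x. f x * (- (2 * pi * of_int (- n)) * trig_basis (- (- n)) x))"
    by (rule ac_parts[OF f trig_basis_ac[OF n']])
  also have "\<dots> = - (2 * pi * of_int n * fc f n)"
    unfolding fc_def integral_mult_right[symmetric] by (simp add: mult_ac)
  finally have 1: "2 * pi * of_int n * fc f n = - integral {0..1} (\<lambda>x. g x * trig_basis (- n) x)" by simp
  have "\<bar>integral {0..1} (\<lambda>x. g x * trig_basis (- n) x)\<bar> \<le> integral {0..1} (\<lambda>x. sqrt 2 * \<bar>g x\<bar>)"
    unfolding real_norm_def[symmetric]
  proof (rule integral_norm_bound_integral)
    show "(\<lambda>x. g x * trig_basis (- n) x) integrable_on {0..1}" by (rule L1pD(4)[OF L])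
    show "(\<lambda>x. sqrt 2 * norm (g x)) integrable_on {0..1}"
      unfolding real_norm_def by (rule integrable_on_mult_right[OF acD(10)[OF f]])
    show "norm (g x * trig_basis (- n) x) \<le> sqrt 2 * norm (g x)" for x
      using mult_left_mono[OF trig_basis_le[of "-n" x], of "\<bar>g x\<bar>"] by (simp add: abs_mult mult.commute)
  qed
  also have "\<dots> = sqrt 2 * K" by (simp add: K_def)
  finally have 2: "\<bar>integral {0..1} (\<lambda>x. g x * trig_basis (- n) x)\<bar> \<le> sqrt 2 * K" .
  have "2 * pi * \<bar>of_int n\<bar> * \<bar>fc f n\<bar> \<le> sqrt 2 * K"
  proof -
    have "2 * pi * \<bar>of_int n\<bar> * \<bar>fc f n\<bar> = \<bar>2 * pi * of_int n * fc f n\<bar>" by (simp add: abs_mult)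
    also have "\<dots> = \<bar>integral {0..1} (\<lambda>x. g x * trig_basis (- n) x)\<bar>" unfolding 1 by (rule abs_minus_cancel)
    finally show ?thesis using 2 by simp
  qed
  moreover have "K \<ge> 0" unfolding K_def by (intro integral_nonneg acD(10)[OF f]) auto
  moreover have "sqrt 2 \<le> 2 * pi" using pi_gt3 sqrt2_less_2 by linarith
  ultimately have "sqrt 2 * K \<le> 2 * pi * K" by (intro mult_right_mono)
  with \<open>2 * pi * \<bar>of_int n\<bar> * \<bar>fc f n\<bar> \<le> sqrt 2 * K\<close> have "2 * pi * \<bar>of_int n\<bar> * \<bar>fc f n\<bar> \<le> 2 * pi * K"
    by (rule order_trans)
  then have "2 * pi * (\<bar>of_int n\<bar> * \<bar>fc f n\<bar>) \<le> 2 * pi * K" by (simp only: mult.assoc)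
  then have "\<bar>of_int n\<bar> * \<bar>fc f n\<bar> \<le> K" by simp
  then show ?thesis using n unfolding K_def by (simp add: field_simps)
qed

lemma fc_bound2: assumes f: "ac f g" and n: "n \<noteq> 0"
  shows "(fc f n)\<^sup>2 \<le> (integral {0..1} (\<lambda>x. \<bar>g x\<bar>))\<^sup>2 / (of_int n)\<^sup>2"
  using power_mono[OF fc_bound[OF assms], of 2] by (simp add: power_divide)

text \<open>Translation by \<open>l\<close> rotates the plane of the modes \<open>n\<close> and
  \<open>- n\<close> by the angle 2 pi n l. Rotation minus identity multiplies squared lengths by (c
  - 1)^2 + s^2 = 2 - 2 c.\<close>

lemma fc_increment:
  assumes f: "cper f" and n: "n > 0"
  shows "(fc (\<lambda>x. f (x + l) - f x) n)\<^sup>2 + (fc (\<lambda>x. f (x + l) - f x) (- n))\<^sup>2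
    = (2 - 2 * cos (2 * pi * of_int n * l)) * ((fc f n)\<^sup>2 + (fc f (- n))\<^sup>2)"
proof -
  define c where "c = cos (2 * pi * of_int n * l)"
  define s where "s = sin (2 * pi * of_int n * l)"
  have sh: "2 * pi * of_int n * (x - l) = 2 * pi * of_int n * x - 2 * pi * of_int n * l" for x
    by (simp add: algebra_simps)
  have e1: "trig_basis n (x - l) - trig_basis n x = (c - 1) * trig_basis n x + s * trig_basis (- n) x" for x
    unfolding trig_basis_def c_def s_def using n by (simp add: sh cos_diff algebra_simps)
  have e2: "trig_basis (- n) (x - l) - trig_basis (- n) x = (c - 1) * trig_basis (- n) x + (- s) * trig_basis n x" for x
    unfolding trig_basis_def c_def s_def using n by (simp add: sh sin_diff algebra_simps)
  have int: "(\<lambda>x. f x * trig_basis m x) integrable_on {0..1}" for m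
    by (rule L1pD(4)[OF cper_L1p[OF cper_intros(4)[OF f trig_basis_cper]]])
  have lin: "integral {0..1} (\<lambda>x. f x * (a * trig_basis m x + b * trig_basis m' x)) = a * fc f m + b * fc f m'" for a b m m'
  proof -
    have "integral {0..1} (\<lambda>x. f x * (a * trig_basis m x + b * trig_basis m' x)) = integral {0..1} (\<lambda>x. a * (f x * trig_basis m x) + b * (f x * trig_basis m' x))"
      by (simp add: algebra_simps)
    also have "\<dots> = a * fc f m + b * fc f m'"
      unfolding fc_def by (subst hk_integral_add[OF integrable_on_mult_right[OF int] integrable_on_mult_right[OF int]]) (simp only: integral_mult_right)
    finally show ?thesis .
  qed
  have fm: "fc (\<lambda>x. f (x + l) - f x) m = integral {0..1} (\<lambda>x. f x * (trig_basis m (x - l) - trig_basis m x))" for m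
    unfolding fc_def by (rule delta_parts[OF cper_L2p[OF f] cper_L2p[OF trig_basis_cper], symmetric])
  have "fc (\<lambda>x. f (x + l) - f x) n = (c - 1) * fc f n + s * fc f (- n)"
    unfolding fm e1 lin ..
  moreover have "fc (\<lambda>x. f (x + l) - f x) (- n) = (c - 1) * fc f (- n) + (- s) * fc f n"
    unfolding fm e2 lin ..
  moreover have "((c - 1) * a + s * b)\<^sup>2 + ((c - 1) * b + (- s) * a)\<^sup>2 = (2 - 2 * c) * (a\<^sup>2 + b\<^sup>2)" for a b
  proof -
    have "((c - 1) * a + s * b)\<^sup>2 + ((c - 1) * b + (- s) * a)\<^sup>2 = ((s\<^sup>2 + c\<^sup>2) + 1 - 2 * c) * (a\<^sup>2 + b\<^sup>2)"
      by (simp add: power2_eq_square algebra_simps)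
    also have "s\<^sup>2 + c\<^sup>2 = 1" unfolding s_def c_def by (rule sin_cos_squared_add)
    finally show ?thesis by simp
  qed
  ultimately show ?thesis unfolding c_def by simp
qed

lemma fidx_sum: "(\<Sum>s\<in>fidx N. F s) = (\<Sum>n\<in>{1..N}. F (int n) + F (- int n) :: real)"
proof -
  have eq: "fidx N = int ` {1..N} \<union> (\<lambda>n. - int n) ` {1..N}"
  proof (intro set_eqI iffI)
    fix s assume s: "s \<in> fidx N"
    show "s \<in> int ` {1..N} \<union> (\<lambda>n. - int n) ` {1..N}"
    proof (cases "s > 0")
      case True
      then have "s = int (nat s)" "nat s \<in> {1..N}" using s by (auto simp: fidx_def)
      then show ?thesis by blast
    next
      case False
      then have "s = - int (nat (-s))" "nat (-s) \<in> {1..N}" using s by (auto simp: fidx_def)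
      then show ?thesis by blast
    qed
  qed (auto simp: fidx_def)
  have "(\<Sum>s\<in>fidx N. F s) = sum F (int ` {1..N}) + sum F ((\<lambda>n. - int n) ` {1..N})"
    unfolding eq by (rule sum.union_disjoint) auto
  also have "sum F (int ` {1..N}) = (\<Sum>n\<in>{1..N}. F (int n))" by (subst sum.reindex) (auto simp: inj_on_def)
  also have "sum F ((\<lambda>n. - int n) ` {1..N}) = (\<Sum>n\<in>{1..N}. F (- int n))" by (subst sum.reindex) (auto simp: inj_on_def)
  finally show ?thesis by (simp add: sum.distrib)
qed

text \<open>Telescoping, from 1 / (N + 1)^2 \<le> 1 / N - 1 / (N + 1).\<close>

lemma inverse_square_tail: assumes "m \<ge> 1" shows "(\<Sum>n\<in>{m<..N}. 1 / (real n)\<^sup>2) \<le> 1 / real m"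
proof -
  have "m \<le> N \<Longrightarrow> (\<Sum>n\<in>{m<..N}. 1 / (real n)\<^sup>2) \<le> 1 / real m - 1 / real N"
  proof (induction N rule: dec_induct)
    case base
    then show ?case by simp
  next
    case (step N)
    have "{m<..Suc N} = insert (Suc N) {m<..N}" using step by auto
    then have "(\<Sum>n\<in>{m<..Suc N}. 1 / (real n)\<^sup>2) = 1 / (real (Suc N))\<^sup>2 + (\<Sum>n\<in>{m<..N}. 1 / (real n)\<^sup>2)" by simp
    moreover have "1 / (real (Suc N))\<^sup>2 \<le> 1 / real N - 1 / real (Suc N)"
    proof -
      have N0: "real N > 0" using step assms by simp
      then have "1 / real N - 1 / real (Suc N) = 1 / (real N * real (Suc N))" by (simp add: field_simps)
      moreover have "1 / (real (Suc N) * real (Suc N)) \<le> 1 / (real N * real (Suc N))" using N0 by (intro divide_left_mono mult_right_mono) auto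
      ultimately show ?thesis by (simp only: power2_eq_square)
    qed
    ultimately show ?case using step.IH by linarith
  qed
  moreover have "0 \<le> 1 / real N" by simp
  moreover have "(\<Sum>n\<in>{m<..N}. 1 / (real n)\<^sup>2) \<le> 1 / real m" if "\<not> m \<le> N" using that by simp
  ultimately show ?thesis by linarith
qed

definition shell :: "real \<Rightarrow> nat \<Rightarrow> int set" where
  "shell M k = {n. real k / M \<le> \<bar>real_of_int n\<bar> \<and> \<bar>real_of_int n\<bar> \<le> M * real k}"

lemma finite_shell: "finite (shell M k)" "M * real k \<ge> 0 \<Longrightarrow> real (card (shell M k)) \<le> 2 * (M * real k) + 1"
proof -
  have sub: "shell M k \<subseteq> {- \<lfloor>M * real k\<rfloor>..\<lfloor>M * real k\<rfloor>}"
    by (auto simp: shell_def le_floor_iff abs_le_iff) (auto simp: minus_le_iff le_floor_iff)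
  then show "finite (shell M k)" by (rule finite_subset) auto
  assume p: "M * real k \<ge> 0"
  have "card (shell M k) \<le> nat (2 * \<lfloor>M * real k\<rfloor> + 1)" using card_mono[OF _ sub] by simp
  then have "real (card (shell M k)) \<le> real_of_int (2 * \<lfloor>M * real k\<rfloor> + 1)" using p by linarith
  also have "\<dots> \<le> 2 * (M * real k) + 1" by simp
  finally show "real (card (shell M k)) \<le> 2 * (M * real k) + 1" .
qed

text \<open>Frequencies below the shell contribute little because \<open>2 - 2 cos y \<le> y\<^sup>2\<close>, those above it because of the
  decay of the coefficients.\<close>

lemma increment_le_shell:
  assumes f: "ac f g" and f0: "integral {0..1} f = 0" and k: "k \<ge> 1" and M: "M > 1"
    and K: "(integral {0..1} (\<lambda>x. \<bar>g x\<bar>))\<^sup>2 \<le> K2"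
  shows "integral {0..1} (\<lambda>x. (f (x + 1 / real k) - f x)\<^sup>2) \<le> 4 * (\<Sum>n\<in>shell M k. (fc f n)\<^sup>2) + (8 * pi\<^sup>2 + 16) * K2 / (M * real k)"
proof (rule field_le_epsilon)
  fix e :: real assume e: "e > 0"
  define l where "l = 1 / real k"
  define \<delta> where "\<delta> x = f (x + l) - f x" for x
  have K0: "K2 \<ge> 0" using K order_trans[OF zero_le_power2] by blast
  have k0: "real k > 0" using k by simp
  have Mk: "M * real k \<ge> 1" using mult_mono[of 1 M 1 "real k"] M k by simp
  have \<delta>c: "cper \<delta>" unfolding \<delta>_def[abs_def] by (rule cper_intros(3)[OF cper_shift(1)[OF acD(6)[OF f]] acD(6)[OF f]])
  have \<delta>0: "integral {0..1} \<delta> = 0" unfolding \<delta>_def[abs_def]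
    using per_integral_shift[OF acD(8)[OF f], of l] L1pD(4)[OF L1p_shift[OF acD(8)[OF f]]] L1pD(4)[OF acD(8)[OF f]]
    by (subst hk_integral_diff) auto
  obtain N where N: "integral {0..1} (\<lambda>x. (\<delta> x)\<^sup>2) \<le> (\<Sum>s\<in>fidx N. (fc \<delta> s)\<^sup>2) + e"
    using parseval_approx[OF \<delta>c \<delta>0 e] by blast
  \<comment> \<open>\<open>A\<close>, \<open>B\<close> and \<open>C\<close> bound the pair of modes
    \<open>n\<close> and \<open>- n\<close> inside, below and above the shell. Below, y^2 times the
    decay K2 / n^2 is independent of \<open>n\<close> and there are at most k / M frequencies,
    giving 8 pi^2 K2 / (M k); above, the tail of 8 K2 / n^2 gives 16 K2 / (M k).\<close>
  define A where "A n = (if n \<in> shell M k then (fc f n)\<^sup>2 else 0)" for n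
  define B where "B n = (if real n < real k / M then 8 * pi\<^sup>2 * K2 / (real k)\<^sup>2 else 0)" for n :: nat
  define C where "C n = (if real n > M * real k then 8 * K2 * (1 / (real n)\<^sup>2) else 0)" for n :: nat
  have termb: "(fc \<delta> (int n))\<^sup>2 + (fc \<delta> (- int n))\<^sup>2 \<le> 4 * (A (int n) + A (- int n)) + B n + C n" if n: "n \<ge> 1" for n
  proof -
    define F where "F = (fc f (int n))\<^sup>2 + (fc f (- int n))\<^sup>2"
    define y where "y = 2 * pi * real n * l"
    have F0: "F \<ge> 0" by (simp add: F_def)
    have n0: "real n > 0" using n by simp
    have FK: "F \<le> 2 * K2 / (real n)\<^sup>2"
    proof -
      have "(fc f m)\<^sup>2 \<le> K2 / (real n)\<^sup>2" if "m = int n \<or> m = - int n" for m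
      proof -
        have "m \<noteq> 0" "(real_of_int m)\<^sup>2 = (real n)\<^sup>2" using that n by auto
        then show ?thesis using fc_bound2[OF f, of m] divide_right_mono[OF K, of "(real n)\<^sup>2"] by simp
      qed
      from this[of "int n"] this[of "- int n"] show ?thesis by (simp add: F_def)
    qed
    have eq: "(fc \<delta> (int n))\<^sup>2 + (fc \<delta> (- int n))\<^sup>2 = (2 - 2 * cos y) * F"
      unfolding \<delta>_def F_def y_def using fc_increment[OF acD(6)[OF f], of "int n" l] n by simp
    have c4: "2 - 2 * cos y \<le> 4" using cos_ge_minus_one[of y] by linarith
    have cy: "2 - 2 * cos y \<le> y\<^sup>2"
    proof -
      have "2 - 2 * cos y = 4 * (sin (y / 2))\<^sup>2" using cos_double_sin[of "y / 2"] by simp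
      also have "\<dots> \<le> 4 * (y / 2)\<^sup>2"
        using power_mono[OF abs_sin_x_le_abs_x[of "y / 2"] abs_ge_zero, of 2] unfolding power2_abs by linarith
      finally show ?thesis by (simp add: power_divide)
    qed
    have BC: "B n \<ge> 0" "C n \<ge> 0" "A m \<ge> 0" for m unfolding A_def B_def C_def using K0 by auto
    have aux: "x \<le> a + y + z" "y \<le> a + y + z" "a \<le> a + y + z" if "0 \<le> a" "0 \<le> y" "0 \<le> z" "x = z" for a x y z :: real
      using that by auto
    have nn: "0 \<le> 4 * (A (int n) + A (- int n))" using BC(3)[of "int n"] BC(3)[of "- int n"] by auto
    consider "real n < real k / M" | "real n > M * real k" | "int n \<in> shell M k" "- int n \<in> shell M k"
      unfolding shell_def by force
    then show ?thesis
    proof cases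
      case 1
      have "(2 - 2 * cos y) * F \<le> y\<^sup>2 * (2 * K2 / (real n)\<^sup>2)"
        using cy FK F0 by (intro mult_mono) auto
      also have "\<dots> = B n" using 1 n0 k0 by (simp add: B_def y_def l_def power_mult_distrib power_divide)
      finally show ?thesis unfolding eq
        by (rule order_trans) (rule aux(2)[OF nn BC(1,2) refl])
    next
      case 2
      have "(2 - 2 * cos y) * F \<le> 4 * (2 * K2 / (real n)\<^sup>2)"
        using c4 FK F0 by (intro mult_mono) auto
      also have "\<dots> = C n" using 2 by (simp add: C_def)
      finally show ?thesis unfolding eq
        by (rule order_trans) (rule aux(1)[OF nn BC(1,2) refl])
    next
      case 3
      have "(2 - 2 * cos y) * F \<le> 4 * F" using c4 F0 by (intro mult_right_mono) auto
      also have "\<dots> = 4 * (A (int n) + A (- int n))" using 3 by (simp add: A_def F_def)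
      finally show ?thesis unfolding eq by (rule order_trans) (rule aux(3)[OF nn BC(1,2) refl])
    qed
  qed
  have SA: "(\<Sum>n\<in>{1..N}. A (int n) + A (- int n)) \<le> (\<Sum>n\<in>shell M k. (fc f n)\<^sup>2)"
  proof -
    have "(\<Sum>n\<in>{1..N}. A (int n) + A (- int n)) = (\<Sum>s\<in>fidx N. A s)" by (rule fidx_sum[symmetric])
    also have "\<dots> = (\<Sum>s\<in>fidx N \<inter> shell M k. (fc f s)\<^sup>2)"
      unfolding A_def using finite_fidx by (subst sum.inter_restrict) auto
    also have "\<dots> \<le> (\<Sum>n\<in>shell M k. (fc f n)\<^sup>2)" by (rule sum_mono2[OF finite_shell(1)]) auto
    finally show ?thesis .
  qed
  have SB: "(\<Sum>n\<in>{1..N}. B n) \<le> 8 * pi\<^sup>2 * K2 / (M * real k)"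
  proof -
    define c where "c = 8 * pi\<^sup>2 * K2 / (real k)\<^sup>2"
    have c0: "c \<ge> 0" unfolding c_def using K0 by simp
    define m where "m = nat \<lfloor>real k / M\<rfloor>"
    have km: "real k / M \<ge> 0" using M by simp
    have "(\<Sum>n\<in>{1..N}. B n) = (\<Sum>n\<in>{n\<in>{1..N}. real n < real k / M}. c)"
      unfolding B_def c_def[symmetric] by (subst sum.inter_filter[symmetric]) auto
    also have "\<dots> = real (card {n\<in>{1..N}. real n < real k / M}) * c" by simp
    also have "\<dots> \<le> real m * c"
    proof (intro mult_right_mono c0)
      have "{n\<in>{1..N}. real n < real k / M} \<subseteq> {1..m}" unfolding m_def using km by (auto simp: le_nat_iff le_floor_iff)
      from card_mono[OF _ this] show "real (card {n\<in>{1..N}. real n < real k / M}) \<le> real m" by simp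
    qed
    also have "\<dots> \<le> real k / M * c" unfolding m_def using km c0 by (intro mult_right_mono) auto
    also have "\<dots> = 8 * pi\<^sup>2 * K2 / (M * real k)" unfolding c_def using k0 M by (simp add: field_simps power2_eq_square)
    finally show ?thesis .
  qed
  have SC: "(\<Sum>n\<in>{1..N}. C n) \<le> 16 * K2 / (M * real k)"
  proof -
    define m where "m = nat \<lfloor>M * real k\<rfloor>"
    \<comment> \<open>Since M k \<ge> 1, rounding down costs at most a factor 2; hence 16 instead of
      8.\<close>
    have m: "m \<ge> 1" "real m \<ge> M * real k / 2"
    proof -
      have f1: "\<lfloor>M * real k\<rfloor> \<ge> 1" using Mk by (simp add: le_floor_iff)
      then have r: "real m = of_int \<lfloor>M * real k\<rfloor>" by (simp add: m_def)
      show "m \<ge> 1" using f1 by (simp add: m_def le_nat_iff)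
      have "of_int \<lfloor>M * real k\<rfloor> \<ge> (1::real)" using f1 by simp
      moreover have "M * real k < of_int \<lfloor>M * real k\<rfloor> + 1" by linarith
      ultimately show "real m \<ge> M * real k / 2" unfolding r by linarith
    qed
    have "(\<Sum>n\<in>{1..N}. C n) = (\<Sum>n\<in>{n\<in>{1..N}. real n > M * real k}. 8 * K2 * (1 / (real n)\<^sup>2))"
      unfolding C_def by (subst sum.inter_filter[symmetric]) auto
    also have "\<dots> \<le> (\<Sum>n\<in>{m<..N}. 8 * K2 * (1 / (real n)\<^sup>2))"
    proof (rule sum_mono2)
      show "{n\<in>{1..N}. real n > M * real k} \<subseteq> {m<..N}"
      proof
        fix n assume n: "n \<in> {n\<in>{1..N}. real n > M * real k}"
        have "real m \<le> M * real k" unfolding m_def using Mk by simp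
        then have "real m < real n" using n by auto
        then show "n \<in> {m<..N}" using n by auto
      qed
    qed (use K0 in auto)
    also have "\<dots> = 8 * K2 * (\<Sum>n\<in>{m<..N}. 1 / (real n)\<^sup>2)" by (simp only: sum_distrib_left)
    also have "\<dots> \<le> 8 * K2 * (1 / real m)" using K0 by (intro mult_left_mono inverse_square_tail m) auto
    also have "\<dots> \<le> 8 * K2 * (2 / (M * real k))"
    proof (intro mult_left_mono)
      have "1 / real m \<le> 1 / (M * real k / 2)" using m Mk by (intro divide_left_mono) auto
      then show "1 / real m \<le> 2 / (M * real k)" by simp
    qed (use K0 in auto)
    finally show ?thesis by simp
  qed
  have "(\<Sum>s\<in>fidx N. (fc \<delta> s)\<^sup>2) = (\<Sum>n\<in>{1..N}. (fc \<delta> (int n))\<^sup>2 + (fc \<delta> (- int n))\<^sup>2)" by (rule fidx_sum)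
  also have "\<dots> \<le> (\<Sum>n\<in>{1..N}. 4 * (A (int n) + A (- int n)) + B n + C n)" by (intro sum_mono termb) auto
  also have "\<dots> = 4 * (\<Sum>n\<in>{1..N}. A (int n) + A (- int n)) + (\<Sum>n\<in>{1..N}. B n) + (\<Sum>n\<in>{1..N}. C n)"
    unfolding sum.distrib[of "\<lambda>n. 4 * (A (int n) + A (- int n)) + B n"] sum.distrib[of "\<lambda>n. 4 * (A (int n) + A (- int n))"]
    by (simp only: sum_distrib_left)
  also have "\<dots> \<le> 4 * (\<Sum>n\<in>shell M k. (fc f n)\<^sup>2) + 8 * pi\<^sup>2 * K2 / (M * real k) + 16 * K2 / (M * real k)"
    using SA SB SC by linarith
  also have "\<dots> = 4 * (\<Sum>n\<in>shell M k. (fc f n)\<^sup>2) + (8 * pi\<^sup>2 + 16) * K2 / (M * real k)"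
    by (simp add: add_divide_distrib distrib_right)
  finally show "integral {0..1} (\<lambda>x. (f (x + 1 / real k) - f x)\<^sup>2) \<le> 4 * (\<Sum>n\<in>shell M k. (fc f n)\<^sup>2) + (8 * pi\<^sup>2 + 16) * K2 / (M * real k) + e"
    using N unfolding \<delta>_def l_def by linarith
qed

section \<open>Averages\<close>

lemma AE_lborel_shift: assumes "AE x in lborel. Pr x" shows "AE x in lborel. Pr (x + h :: real)"
proof -
  have "AE x in distr lborel borel (\<lambda>x. h + x). Pr x" using assms by (simp only: lborel_distr_plus)
  from AE_distrD[OF _ this] show ?thesis by (simp add: add.commute)
qed

lemma fourier_coeff_eq_fc:
  assumes "L2p v" "L2p f" "AE x in lborel. v x = f x" shows "fourier_coeff v s = fc f s"
proof -
  note L = L2p_mult[OF assms(1) cper_L2p[OF trig_basis_cper]] L2p_mult[OF assms(2) cper_L2p[OF trig_basis_cper]]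
  have "integral {0..1} (\<lambda>x. v x * trig_basis s x) = integral {0..1} (\<lambda>x. f x * trig_basis s x)"
    by (rule integral_cong_AE[OF L]) (use assms(3) in \<open>eventually_elim, simp\<close>)
  then show ?thesis unfolding fourier_coeff_def L1pD(6)[OF L(1)] fc_def .
qed

lemma fourier_coeff_bound:
  assumes v: "v \<in> H1_space" and n: "n \<noteq> 0"
  shows "(fourier_coeff v n)\<^sup>2 \<le> (integral {0..1} (\<lambda>x. \<bar>dx v x\<bar>))\<^sup>2 / (of_int n)\<^sup>2"
proof -
  obtain f where f: "ac f (dx v)" "AE x in lborel. v x = f x" using H1_space_ac(1)[OF v] by blast
  have "L2p v" using v H_spaceD(1) by (auto simp: H1_space_def)
  from fourier_coeff_eq_fc[OF this acD(7)[OF f(1)] f(2)] fc_bound2[OF f(1) n] show ?thesis by simp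
qed

text \<open>Passes from the continuous representative to an arbitrary one: the null set where they
  differ stays null after translation.\<close>

lemma increment_le_shell_H1:
  assumes v: "v \<in> H1_space" and k: "k \<ge> 1" and M: "M > 1"
    and K: "(integral {0..1} (\<lambda>x. \<bar>dx v x\<bar>))\<^sup>2 \<le> K2"
  shows "circle_integral (\<lambda>x. \<bar>v (x + 1 / real k) - v x\<bar> powr 2)
    \<le> 4 * (\<Sum>n\<in>shell M k. \<bar>fourier_coeff v n\<bar>\<^sup>2) + (8 * pi\<^sup>2 + 16) * K2 / (M * real k)"
proof -
  obtain f where f: "ac f (dx v)" "AE x in lborel. v x = f x" "integral {0..1} f = 0" using H1_space_ac(1)[OF v] by blast
  have v2: "L2p v" using v H_spaceD(1) by (auto simp: H1_space_def)
  note fcv = fourier_coeff_eq_fc[OF v2 acD(7)[OF f(1)] f(2)]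
  define l where "l = 1 / real k"
  have p2: "\<bar>a\<bar> powr 2 = a\<^sup>2" for a :: real by (cases "a = 0") (auto simp: powr_numeral)
  have L: "L1p (\<lambda>x. (v (x + l) - v x)\<^sup>2)" "L1p (\<lambda>x. (f (x + l) - f x)\<^sup>2)"
    using L2p_intros(2)[OF L2p_intros(6)[OF v2] v2, of l] L2p_intros(2)[OF L2p_intros(6)[OF acD(7)[OF f(1)]] acD(7)[OF f(1)], of l]
    by (simp_all add: L2p_cong)
  have "circle_integral (\<lambda>x. \<bar>v (x + l) - v x\<bar> powr 2) = integral {0..1} (\<lambda>x. (v (x + l) - v x)\<^sup>2)"
    unfolding p2 by (rule L1pD(6)[OF L(1)])
  also have "\<dots> = integral {0..1} (\<lambda>x. (f (x + l) - f x)\<^sup>2)"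
    by (rule integral_cong_AE[OF L]) (use f(2) AE_lborel_shift[OF f(2), of l] in \<open>eventually_elim, simp\<close>)
  also have "\<dots> \<le> 4 * (\<Sum>n\<in>shell M k. (fc f n)\<^sup>2) + (8 * pi\<^sup>2 + 16) * K2 / (M * real k)"
    unfolding l_def by (rule increment_le_shell[OF f(1) f(3) k M K])
  finally show ?thesis unfolding l_def fcv by simp
qed

text \<open>A solution comes with measurability at each time and continuity of almost every path.
  Together with a dominating function these make the expectation of a squared coefficient continuous
  in time, so that \<open>bracket\<close> averages a continuous function.\<close>

lemma fourier_coeff_continuous:
  assumes v: "continuous_H1_path v" and n: "n \<noteq> 0"
  shows "continuous_on {0..} (\<lambda>t. fourier_coeff (v t) n)"
  unfolding continuous_on_def
proof
  fix t :: real assume t: "t \<in> {0..}"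
  have H1: "v s \<in> H1_space" "v s \<in> H_space" if "s \<ge> 0" for s using v that by (auto simp: continuous_H1_path_def H1_space_def)
  have le: "\<bar>fourier_coeff (v s) n - fourier_coeff (v t) n\<bar> \<le> H1_norm (\<lambda>x. v s x - v t x)" if s: "s \<in> {0..}" for s
  proof -
    have s0: "s \<ge> 0" and t0: "t \<ge> 0" using s t by auto
    obtain f where f: "ac f (dx (v s))" "AE x in lborel. v s x = f x" using H1_space_ac(1)[OF H1(1)[OF s0]] by blast
    obtain f' where f': "ac f' (dx (v t))" "AE x in lborel. v t x = f' x" using H1_space_ac(1)[OF H1(1)[OF t0]] by blast
    note a = H_spaceD[OF H1(2)[OF s0]] and b = H_spaceD[OF H1(2)[OF t0]]
    have w: "(\<lambda>x. v s x - v t x) \<in> H_space"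
    proof (rule H_spaceI[OF L2p_intros(2)[OF a(1) b(1)]])
      show "integral {0..1} (\<lambda>x. v s x - v t x) = 0"
        using a(2) b(2) by (subst hk_integral_diff[OF L1pD(4)[OF L2p_L1p[OF a(1)]] L1pD(4)[OF L2p_L1p[OF b(1)]]]) simp
    qed
    have ae: "AE x in lborel. v s x - v t x = f x - f' x" using f(2) f'(2) by eventually_elim simp
    note D = ac_diff[OF f(1) f'(1)]
    note dw = dx_unique[OF w D ae]
    note fw = H1_space_ac(1)[OF dw(1)]
    then obtain h where h: "ac h (dx (\<lambda>x. v s x - v t x))" "AE x in lborel. v s x - v t x = h x" by blast
    have "fourier_coeff (\<lambda>x. v s x - v t x) n = fourier_coeff (v s) n - fourier_coeff (v t) n"
    proof -
      note L = L2p_mult[OF a(1) cper_L2p[OF trig_basis_cper], of n] L2p_mult[OF b(1) cper_L2p[OF trig_basis_cper], of n]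
      show ?thesis unfolding fourier_coeff_def left_diff_distrib L1pD(6)[OF L1p_intros(2)[OF L]] L1pD(6)[OF L(1)] L1pD(6)[OF L(2)]
        by (rule hk_integral_diff[OF L1pD(4)[OF L(1)] L1pD(4)[OF L(2)]])
    qed
    moreover have "fourier_coeff (\<lambda>x. v s x - v t x) n = fc h n"
      by (rule fourier_coeff_eq_fc[OF L2p_intros(2)[OF a(1) b(1)] acD(7)[OF h(1)] h(2)])
    moreover have "\<bar>fc h n\<bar> \<le> integral {0..1} (\<lambda>x. \<bar>dx (\<lambda>x. v s x - v t x) x\<bar>)"
    proof -
      have p: "0 \<le> integral {0..1} (\<lambda>x. \<bar>dx (\<lambda>x. v s x - v t x) x\<bar>)" by (intro integral_nonneg acD(10)[OF h(1)]) auto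
      have "1 \<le> \<bar>real_of_int n\<bar>" using n by auto
      then have "integral {0..1} (\<lambda>x. \<bar>dx (\<lambda>x. v s x - v t x) x\<bar>) / \<bar>real_of_int n\<bar> \<le> integral {0..1} (\<lambda>x. \<bar>dx (\<lambda>x. v s x - v t x) x\<bar>)"
        using p mult_left_mono[of 1 "\<bar>real_of_int n\<bar>"] by (simp add: divide_le_eq)
      then show ?thesis using fc_bound[OF h(1) n] by linarith
    qed
    moreover have "\<dots> \<le> H1_norm (\<lambda>x. v s x - v t x)" unfolding H1_norm_def by (rule L1_le_H_norm[OF acD(2)[OF h(1)]])
    ultimately show ?thesis by simp
  qed
  have "((\<lambda>s. fourier_coeff (v s) n - fourier_coeff (v t) n) \<longlongrightarrow> 0) (at t within {0..})"
  proof (rule Lim_null_comparison)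
    show "((\<lambda>s. H1_norm (\<lambda>x. v s x - v t x)) \<longlongrightarrow> 0) (at t within {0..})" using v t by (auto simp: continuous_H1_path_def)
    show "\<forall>\<^sub>F s in at t within {0..}. norm (fourier_coeff (v s) n - fourier_coeff (v t) n) \<le> H1_norm (\<lambda>x. v s x - v t x)"
      using le by (auto simp: eventually_at_filter)
  qed
  then show "((\<lambda>t. fourier_coeff (v t) n) \<longlongrightarrow> fourier_coeff (v t) n) (at t within {0..})" by (rule LIM_zero_cancel)
qed

text \<open>The estimates see the solution only through the majorant \<open>D\<close> of its squared
  variation; a \<open>D\<close> common to all viscosities therefore makes them uniform.\<close>

lemma averaged_bounds:
  fixes P :: "'w measure"
  assumes P: "prob_space P" and T: "T \<ge> 0" and \<sigma>: "\<sigma> > 0"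
    and D: "integrable P D" "\<And>\<omega>. D \<omega> \<ge> 0"
    and meas: "\<And>t s. t \<ge> 0 \<Longrightarrow> s \<noteq> 0 \<Longrightarrow> (\<lambda>\<omega>. fourier_coeff (u t \<omega>) s) \<in> borel_measurable P"
    and path: "AE \<omega> in P. continuous_H1_path (\<lambda>t. u t \<omega>)"
    and bound: "AE \<omega> in P. \<forall>t\<in>{0..T + \<sigma>}. (integral {0..1} (\<lambda>x. \<bar>dx (u t \<omega>) x\<bar>))\<^sup>2 \<le> D \<omega>"
  defines "a \<equiv> (\<lambda>n. bracket P T \<sigma> (\<lambda>t \<omega>. \<bar>fourier_coeff (u t \<omega>) n\<bar>\<^sup>2))"
  defines "d \<equiv> (LINT \<omega>|P. D \<omega>)"
  shows "n \<noteq> 0 \<Longrightarrow> 0 \<le> a n" "n \<noteq> 0 \<Longrightarrow> a n \<le> d / (of_int n)\<^sup>2"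
    "k \<ge> 1 \<Longrightarrow> M > 1 \<Longrightarrow> structure_function P T \<sigma> u 2 (1 / real k) \<le> 4 * (\<Sum>n\<in>shell M k. a n) + (8 * pi\<^sup>2 + 16) * d / (M * real k)"
proof -
  interpret prob_space P by fact
  define e where "e n t = (LINT \<omega>|P. \<bar>fourier_coeff (u t \<omega>) n\<bar>\<^sup>2)" for n t
  have H1: "AE \<omega> in P. \<forall>t\<ge>0. u t \<omega> \<in> H1_space" using path by eventually_elim (auto simp: continuous_H1_path_def)
  have d0: "d \<ge> 0" unfolding d_def by (intro integral_nonneg_AE) (simp add: D)
  have fb: "AE \<omega> in P. \<forall>t\<in>{0..T + \<sigma>}. \<bar>fourier_coeff (u t \<omega>) n\<bar>\<^sup>2 \<le> D \<omega> / (of_int n)\<^sup>2" if n: "n \<noteq> 0" for n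
    using bound H1
  proof eventually_elim
    case (elim \<omega>)
    show ?case
    proof
      fix t assume t: "t \<in> {0..T + \<sigma>}"
      have "(fourier_coeff (u t \<omega>) n)\<^sup>2 \<le> (integral {0..1} (\<lambda>x. \<bar>dx (u t \<omega>) x\<bar>))\<^sup>2 / (of_int n)\<^sup>2"
        using elim(2) t n by (intro fourier_coeff_bound) auto
      also have "\<dots> \<le> D \<omega> / (of_int n)\<^sup>2" using elim(1) t by (intro divide_right_mono) auto
      finally show "\<bar>fourier_coeff (u t \<omega>) n\<bar>\<^sup>2 \<le> D \<omega> / (of_int n)\<^sup>2" by simp
    qed
  qed
  have Dn: "integrable P (\<lambda>\<omega>. D \<omega> / (of_int n)\<^sup>2)" for n :: int using D(1) by simp
  have int: "integrable P (\<lambda>\<omega>. \<bar>fourier_coeff (u t \<omega>) n\<bar>\<^sup>2)" if n: "n \<noteq> 0" and t: "t \<in> {0..T + \<sigma>}" for n t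
  proof (rule Bochner_Integration.integrable_bound[OF Dn])
    show "(\<lambda>\<omega>. \<bar>fourier_coeff (u t \<omega>) n\<bar>\<^sup>2) \<in> borel_measurable P" using meas[of t n] n t by simp
    show "AE \<omega> in P. norm (\<bar>fourier_coeff (u t \<omega>) n\<bar>\<^sup>2) \<le> norm (D \<omega> / (of_int n)\<^sup>2)"
      using fb[OF n] by eventually_elim (use t D(2) in auto)
  qed
  have e0: "0 \<le> e n t" for n t unfolding e_def by (intro integral_nonneg_AE) simp
  have e_le: "e n t \<le> d / (of_int n)\<^sup>2" if n: "n \<noteq> 0" and t: "t \<in> {0..T + \<sigma>}" for n t
  proof -
    have "e n t \<le> (LINT \<omega>|P. D \<omega> / (of_int n)\<^sup>2)" unfolding e_def
    proof (rule integral_mono_AE[OF int[OF n t] Dn])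
      show "AE \<omega> in P. \<bar>fourier_coeff (u t \<omega>) n\<bar>\<^sup>2 \<le> D \<omega> / (of_int n)\<^sup>2"
        using fb[OF n] by eventually_elim (use t in blast)
    qed
    then show ?thesis by (simp add: d_def)
  qed
  have e_cont: "continuous_on {T..T + \<sigma>} (e n)" if n: "n \<noteq> 0" for n
    unfolding continuous_on_sequentially
  proof (intro allI ballI impI, elim conjE)
    fix \<tau> :: "nat \<Rightarrow> real" and t assume t: "t \<in> {T..T + \<sigma>}" and \<tau>: "\<forall>i. \<tau> i \<in> {T..T + \<sigma>}" "\<tau> \<longlonglongrightarrow> t"
    have t': "t \<in> {0..T + \<sigma>}" "\<tau> i \<in> {0..T + \<sigma>}" for i using t \<tau>(1) T by (auto intro: order_trans)
    show "(e n \<circ> \<tau>) \<longlonglongrightarrow> e n t"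
      unfolding e_def o_def
    proof (rule integral_dominated_convergence[OF _ _ Dn])
      show "(\<lambda>\<omega>. \<bar>fourier_coeff (u t \<omega>) n\<bar>\<^sup>2) \<in> borel_measurable P" using meas[of t n] n t' by simp
      show "(\<lambda>\<omega>. \<bar>fourier_coeff (u (\<tau> i) \<omega>) n\<bar>\<^sup>2) \<in> borel_measurable P" for i using meas[of "\<tau> i" n] n t'(2)[of i] by simp
      show "AE \<omega> in P. norm (\<bar>fourier_coeff (u (\<tau> i) \<omega>) n\<bar>\<^sup>2) \<le> D \<omega> / (of_int n)\<^sup>2" for i
        using fb[OF n] by eventually_elim (use t'(2)[of i] in auto)
      show "AE \<omega> in P. (\<lambda>i. \<bar>fourier_coeff (u (\<tau> i) \<omega>) n\<bar>\<^sup>2) \<longlonglongrightarrow> \<bar>fourier_coeff (u t \<omega>) n\<bar>\<^sup>2"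
        using path
      proof eventually_elim
        case (elim \<omega>)
        have "(\<lambda>i. fourier_coeff (u (\<tau> i) \<omega>) n) \<longlonglongrightarrow> fourier_coeff (u t \<omega>) n"
          by (rule continuous_on_tendsto_compose[OF fourier_coeff_continuous[OF elim n] \<tau>(2)]) (use t' in auto)
        then show ?case by (intro tendsto_intros)
      qed
    qed
  qed
  have si: "set_integrable lborel {T..T + \<sigma>} (e n)" if "n \<noteq> 0" for n
    by (rule borel_integrable_atLeastAtMost'[OF e_cont[OF that]])
  have I: "e n integrable_on {T..T + \<sigma>}" if "n \<noteq> 0" for n
    by (rule integrable_continuous_real[OF e_cont[OF that]])
  have a_eq: "a n = 1 / \<sigma> * integral {T..T + \<sigma>} (e n)" if "n \<noteq> 0" for n
    unfolding a_def bracket_def e_def[symmetric] using set_borel_integral_eq_integral(2)[OF si[OF that]] by simp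
  show "0 \<le> a n" if n: "n \<noteq> 0" for n
    unfolding a_eq[OF n] using \<sigma> by (intro mult_nonneg_nonneg integral_nonneg I n e0) auto
  show "a n \<le> d / (of_int n)\<^sup>2" if n: "n \<noteq> 0" for n
  proof -
    have "integral {T..T + \<sigma>} (e n) \<le> integral {T..T + \<sigma>} (\<lambda>_. d / (of_int n)\<^sup>2)"
      by (intro integral_le I n integrable_const_ivl e_le) (use T in auto)
    also have "\<dots> = \<sigma> * (d / (of_int n)\<^sup>2)" using \<sigma> by simp
    finally show ?thesis unfolding a_eq[OF n] using \<sigma> by (simp add: field_simps)
  qed
  show "structure_function P T \<sigma> u 2 (1 / real k) \<le> 4 * (\<Sum>n\<in>shell M k. a n) + (8 * pi\<^sup>2 + 16) * d / (M * real k)"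
    if k: "k \<ge> 1" and M: "M > 1"
  proof -
    define c where "c = (8 * pi\<^sup>2 + 16) / (M * real k)"
    have c0: "c \<ge> 0" unfolding c_def using M by simp
    \<comment> \<open>As k / M > 0, the shell avoids the index 0, at which the basis and
      \<open>meas\<close> say nothing.\<close>
    have sh0: "n \<noteq> 0" if "n \<in> shell M k" for n using that k M by (auto simp: shell_def divide_le_eq)
    define R where "R t = 4 * (\<Sum>n\<in>shell M k. e n t) + c * d" for t
    have R0: "R t \<ge> 0" for t unfolding R_def using c0 d0 e0 by (intro add_nonneg_nonneg mult_nonneg_nonneg sum_nonneg) auto
    have Rc: "continuous_on {T..T + \<sigma>} R" unfolding R_def by (intro continuous_intros e_cont sh0)
    have inner: "(LINT \<omega>|P. circle_integral (\<lambda>x. \<bar>u t \<omega> (x + 1 / real k) - u t \<omega> x\<bar> powr 2)) \<le> R t" if t: "t \<in> {T..T + \<sigma>}" for t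
    proof -
      have t': "t \<in> {0..T + \<sigma>}" using t T by auto
      have i: "integrable P (\<lambda>\<omega>. 4 * (\<Sum>n\<in>shell M k. \<bar>fourier_coeff (u t \<omega>) n\<bar>\<^sup>2) + c * D \<omega>)"
        by (intro Bochner_Integration.integrable_add integrable_mult_right Bochner_Integration.integrable_sum int sh0 t' D)
      have "(LINT \<omega>|P. circle_integral (\<lambda>x. \<bar>u t \<omega> (x + 1 / real k) - u t \<omega> x\<bar> powr 2)) \<le>
        (LINT \<omega>|P. 4 * (\<Sum>n\<in>shell M k. \<bar>fourier_coeff (u t \<omega>) n\<bar>\<^sup>2) + c * D \<omega>)"
      \<comment> \<open>Only the majorant is known to be integrable in \<omega>. Should the left
        side fail to be, its Bochner integral is 0 by convention, and the nonnegative majorant still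
        dominates; the time integral below is treated the same way.\<close>
      proof (rule integral_mono_AE'[OF i])
        show "AE \<omega> in P. circle_integral (\<lambda>x. \<bar>u t \<omega> (x + 1 / real k) - u t \<omega> x\<bar> powr 2) \<le> 4 * (\<Sum>n\<in>shell M k. \<bar>fourier_coeff (u t \<omega>) n\<bar>\<^sup>2) + c * D \<omega>"
          using bound H1
        proof eventually_elim
          case (elim \<omega>)
          have "u t \<omega> \<in> H1_space" "(integral {0..1} (\<lambda>x. \<bar>dx (u t \<omega>) x\<bar>))\<^sup>2 \<le> D \<omega>" using elim t' by auto
          from increment_le_shell_H1[OF this(1) k M this(2)] show ?case by (simp add: c_def)
        qed
        show "AE \<omega> in P. 0 \<le> 4 * (\<Sum>n\<in>shell M k. \<bar>fourier_coeff (u t \<omega>) n\<bar>\<^sup>2) + c * D \<omega>"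
          using c0 D(2) by (intro AE_I2 add_nonneg_nonneg mult_nonneg_nonneg sum_nonneg) auto
      qed
      also have "\<dots> = R t"
      proof -
        have "(LINT \<omega>|P. 4 * (\<Sum>n\<in>shell M k. \<bar>fourier_coeff (u t \<omega>) n\<bar>\<^sup>2) + c * D \<omega>) =
          (LINT \<omega>|P. 4 * (\<Sum>n\<in>shell M k. \<bar>fourier_coeff (u t \<omega>) n\<bar>\<^sup>2)) + (LINT \<omega>|P. c * D \<omega>)"
          by (intro Bochner_Integration.integral_add integrable_mult_right Bochner_Integration.integrable_sum int sh0 t' D)
        also have "(LINT \<omega>|P. 4 * (\<Sum>n\<in>shell M k. \<bar>fourier_coeff (u t \<omega>) n\<bar>\<^sup>2)) = 4 * (\<Sum>n\<in>shell M k. e n t)"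
          unfolding e_def using Bochner_Integration.integral_sum[of "shell M k" P "\<lambda>n \<omega>. \<bar>fourier_coeff (u t \<omega>) n\<bar>\<^sup>2"] int[OF sh0 t'] by simp
        finally show ?thesis unfolding R_def d_def by simp
      qed
      finally show ?thesis .
    qed
    have "(LINT t:{T..T + \<sigma>}|lborel. (LINT \<omega>|P. circle_integral (\<lambda>x. \<bar>u t \<omega> (x + 1 / real k) - u t \<omega> x\<bar> powr 2))) \<le> (LINT t:{T..T + \<sigma>}|lborel. R t)"
      unfolding set_lebesgue_integral_def
    proof (rule integral_mono')
      show "integrable lborel (\<lambda>t. indicator {T..T + \<sigma>} t *\<^sub>R R t)"
        using borel_integrable_atLeastAtMost'[OF Rc] unfolding set_integrable_def .
    qed (use inner R0 in \<open>auto simp: indicator_def\<close>)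
    also have "\<dots> = integral {T..T + \<sigma>} R"
      by (rule set_borel_integral_eq_integral(2)[OF borel_integrable_atLeastAtMost'[OF Rc]])
    also have "\<dots> = 4 * (\<Sum>n\<in>shell M k. integral {T..T + \<sigma>} (e n)) + \<sigma> * (c * d)"
    proof -
      have sI: "(\<lambda>t. \<Sum>n\<in>shell M k. e n t) integrable_on {T..T + \<sigma>}" by (intro integrable_sum finite_shell I sh0)
      have "integral {T..T + \<sigma>} R = integral {T..T + \<sigma>} (\<lambda>t. 4 * (\<Sum>n\<in>shell M k. e n t)) + integral {T..T + \<sigma>} (\<lambda>t. c * d)"
        unfolding R_def by (rule hk_integral_add[OF integrable_on_mult_right[OF sI] integrable_const_ivl])
      moreover have "integral {T..T + \<sigma>} (\<lambda>t. \<Sum>n\<in>shell M k. e n t) = (\<Sum>n\<in>shell M k. integral {T..T + \<sigma>} (e n))"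
        by (intro integral_sum finite_shell I sh0)
      ultimately show ?thesis using \<sigma> by simp
    qed
    finally have "structure_function P T \<sigma> u 2 (1 / real k) \<le> 1 / \<sigma> * (4 * (\<Sum>n\<in>shell M k. integral {T..T + \<sigma>} (e n)) + \<sigma> * (c * d))"
      unfolding structure_function_def bracket_def using \<sigma> by (intro mult_left_mono) auto
    also have "\<dots> = 4 * (\<Sum>n\<in>shell M k. 1 / \<sigma> * integral {T..T + \<sigma>} (e n)) + c * d"
      using \<sigma> unfolding sum_distrib_left[symmetric] by (simp add: field_simps)
    also have "(\<Sum>n\<in>shell M k. 1 / \<sigma> * integral {T..T + \<sigma>} (e n)) = (\<Sum>n\<in>shell M k. a n)"
      by (intro sum.cong refl) (simp add: a_eq[OF sh0])
    finally show ?thesis by (simp add: c_def)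
  qed
qed

section \<open>Choice of the width M and of the constants in the energy bounds\<close>

theorem mainTheorem5:
  fixes P :: "'w measure"
    and b :: "int \<Rightarrow> real" and \<beta> :: "int \<Rightarrow> real \<Rightarrow> 'w \<Rightarrow> real"
    and u\<^sub>0 :: "real \<Rightarrow> real" and u :: "real \<Rightarrow> real \<Rightarrow> 'w \<Rightarrow> real \<Rightarrow> real"
    and T \<sigma> \<sigma>\<^sub>0 c\<^sub>s c\<^sub>1 c\<^sub>2 :: real
  assumes "prob_space P"
    and "independent_wieners P \<beta>"
    and "\<forall>m\<ge>1. B_finite b m" and "B b 0 > 0"
    and "u\<^sub>0 \<in> H1_space"
    and "\<forall>\<nu>\<in>{0<..1}. burgers_solution P b \<beta> \<nu> u\<^sub>0 (u \<nu>)"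
    and "\<sigma>\<^sub>0 > 0"
    and "\<forall>\<sigma>'\<ge>\<sigma>\<^sub>0. \<forall>T'\<ge>1. \<forall>\<nu>\<in>{0<..1}. \<forall>v\<^sub>0\<in>H1_space. \<forall>v. burgers_solution P b \<beta> \<nu> v\<^sub>0 v \<longrightarrow>
           1 / 4 * B b 0 \<le> \<nu> * bracket P T' \<sigma>' (\<lambda>t \<omega>. (H1_norm (v t \<omega>))\<^sup>2) \<and>
           \<nu> * bracket P T' \<sigma>' (\<lambda>t \<omega>. (H1_norm (v t \<omega>))\<^sup>2) \<le> 3 / 4 * B b 0"
    and "T \<ge> 1" and "\<sigma> \<ge> \<sigma>\<^sub>0"
    and "0 < c\<^sub>s" and "c\<^sub>s \<le> 1" and "c\<^sub>1 > 0" and "c\<^sub>2 > 0"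
    and "\<forall>p>0. \<exists>c>0. \<forall>\<nu>\<in>{0<..c\<^sub>s}. \<forall>l\<in>{c\<^sub>1 * \<nu>..c\<^sub>2}.
           structure_function P T \<sigma> (u \<nu>) p l \<ge> c * l powr min 1 p"
  shows "\<exists>M\<^sub>0>1. \<forall>M\<ge>M\<^sub>0. \<exists>c\<^sub>3>0. \<exists>c\<^sub>4>0. \<forall>\<nu>\<in>{0<..c\<^sub>s}. \<forall>k::nat.
           0 < k \<and> 1 / c\<^sub>2 \<le> real k \<and> real k \<le> 1 / (c\<^sub>1 * \<nu>) \<longrightarrow>
             c\<^sub>3 / (real k)\<^sup>2 \<le> energy P T \<sigma> (u \<nu>) M k \<and>
             energy P T \<sigma> (u \<nu>) M k \<le> c\<^sub>4 / (real k)\<^sup>2"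
proof -
  note P = assms(1) and \<beta> = assms(2) and b = assms(3) and u0 = assms(5) and sol = assms(6)
    and T = assms(9) and \<sigma>ge = assms(10) and cs = assms(11,12) and c1 = assms(13) and c2 = assms(14) and SF = assms(15)
  have \<sigma>: "\<sigma> > 0" using assms(7) \<sigma>ge by linarith
  have L: "T + \<sigma> > 0" using T \<sigma> by linarith
  obtain D where D: "D \<in> borel_measurable P" "(\<integral>\<^sup>+\<omega>. D \<omega> \<partial>P) < \<infinity>"
    "\<And>\<nu>. \<nu> \<in> {0<..1} \<Longrightarrow> AE \<omega> in P. \<forall>t\<in>{0..T + \<sigma>}. ennreal ((integral {0..1} (\<lambda>x. \<bar>dx (u \<nu> t \<omega>) x\<bar>))\<^sup>2) \<le> D \<omega>"
  proof -
    have "B_finite b 4" using b by simp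
    from solution_variation_bound[OF P \<beta> this u0 _ L, of u] sol show thesis using that by blast
  qed
  define Dr where "Dr \<omega> = enn2real (D \<omega>)" for \<omega>
  have Dfin: "AE \<omega> in P. D \<omega> \<noteq> \<infinity>" using D(1,2) by (intro nn_integral_PInf_AE) auto
  have Dr0: "Dr \<omega> \<ge> 0" for \<omega> by (simp add: Dr_def)
  have Dri: "integrable P Dr"
  proof (rule integrableI_nonneg)
    show "Dr \<in> borel_measurable P" unfolding Dr_def using D(1) by measurable
    have "(\<integral>\<^sup>+\<omega>. ennreal (Dr \<omega>) \<partial>P) = (\<integral>\<^sup>+\<omega>. D \<omega> \<partial>P)"
      by (rule nn_integral_cong_AE) (use Dfin in \<open>eventually_elim, simp add: Dr_def less_top\<close>)
    then show "(\<integral>\<^sup>+\<omega>. ennreal (Dr \<omega>) \<partial>P) < \<infinity>" using D(2) by simp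
  qed (simp add: Dr0)
  define d where "d = (LINT \<omega>|P. Dr \<omega>)"
  have d0: "d \<ge> 0" unfolding d_def by (intro integral_nonneg_AE) (simp add: Dr0)
  define a where "a \<nu> n = bracket P T \<sigma> (\<lambda>t \<omega>. \<bar>fourier_coeff (u \<nu> t \<omega>) n\<bar>\<^sup>2)" for \<nu> n
  define C where "C = 8 * pi\<^sup>2 + 16"
  have C0: "C > 0" unfolding C_def by (simp add: add_nonneg_pos)
  have bounds: "n \<noteq> 0 \<Longrightarrow> 0 \<le> a \<nu> n" "n \<noteq> 0 \<Longrightarrow> a \<nu> n \<le> d / (of_int n)\<^sup>2"
    "k \<ge> 1 \<Longrightarrow> M > 1 \<Longrightarrow> structure_function P T \<sigma> (u \<nu>) 2 (1 / real k) \<le> 4 * (\<Sum>n\<in>shell M k. a \<nu> n) + C * d / (M * real k)"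
    if \<nu>: "\<nu> \<in> {0<..c\<^sub>s}" for \<nu> n k M
  proof -
    have \<nu>1: "\<nu> \<in> {0<..1}" using \<nu> cs by auto
    have s: "burgers_solution P b \<beta> \<nu> u\<^sub>0 (u \<nu>)" using sol \<nu>1 by blast
    have m: "(\<lambda>\<omega>. fourier_coeff (u \<nu> t \<omega>) n) \<in> borel_measurable P" if "t \<ge> 0" "n \<noteq> 0" for t n
      using s that by (simp add: burgers_solution_def)
    have "AE \<omega> in P. burgers_path \<nu> u\<^sub>0 (\<lambda>t. force b \<beta> t \<omega>) (\<lambda>t. u \<nu> t \<omega>)" using s by (simp add: burgers_solution_def)
    then have p: "AE \<omega> in P. continuous_H1_path (\<lambda>t. u \<nu> t \<omega>)" by eventually_elim (simp add: burgers_path_def)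
    have bd: "AE \<omega> in P. \<forall>t\<in>{0..T + \<sigma>}. (integral {0..1} (\<lambda>x. \<bar>dx (u \<nu> t \<omega>) x\<bar>))\<^sup>2 \<le> Dr \<omega>"
      using D(3)[OF \<nu>1] Dfin
    proof eventually_elim
      case (elim \<omega>)
      have "ennreal (Dr \<omega>) = D \<omega>" unfolding Dr_def using elim(2) by (simp add: less_top)
      then show ?case using elim(1) Dr0[of \<omega>] by (metis ennreal_le_iff)
    qed
    have T0: "T \<ge> 0" using T by simp
    note ab = averaged_bounds[OF P T0 \<sigma> Dri Dr0 m p bd, folded d_def C_def a_def]
    show "n \<noteq> 0 \<Longrightarrow> 0 \<le> a \<nu> n" "n \<noteq> 0 \<Longrightarrow> a \<nu> n \<le> d / (of_int n)\<^sup>2"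
      "k \<ge> 1 \<Longrightarrow> M > 1 \<Longrightarrow> structure_function P T \<sigma> (u \<nu>) 2 (1 / real k) \<le> 4 * (\<Sum>n\<in>shell M k. a \<nu> n) + C * d / (M * real k)"
      by (rule ab(1), assumption+, rule ab(2), assumption+, rule ab(3), assumption+)
  qed
  \<comment> \<open>At p = 2 the exponent min 1 p is 1, so the structure function at distance 1/k is
    at least c / k.\<close>
  obtain c where c: "c > 0" "\<And>\<nu> l. \<nu> \<in> {0<..c\<^sub>s} \<Longrightarrow> l \<in> {c\<^sub>1 * \<nu>..c\<^sub>2} \<Longrightarrow> structure_function P T \<sigma> (u \<nu>) 2 l \<ge> c * l powr min 1 2"
    using SF[rule_format, of 2] by auto
  have en: "energy P T \<sigma> (u \<nu>) M k = 1 / (2 * real k * (M - 1 / M)) * (1 / 2 * (\<Sum>n\<in>shell M k. a \<nu> n))" for \<nu> M k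
    unfolding energy_def shell_def a_def by (simp only: sum_distrib_left)
  \<comment> \<open>For M \<ge> 2 C d / c the frequencies outside the shell contribute at most C d /
    (M k) \<le> c / (2 k), half of the lower bound for the structure function. Neither
    \<open>d\<close> nor \<open>c\<close> depends on the viscosity. The 2 keeps M - 1 / M
    positive.\<close>
  define M0 where "M0 = max 2 (2 * C * d / c)"
  show ?thesis
  proof (rule exI[of _ M0], intro conjI allI impI)
    show "M0 > 1" by (simp add: M0_def)
    fix M assume "M \<ge> M0"
    then have M: "M \<ge> 2" "M \<ge> 2 * C * d / c" by (auto simp: M0_def)
    have Mp: "M - 1 / M > 0"
    proof -
      have "1 / M < 1" using M by simp
      then show ?thesis using M by linarith
    qed
    \<comment> \<open>From c / k \<le> 4 S + c / (2 k) the shell sum is at least c / (8 k); the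
      prefactor 1 / (2 k (M - 1 / M)) and the 1/2 of the energy supply the rest of 32.\<close>
    define c3 where "c3 = c / (32 * (M - 1 / M))"
    \<comment> \<open>At most 3 M k terms, each at most d M^2 / k^2. Using d + 1 instead of d keeps
      the constant positive when d = 0.\<close>
    define c4 where "c4 = 3 * M ^ 3 * (d + 1) / (4 * (M - 1 / M))"
    have "c3 > 0" "c4 > 0" unfolding c3_def c4_def using c M Mp d0 by auto
    moreover have "c3 / (real k)\<^sup>2 \<le> energy P T \<sigma> (u \<nu>) M k \<and> energy P T \<sigma> (u \<nu>) M k \<le> c4 / (real k)\<^sup>2"
      if \<nu>: "\<nu> \<in> {0<..c\<^sub>s}" and k: "0 < k \<and> 1 / c\<^sub>2 \<le> real k \<and> real k \<le> 1 / (c\<^sub>1 * \<nu>)" for \<nu> k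
    proof -
      have k0: "real k > 0" "real k \<ge> 1" "k \<ge> 1" using k by auto
      have M1: "M > 1" using M by simp
      have \<nu>0: "\<nu> > 0" using \<nu> by simp
      have sh0: "n \<noteq> 0" if "n \<in> shell M k" for n using that k0 M by (auto simp: shell_def divide_le_eq)
      define S where "S = (\<Sum>n\<in>shell M k. a \<nu> n)"
      define w where "w = 1 / (2 * real k * (M - 1 / M))"
      have w0: "w > 0" unfolding w_def using k0 Mp by simp
      have E: "energy P T \<sigma> (u \<nu>) M k = w * (1 / 2 * S)" unfolding en w_def S_def ..
      have "c / (8 * real k) \<le> S"
      proof -
        \<comment> \<open>The admissible range of wave numbers is precisely the one for which 1/k
          lies in the range of the structure function bound.\<close>
        have "1 / real k \<in> {c\<^sub>1 * \<nu>..c\<^sub>2}" using k k0 c1 c2 \<nu>0 by (auto simp: field_simps)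
        from c(2)[OF \<nu> this] have "c * (1 / real k) \<le> structure_function P T \<sigma> (u \<nu>) 2 (1 / real k)"
          using k0 by simp
        also have "\<dots> \<le> 4 * S + C * d / (M * real k)" unfolding S_def by (rule bounds(3)[OF \<nu> k0(3) M1])
        also have "C * d / (M * real k) \<le> c / (2 * real k)"
        proof -
          have "2 * C * d \<le> M * c" using M(2) c(1) by (simp add: divide_le_eq)
          then have "C * d / M \<le> c / 2" using M by (simp add: field_simps)
          then have "C * d / M / real k \<le> c / 2 / real k" using k0 by (intro divide_right_mono) auto
          then show ?thesis by simp
        qed
        finally have "c * (1 / real k) \<le> 4 * S + c / (2 * real k)" by simp
        then show ?thesis using k0 by (simp add: field_simps)
      qed
      then have "w * (1 / 2 * (c / (8 * real k))) \<le> energy P T \<sigma> (u \<nu>) M k"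
        unfolding E using w0 by (intro mult_left_mono) auto
      moreover have "w * (1 / 2 * (c / (8 * real k))) = c3 / (real k)\<^sup>2"
        unfolding w_def c3_def using k0 Mp by (simp add: power2_eq_square)
      ultimately have lower: "c3 / (real k)\<^sup>2 \<le> energy P T \<sigma> (u \<nu>) M k" by simp
      have "S \<le> (\<Sum>n\<in>shell M k. d * M\<^sup>2 / (real k)\<^sup>2)"
        unfolding S_def
      proof (rule sum_mono)
        fix n assume n: "n \<in> shell M k"
        have "(real k / M)\<^sup>2 \<le> \<bar>real_of_int n\<bar>\<^sup>2" using n k0 M by (intro power_mono) (auto simp: shell_def)
        then have "d / (real_of_int n)\<^sup>2 \<le> d / (real k / M)\<^sup>2"
          using sh0[OF n] k0 M d0 by (intro divide_left_mono) auto
        then show "a \<nu> n \<le> d * M\<^sup>2 / (real k)\<^sup>2" using bounds(2)[OF \<nu> sh0[OF n]] by (simp add: power_divide)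
      qed
      also have "\<dots> = real (card (shell M k)) * (d * M\<^sup>2 / (real k)\<^sup>2)" by simp
      also have "\<dots> \<le> (3 * (M * real k)) * ((d + 1) * M\<^sup>2 / (real k)\<^sup>2)"
      proof (rule mult_mono)
        have "1 \<le> M * real k" using mult_mono[of 1 M 1 "real k"] M k0 by simp
        then show "real (card (shell M k)) \<le> 3 * (M * real k)" using finite_shell(2)[of M k] by linarith
      qed (use M k0 d0 in \<open>auto intro!: divide_right_mono mult_right_mono\<close>)
      finally have "w * (1 / 2 * S) \<le> w * (1 / 2 * ((3 * (M * real k)) * ((d + 1) * M\<^sup>2 / (real k)\<^sup>2)))"
        using w0 by (intro mult_left_mono) auto
      also have "\<dots> = c4 / (real k)\<^sup>2"
      proof -
        have "1 / (2 * K * m) * (1 / 2 * ((3 * (M * K)) * ((d + 1) * M\<^sup>2 / K\<^sup>2))) = 3 * M ^ 3 * (d + 1) / (4 * m) / K\<^sup>2"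
          if "K > 0" "m > 0" for K m :: real
          using that by (simp add: field_simps power2_eq_square power3_eq_cube)
        from this[OF k0(1) Mp] show ?thesis unfolding w_def c4_def .
      qed
      finally have "energy P T \<sigma> (u \<nu>) M k \<le> c4 / (real k)\<^sup>2" unfolding E .
      with lower show ?thesis ..
    qed
    ultimately show "\<exists>c\<^sub>3>0. \<exists>c\<^sub>4>0. \<forall>\<nu>\<in>{0<..c\<^sub>s}. \<forall>k::nat.
           0 < k \<and> 1 / c\<^sub>2 \<le> real k \<and> real k \<le> 1 / (c\<^sub>1 * \<nu>) \<longrightarrow>
             c\<^sub>3 / (real k)\<^sup>2 \<le> energy P T \<sigma> (u \<nu>) M k \<and>
             energy P T \<sigma> (u \<nu>) M k \<le> c\<^sub>4 / (real k)\<^sup>2"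
      by blast
  qed
qed

end
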